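(* Let $\sigma>0$, $K\ge1$, and let $\alpha_k=\mathcal{N}(\mathbf{a}_k,\mathbf{A}_k)$, $k=1,\dots,K$, be Gaussian measures on $\mathbb{R}^d$ with $\mathbf{a}_k\in\mathbb{R}^d$, $\mathbf{A}_k\in\mathcal{S}^d_{++}$, and let $w_1,\dots,w_K>0$ be weights with $\sum_{k=1}^Kw_k=1$. Then the weighted debiased barycenter $$\beta=\operatorname*{arg\,min}_{\beta\in\mathcal{G}}\sum_{k=1}^Kw_kS_\sigma(\alpha_k,\beta)$$ is a Gaussian measure $\mathcal{N}\big(\sum_{k=1}^Kw_k\mathbf{a}_k,\mathbf{B}\big)$, where $\mathbf{B}\in\mathcal{S}^d_+$ is a solution of the equation $$\sum_{k=1}^Kw_k\Big(\mathbf{B}^{1/2}\mathbf{A}_k\mathbf{B}^{1/2}+\frac{\sigma^4}{4}\mathrm{Id}\Big)^{1/2}=\Big(\mathbf{B}^2+\frac{\sigma^4}{4}\mathrm{Id}\Big)^{1/2}.$$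
   Context: $\mathcal{S}^d_{++}$ and $\mathcal{S}^d_+$ are the sets of symmetric positive definite and positive semi-definite $d\times d$ real matrices. $\mathcal{P}_2$ is the set of probability measures on $\mathbb{R}^d$ with finite second moment, and $\mathcal{G}=\{\mu\in\mathcal{P}_2:\exists q>0,\ \mathbb{E}_{X\sim\mu}(e^{q\|X\|^2})<+\infty\}$ is the set of sub-Gaussian measures. For $\alpha,\beta\in\mathcal{P}_2$, $$\mathrm{OT}_\sigma(\alpha,\beta)=\min_{\pi\in\Pi(\alpha,\beta)}\int\|x-y\|^2\,d\pi(x,y)+2\sigma^2\int\log\Big(\frac{d\pi}{d\alpha\,d\beta}\Big)d\pi,$$ where $\Pi(\alpha,\beta)$ is the set of couplings of $\alpha$ and $\beta$ (the second term being $+\infty$ if $\pi\not\ll\alpha\otimes\beta$). The Sinkhorn divergence is $$S_\sigma(\alpha,\beta)=\mathrm{OT}_\sigma(\alpha,\beta)-\tfrac12\big(\mathrm{OT}_\sigma(\alpha,\alpha)+\mathrm{OT}_\sigma(\beta,\beta)\big).$$ *)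

theory Defs
  imports "HOL-Probability.Probability"
begin

definition psd :: "real^'d^'d \<Rightarrow> bool" where
  "psd A \<longleftrightarrow> transpose A = A \<and> (\<forall>x. 0 \<le> x \<bullet> (A *v x))"

definition pd :: "real^'d^'d \<Rightarrow> bool" where
  "pd A \<longleftrightarrow> transpose A = A \<and> (\<forall>x. x \<noteq> 0 \<longrightarrow> 0 < x \<bullet> (A *v x))"

(* Meaningful for positive semi-definite A, where such an R exists and is unique. *)
definition msqrt :: "real^'d^'d \<Rightarrow> real^'d^'d" where
  "msqrt A = (THE R. psd R \<and> R ** R = A)"

definition std_gaussian :: "(real^'d) measure" where
  "std_gaussian = density lborel (\<lambda>x. ennreal (\<Prod>i\<in>UNIV. std_normal_density (x $ i)))"

(* N(m, S) for positive semi-definite S, singular S included: the law of m + S^(1/2) Z with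
   Z standard normal. *)
definition gaussian :: "real^'d \<Rightarrow> real^'d^'d \<Rightarrow> (real^'d) measure" where
  "gaussian m S = distr std_gaussian borel (\<lambda>z. m + msqrt S *v z)"

definition P2 :: "(real^'d) measure set" where
  "P2 = {\<mu>. prob_space \<mu> \<and> sets \<mu> = sets borel \<and> integrable \<mu> (\<lambda>x. (norm x)\<^sup>2)}"

definition subgaussian :: "(real^'d) measure set" where
  "subgaussian = {\<mu> \<in> P2. \<exists>q>0. integrable \<mu> (\<lambda>x. exp (q * (norm x)\<^sup>2))}"

definition couplings ::
  "(real^'d) measure \<Rightarrow> (real^'d) measure \<Rightarrow> ((real^'d) \<times> (real^'d)) measure set" where
  "couplings \<alpha> \<beta> =
     {\<pi>. prob_space \<pi> \<and> sets \<pi> = sets (\<alpha> \<Otimes>\<^sub>M \<beta>) \<and>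
         distr \<pi> borel fst = \<alpha> \<and> distr \<pi> borel snd = \<beta>}"

(* The library's KL_divergence is a Bochner integral, hence 0 when the logarithm of the density is
   not integrable. For probability measures its negative part is always integrable, so the
   relative entropy is then +infinity. *)
definition KL :: "'a measure \<Rightarrow> 'a measure \<Rightarrow> ereal" where
  "KL \<pi> \<mu> =
     (if absolutely_continuous \<mu> \<pi> \<and> integrable \<pi> (entropy_density (exp 1) \<mu> \<pi>)
      then ereal (KL_divergence (exp 1) \<mu> \<pi>) else \<infinity>)"

(* The infimum is attained and finite for \<alpha>, \<beta> in P2; finiteness is witnessed by the product
   coupling. *)
definition OT :: "real \<Rightarrow> (real^'d) measure \<Rightarrow> (real^'d) measure \<Rightarrow> ereal" where
  "OT \<sigma> \<alpha> \<beta> =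
     (INF \<pi>\<in>couplings \<alpha> \<beta>.
        enn2ereal (\<integral>\<^sup>+(x, y). ennreal ((norm (x - y))\<^sup>2) \<partial>\<pi>) +
        ereal (2 * \<sigma>\<^sup>2) * KL \<pi> (\<alpha> \<Otimes>\<^sub>M \<beta>))"

definition sinkhorn_div :: "real \<Rightarrow> (real^'d) measure \<Rightarrow> (real^'d) measure \<Rightarrow> ereal" where
  "sinkhorn_div \<sigma> \<alpha> \<beta> = OT \<sigma> \<alpha> \<beta> - ereal (1/2) * (OT \<sigma> \<alpha> \<alpha> + OT \<sigma> \<beta> \<beta>)"

end

theory Submission
  imports Defs
begin

text \<open>Weak duality bounds \<open>OT(\<alpha>, \<beta>)\<close> below by \<open>\<integral>f d\<alpha> + \<integral>g d\<beta>\<close>. For Gaussians the optimal potentials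
  are quadratic, and the equation for \<open>B\<close> says exactly that the potentials \<open>g\<^sub>k\<close> of the pairs
  \<open>(\<alpha>\<^sub>k, \<beta>\<^sup>*)\<close>, \<open>\<beta>\<^sup>* = N(\<Sum> w\<^sub>k a\<^sub>k, B)\<close>, average to the self-potential \<open>h\<close> of \<open>\<beta>\<^sup>*\<close> (up to a constant).
  Since the \<open>g\<^sub>k\<close> are admissible against every \<open>\<beta>\<close>, minimality of \<open>\<beta>\<^sup>*\<close> reduces to
  \<open>OT(\<beta>, \<beta>) \<le> 2 \<integral>h d\<beta>\<close>, which holds because of an explicit self-coupling of \<open>\<beta>\<close>: the kernel
  \<open>exp(-|x - y|\<^sup>2/2\<sigma>\<^sup>2)\<close> is the Gram kernel of narrower Gaussians centred at \<open>x\<close> and \<open>y\<close>, and one couples \<open>x\<close>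
  and \<open>y\<close> through the centre variable. A minimizer attains equality in weak duality against
  \<open>\<alpha>\<^sub>1\<close>; this fixes the Gaussian convolution of \<open>exp(g\<^sub>1/2\<sigma>\<^sup>2) \<beta>\<close>, hence \<open>\<beta>\<close> itself. The equation
  has a positive definite solution by Brouwer's theorem.\<close>

section \<open>Positive definite matrices and their square roots\<close>

text \<open>The obstacle is the debiasing term: \<open>OT \<sigma> \<beta> \<beta>\<close> enters
  with a minus sign, so bounding the objective from below requires bounding this term from above for
  arbitrary \<beta>, in terms of the potential h of the candidate. The Gibbs density built from h
  has the wrong marginals against \<beta> and is multiplied by a correction \<rho>. Since ln \<rho>
  \<le> \<rho> - 1, the correction costs no entropy as soon as the integral of \<rho>^2 against the
  Gibbs density is at most 1. Routing the coupling through a centre variable achieves this: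
  Cauchy-Schwarz in that variable reduces the integral to a quantity that depends on the candidate
  alone. A second difficulty is that B = 0 always solves the matrix equation, so a fixed-point
  argument must stay away from singular matrices. This is why the square-root calculus is developed
  on matrix intervals m Id \<le> A \<le> M Id with m > 0. Gaussian normalising constants are kept
  implicit: translation invariance makes them constant, and Tonelli relates them to each
  other.\<close>

lemma matrix_add_rdistrib: "(B + C) ** A = B ** A + C ** (A :: real^'d^'d)"
  by (vector matrix_matrix_mult_def sum.distrib[symmetric] field_simps)

lemma matrix_diff_ldistrib: "A ** (B - C) = A ** B - A ** (C :: real^'d^'d)"
  by (simp add: vec_eq_iff matrix_matrix_mult_def sum_subtractf[symmetric] field_simps)

lemma matrix_diff_rdistrib: "(B - C) ** A = B ** A - C ** (A :: real^'d^'d)"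
  by (simp add: vec_eq_iff matrix_matrix_mult_def sum_subtractf[symmetric] field_simps)

lemma matrix_scaleR_left: "(c *\<^sub>R A) ** B = c *\<^sub>R (A ** (B :: real^'d^'d))"
  by (simp add: vec_eq_iff matrix_matrix_mult_def sum_distrib_left field_simps)

lemma matrix_scaleR_right: "A ** (c *\<^sub>R B) = c *\<^sub>R (A ** (B :: real^'d^'d))"
  by (simp add: vec_eq_iff matrix_matrix_mult_def sum_distrib_left field_simps)

lemma transpose_add: "transpose (A + B) = transpose A + transpose B"
  by (simp add: vec_eq_iff transpose_def)

lemma transpose_diff: "transpose (A - B) = transpose A - transpose B"
  by (simp add: vec_eq_iff transpose_def)

lemma sum_matrix_vector_mult:
  fixes f :: "'i \<Rightarrow> real^'d^'d"
  shows "(\<Sum>k\<in>I. f k) *v x = (\<Sum>k\<in>I. f k *v x)"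
  by (induction I rule: infinite_finite_induct) (auto simp: matrix_vector_mult_add_rdistrib)

lemma sum_matrix_mult_left:
  fixes f :: "'i \<Rightarrow> real^'d^'d"
  shows "C ** (\<Sum>k\<in>I. f k) = (\<Sum>k\<in>I. C ** f k)"
proof -
  have "C ** (0::real^'d^'d) = 0" by (simp add: vec_eq_iff matrix_matrix_mult_def)
  then show ?thesis
    by (induction I rule: infinite_finite_induct) (auto simp: matrix_add_ldistrib)
qed

lemma sum_matrix_mult_right:
  fixes f :: "'i \<Rightarrow> real^'d^'d" and C :: "real^'d^'d"
  shows "(\<Sum>k\<in>I. f k) ** C = (\<Sum>k\<in>I. f k ** C)"
proof -
  have "(0::real^'d^'d) ** C = 0" by (simp add: vec_eq_iff matrix_matrix_mult_def)
  then show ?thesis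
    by (induction I rule: infinite_finite_induct) (auto simp: matrix_add_rdistrib)
qed

lemmas matrix_ring_simps = matrix_add_ldistrib matrix_add_rdistrib matrix_diff_ldistrib
  matrix_diff_rdistrib matrix_scaleR_left matrix_scaleR_right matrix_mul_assoc

lemmas mv_simps = matrix_vector_mult_add_rdistrib matrix_vector_mult_diff_rdistrib
  matrix_vector_right_distrib matrix_vector_mult_diff_distrib scaleR_matrix_vector_assoc[symmetric]
  matrix_vector_mult_scaleR matrix_vector_mul_assoc[symmetric] inner_add_left inner_add_right
  inner_diff_left inner_diff_right

section \<open>Quadratic forms, Loewner intervals and extremal eigenvalues\<close>

lemma sym_inner:
  fixes A :: "real^'d^'d"
  assumes "transpose A = A"
  shows "(A *v x) \<bullet> y = x \<bullet> (A *v y)"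
  by (metis assms dot_lmul_matrix transpose_matrix_vector)

text \<open>These intervals of the Loewner order are compact and convex, so they serve as the domain
  of both applications of Brouwer's theorem; for \<open>m > 0\<close> they exclude singular
  matrices.\<close>

definition loewner_box :: "real \<Rightarrow> real \<Rightarrow> (real^'d^'d) set" where
  "loewner_box m M = {A. transpose A = A \<and>
     (\<forall>x. m * (x \<bullet> x) \<le> x \<bullet> (A *v x) \<and> x \<bullet> (A *v x) \<le> M * (x \<bullet> x))}"

text \<open>The form of S is evaluated at the gradient step
  \<open>x - (1/L) *\<^sub>R (S *v x)\<close>; expanding it and bounding the last term by L gives
  S^2 \<le> L S without diagonalising S.\<close>

lemma psd_image_le:
  fixes S :: "real^'d^'d"
  assumes S: "psd S" and L: "L > 0" and le: "\<And>x. x \<bullet> (S *v x) \<le> L * (x \<bullet> x)"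
  shows "(S *v x) \<bullet> (S *v x) \<le> L * (x \<bullet> (S *v x))"
proof -
  have sym: "transpose S = S" using S by (simp add: psd_def)
  define y where "y = S *v x"
  have "0 \<le> (x - (1/L) *\<^sub>R y) \<bullet> (S *v (x - (1/L) *\<^sub>R y))"
    using S unfolding psd_def by blast
  also have "\<dots> = x \<bullet> y - (2/L) * (y \<bullet> y) + (1/L\<^sup>2) * (y \<bullet> (S *v y))"
    using sym_inner[OF sym, of x y] L
    by (simp add: mv_simps y_def[symmetric] power2_eq_square inner_commute)
      (simp add: inner_commute y_def field_simps)
  also have "\<dots> \<le> x \<bullet> y - (2/L) * (y \<bullet> y) + (1/L\<^sup>2) * (L * (y \<bullet> y))"
    by (intro add_left_mono mult_left_mono le) auto
  also have "\<dots> = x \<bullet> y - (1/L) * (y \<bullet> y)"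
    using L by (simp add: power2_eq_square field_simps)
  finally have "(y \<bullet> y) / L \<le> x \<bullet> y" by simp
  then show ?thesis using L by (simp add: y_def field_simps)
qed

lemma quadratic_form_le:
  fixes A :: "real^'d^'d"
  shows "\<exists>L>0. \<forall>x. \<bar>x \<bullet> (A *v x)\<bar> \<le> L * (x \<bullet> x)"
proof (intro exI conjI allI)
  let ?L = "onorm ((*v) A) + 1"
  show "?L > 0" using onorm_pos_le[of "(*v) A"] by simp
  fix x
  have "\<bar>x \<bullet> (A *v x)\<bar> \<le> norm x * norm (A *v x)" by (rule Cauchy_Schwarz_ineq2)
  also have "\<dots> \<le> norm x * (onorm ((*v) A) * norm x)"
    by (intro mult_left_mono onorm) auto
  also have "\<dots> \<le> ?L * (x \<bullet> x)"
    by (simp add: dot_square_norm power2_eq_square algebra_simps)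
  finally show "\<bar>x \<bullet> (A *v x)\<bar> \<le> ?L * (x \<bullet> x)" .
qed

lemma psd_form_eq_0:
  fixes S :: "real^'d^'d"
  assumes S: "psd S" and "x \<bullet> (S *v x) = 0"
  shows "S *v x = 0"
proof -
  obtain L where L: "L > 0" "\<forall>x. \<bar>x \<bullet> (S *v x)\<bar> \<le> L * (x \<bullet> x)"
    using quadratic_form_le by blast
  have "(S *v x) \<bullet> (S *v x) \<le> L * (x \<bullet> (S *v x))"
    by (rule psd_image_le[OF S L(1)]) (use L(2) abs_le_iff in blast)
  then show ?thesis using assms(2) by (metis inner_eq_zero_iff inner_ge_zero mult_zero_right order_antisym)
qed

text \<open>If v minimises the form on the unit sphere with value l, then N - l Id is positive
  semi-definite and its form vanishes at v, so v lies in its kernel by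
  \<open>psd_form_eq_0\<close>.\<close>

lemma rayleigh:
  fixes N :: "real^'d^'d"
  assumes sym: "transpose N = N"
  obtains v l where "v \<bullet> v = 1" "N *v v = l *\<^sub>R v" "\<And>x. l * (x \<bullet> x) \<le> x \<bullet> (N *v x)"
proof -
  have "sphere (0::real^'d) 1 \<noteq> {}" by simp
  moreover have "continuous_on (sphere 0 1) (\<lambda>x. x \<bullet> (N *v x))"
    by (intro continuous_intros linear_continuous_on matrix_vector_mul_bounded_linear)
  ultimately obtain v where v: "v \<in> sphere 0 1" "\<And>y. y \<in> sphere 0 1 \<Longrightarrow> v \<bullet> (N *v v) \<le> y \<bullet> (N *v y)"
    using continuous_attains_inf[OF compact_sphere, of 0 1 "\<lambda>x. x \<bullet> (N *v x)"] by blast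
  define l where "l = v \<bullet> (N *v v)"
  have v1: "v \<bullet> v = 1" using v(1) by (simp add: dot_square_norm)
  have le: "l * (x \<bullet> x) \<le> x \<bullet> (N *v x)" for x
  proof (cases "x = 0")
    case False
    define u where "u = (1 / norm x) *\<^sub>R x"
    have "u \<in> sphere 0 1" using False by (simp add: u_def)
    then have "l \<le> u \<bullet> (N *v u)" unfolding l_def by (rule v(2))
    also have "\<dots> = (x \<bullet> (N *v x)) / (x \<bullet> x)"
      by (simp add: u_def mv_simps dot_square_norm power2_eq_square)
    finally show ?thesis using False by (simp add: field_simps)
  qed simp
  have "psd (N - l *\<^sub>R mat 1)"
    unfolding psd_def using sym le by (auto simp: transpose_diff transpose_scalar mv_simps)
  then have "(N - l *\<^sub>R mat 1) *v v = 0"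
    by (rule psd_form_eq_0) (simp add: mv_simps v1 l_def)
  then have "N *v v = l *\<^sub>R v" by (simp add: mv_simps)
  then show ?thesis using that v1 le by blast
qed

lemma pd_lower:
  fixes A :: "real^'d^'d"
  assumes "pd A"
  obtains m where "m > 0" "\<And>x. m * (x \<bullet> x) \<le> x \<bullet> (A *v x)"
proof -
  obtain v l where v: "v \<bullet> v = 1" "A *v v = l *\<^sub>R v" "\<And>x. l * (x \<bullet> x) \<le> x \<bullet> (A *v x)"
    using rayleigh assms unfolding pd_def by metis
  have "v \<noteq> 0" using v(1) by auto
  then have "0 < v \<bullet> (A *v v)" using assms unfolding pd_def by blast
  then have "l > 0" using v by simp
  then show ?thesis using that v(3) by blast
qed

lemma pd_in_box:
  fixes A :: "real^'d^'d"
  assumes "pd A"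
  obtains m M where "m > 0" "m \<le> M" "A \<in> loewner_box m M"
proof -
  obtain m where m: "m > 0" "\<And>x. m * (x \<bullet> x) \<le> x \<bullet> (A *v x)" using pd_lower[OF assms] by blast
  obtain L where L: "L > 0" "\<forall>x. \<bar>x \<bullet> (A *v x)\<bar> \<le> L * (x \<bullet> x)" using quadratic_form_le by blast
  obtain x :: "real^'d" where "norm x = 1" using vector_choose_size[of 1] by auto
  then have x: "x \<bullet> x = 1" by (simp add: dot_square_norm)
  have "m \<le> L" using m(2)[of x] L(2)[rule_format, of x] x by simp
  moreover have "A \<in> loewner_box m L" using assms m(2) L(2) abs_le_iff unfolding loewner_box_def pd_def by blast
  ultimately show ?thesis using that m by blast
qed

lemma box_pd:
  assumes "A \<in> loewner_box m M" "m > 0"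
  shows "pd A"
proof -
  have "0 < x \<bullet> (A *v x)" if "x \<noteq> 0" for x
  proof -
    have "0 < m * (x \<bullet> x)" using that assms by simp
    also have "\<dots> \<le> x \<bullet> (A *v x)" using assms unfolding loewner_box_def by blast
    finally show ?thesis .
  qed
  then show ?thesis using assms unfolding pd_def loewner_box_def by blast
qed

lemma box_mono:
  assumes "A \<in> loewner_box m M" "m' \<le> m" "M \<le> M'"
  shows "A \<in> loewner_box m' M'"
  using assms unfolding loewner_box_def
  by (auto intro: order_trans[OF mult_right_mono] order_trans[OF _ mult_right_mono])

lemma pd_imp_psd: "pd A \<Longrightarrow> psd A"
  unfolding pd_def psd_def by (metis inner_zero_left less_eq_real_def)

text \<open>Boundedness comes from the diagonal: shifting by m gives a semi-definite matrix, and
  \<open>psd_image_le\<close> bounds each of its columns through a diagonal entry.\<close>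

lemma compact_box: "compact (loewner_box m M :: (real^'d^'d) set)"
proof -
  have "closed (loewner_box m M :: (real^'d^'d) set)"
  proof -
    have eq: "loewner_box m M = {A::real^'d^'d. transpose A = A} \<inter>
       (\<Inter>x. {A. m * (x \<bullet> x) \<le> x \<bullet> (A *v x)} \<inter> {A. x \<bullet> (A *v x) \<le> M * (x \<bullet> x)})"
      unfolding loewner_box_def by auto
    have c: "continuous_on UNIV (\<lambda>A::real^'d^'d. x \<bullet> (A *v x))" for x
      unfolding matrix_vector_mult_def inner_vec_def
      by (intro continuous_intros) 
    have t: "continuous_on UNIV (transpose :: real^'d^'d \<Rightarrow> _)"
      unfolding transpose_def by (intro continuous_intros)
    show ?thesis unfolding eq
      by (intro closed_Int closed_INT ballI closed_Collect_eq closed_Collect_le c t continuous_intros)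
  qed
  moreover have "bounded (loewner_box m M :: (real^'d^'d) set)"
  proof -
    \<comment> \<open>The added 1 keeps the constant positive, as \<open>psd_image_le\<close>
      demands, also when M \<le> m.\<close>
    define L where "L = \<bar>M - m\<bar> + 1"
    have ent: "\<bar>A $ i $ j\<bar> \<le> L + \<bar>m\<bar>" if A: "A \<in> loewner_box m M" for A :: "real^'d^'d" and i j
    proof -
      define S where "S = A - m *\<^sub>R mat 1"
      have S: "psd S" using A unfolding psd_def loewner_box_def S_def
        by (auto simp: transpose_diff transpose_scalar mv_simps)
      have up: "x \<bullet> (S *v x) \<le> L * (x \<bullet> x)" for x
      proof -
        have "x \<bullet> (S *v x) \<le> (M - m) * (x \<bullet> x)"
          using A unfolding loewner_box_def S_def by (auto simp: mv_simps algebra_simps)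
        also have "\<dots> \<le> L * (x \<bullet> x)" unfolding L_def by (intro mult_right_mono) auto
        finally show ?thesis .
      qed
      let ?e = "axis j 1 :: real^'d"
      have "norm (S *v ?e) ^ 2 \<le> L * (?e \<bullet> (S *v ?e))"
        using psd_image_le[OF S _ up, of ?e] by (simp add: L_def power2_norm_eq_inner)
      also have "\<dots> \<le> L * (L * (?e \<bullet> ?e))" by (intro mult_left_mono up) (simp add: L_def)
      also have "\<dots> = L\<^sup>2" by (simp add: inner_axis_axis power2_eq_square)
      finally have "norm (S *v ?e) \<le> L" by (rule power2_le_imp_le) (simp add: L_def)
      moreover have "\<bar>(S *v ?e) $ i\<bar> \<le> norm (S *v ?e)" by (rule component_le_norm_cart)
      moreover have "(S *v ?e) $ i = A $ i $ j - (m *\<^sub>R mat 1) $ i $ j"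
        by (simp add: S_def matrix_vector_mult_basis column_def)
      moreover have "\<bar>(m *\<^sub>R mat 1 :: real^'d^'d) $ i $ j\<bar> \<le> \<bar>m\<bar>" by (simp add: mat_def)
      ultimately show ?thesis by linarith
    qed
    have "norm A \<le> (\<Sum>i\<in>(UNIV::'d set). \<Sum>j\<in>(UNIV::'d set). L + \<bar>m\<bar>)" if A: "A \<in> loewner_box m M" for A :: "real^'d^'d"
    proof -
      have "norm A \<le> (\<Sum>i\<in>UNIV. norm (A $ i))" unfolding norm_vec_def by (intro L2_set_le_sum) auto
      also have "\<dots> \<le> (\<Sum>i\<in>UNIV. \<Sum>j\<in>UNIV. \<bar>A $ i $ j\<bar>)" by (intro sum_mono norm_le_l1_cart)
      also have "\<dots> \<le> (\<Sum>i\<in>(UNIV::'d set). \<Sum>j\<in>(UNIV::'d set). L + \<bar>m\<bar>)" by (intro sum_mono ent A)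
      finally show ?thesis .
    qed
    then show ?thesis unfolding bounded_iff by blast
  qed
  ultimately show ?thesis by (simp add: compact_eq_bounded_closed)
qed

lemma convex_box: "convex (loewner_box m M :: (real^'d^'d) set)"
proof (rule convexI)
  fix A B :: "real^'d^'d" and u v :: real
  assume A: "A \<in> loewner_box m M" and B: "B \<in> loewner_box m M" and uv: "0 \<le> u" "0 \<le> v" "u + v = 1"
  have "m * (x \<bullet> x) \<le> u * (x \<bullet> (A *v x)) + v * (x \<bullet> (B *v x)) \<and>
     u * (x \<bullet> (A *v x)) + v * (x \<bullet> (B *v x)) \<le> M * (x \<bullet> x)" for x
  proof -
    have "m * (x \<bullet> x) = u * (m * (x \<bullet> x)) + v * (m * (x \<bullet> x))" "M * (x \<bullet> x) = u * (M * (x \<bullet> x)) + v * (M * (x \<bullet> x))"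
      using uv(3) by (simp_all add: distrib_right[symmetric])
    moreover have "u * (m * (x \<bullet> x)) \<le> u * (x \<bullet> (A *v x))" "u * (x \<bullet> (A *v x)) \<le> u * (M * (x \<bullet> x))"
      using A uv unfolding loewner_box_def by (auto intro: mult_left_mono)
    moreover have "v * (m * (x \<bullet> x)) \<le> v * (x \<bullet> (B *v x))" "v * (x \<bullet> (B *v x)) \<le> v * (M * (x \<bullet> x))"
      using B uv unfolding loewner_box_def by (auto intro: mult_left_mono)
    ultimately show ?thesis by linarith
  qed
  then show "u *\<^sub>R A + v *\<^sub>R B \<in> loewner_box m M"
    using A B unfolding loewner_box_def by (auto simp: mv_simps transpose_add transpose_scalar)
qed

lemma mat_in_box: "c *\<^sub>R mat 1 \<in> loewner_box c (c::real)"
  unfolding loewner_box_def by (auto simp: mv_simps transpose_scalar)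

lemma continuous_on_matrix_mult [continuous_intros]:
  fixes f g :: "'a::topological_space \<Rightarrow> real^'d^'d"
  assumes "continuous_on S f" "continuous_on S g"
  shows "continuous_on S (\<lambda>x. f x ** g x)"
  unfolding matrix_matrix_mult_def by (intro continuous_intros assms)

text \<open>For small \<^term>\<open>t\<close> the map \<open>R \<mapsto> R + t (A - R\<^sup>2)\<close> preserves a Loewner interval, so a square
  root is a Brouwer fixed point; no spectral theorem is needed.\<close>

lemma msqrt_exists_box:
  fixes A :: "real^'d^'d"
  assumes A: "A \<in> loewner_box (m\<^sup>2) (M\<^sup>2)" and m: "0 < m" "m \<le> M"
  shows "\<exists>R \<in> loewner_box m M. R ** R = A"
proof -
  \<comment> \<open>The scalar map r + t (a - r^2) has derivative 1 - 2 t r, so this is the largest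
    t for which it is increasing on [0, M]; monotonicity is what preserves both ends of the
    interval.\<close>
  define t where "t = 1 / (2 * M)"
  have t: "t > 0" "2 * t * M = 1" using m by (auto simp: t_def)
  let ?f = "\<lambda>R. R + t *\<^sub>R (A - R ** R)"
  have "?f R \<in> loewner_box m M" if R: "R \<in> loewner_box m M" for R
  proof -
    have symR: "transpose R = R" and symA: "transpose A = A" using R A by (auto simp: loewner_box_def)
    have sym: "transpose (?f R) = ?f R"
      by (simp add: transpose_add transpose_diff transpose_scalar matrix_transpose_mul symR symA)
    have A1: "m\<^sup>2 * (x \<bullet> x) \<le> x \<bullet> (A *v x)" "x \<bullet> (A *v x) \<le> M\<^sup>2 * (x \<bullet> x)" for x
      using A unfolding loewner_box_def by auto
    have q: "x \<bullet> (?f R *v x) = x \<bullet> (R *v x) + t * (x \<bullet> (A *v x)) - t * ((R *v x) \<bullet> (R *v x))" for x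
      by (simp add: mv_simps sym_inner[OF symR] algebra_simps)
    have lo: "m * (x \<bullet> x) \<le> x \<bullet> (?f R *v x)" for x
    proof -
      define S where "S = R - m *\<^sub>R mat 1"
      have S: "psd S" using R unfolding psd_def loewner_box_def S_def
        by (auto simp: transpose_diff transpose_scalar mv_simps)
      have "x \<bullet> (S *v x) \<le> (M - m) * (x \<bullet> x)" for x
        using R unfolding loewner_box_def S_def by (auto simp: mv_simps algebra_simps)
      moreover have "(M - m) * (x \<bullet> x) \<le> M * (x \<bullet> x)" for x :: "real^'d"
        using m by (intro mult_right_mono) auto
      ultimately have up: "x \<bullet> (S *v x) \<le> M * (x \<bullet> x)" for x using order_trans by blast
      have eps: "(S *v x) \<bullet> (S *v x) \<le> (M - m) * (x \<bullet> (S *v x))"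
      \<comment> \<open>\<open>psd_image_le\<close> wants a positive bound, so the degenerate
        interval is treated apart.\<close>
      proof (cases "M = m")
        case True
        then have "x \<bullet> (S *v x) = 0" using \<open>\<And>x. x \<bullet> (S *v x) \<le> (M - m) * (x \<bullet> x)\<close>[of x] S
          unfolding psd_def by (metis cancel_comm_monoid_add_class.diff_cancel mult_zero_left order_antisym)
        then have "S *v x = 0" by (rule psd_form_eq_0[OF S])
        then show ?thesis by simp
      next
        case False
        then show ?thesis using psd_image_le[OF S _ \<open>\<And>x. x \<bullet> (S *v x) \<le> (M - m) * (x \<bullet> x)\<close>] m by auto
      qed
      have Rx: "R *v x = m *\<^sub>R x + S *v x" by (simp add: S_def mv_simps)
      have RR: "(R *v x) \<bullet> (R *v x) = m\<^sup>2 * (x \<bullet> x) + 2 * m * (x \<bullet> (S *v x)) + (S *v x) \<bullet> (S *v x)"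
        unfolding Rx by (simp add: mv_simps power2_eq_square inner_commute algebra_simps)
      have "0 \<le> x \<bullet> (S *v x)" using S unfolding psd_def by blast
      have "t * ((R *v x) \<bullet> (R *v x)) \<le> t * (m\<^sup>2 * (x \<bullet> x) + 2 * m * (x \<bullet> (S *v x)) + (M - m) * (x \<bullet> (S *v x)))"
        unfolding RR using eps t(1) by (intro mult_left_mono) auto
      also have "\<dots> = t * m\<^sup>2 * (x \<bullet> x) + t * (M + m) * (x \<bullet> (S *v x))" by (simp add: algebra_simps)
      also have "\<dots> \<le> t * m\<^sup>2 * (x \<bullet> x) + 1 * (x \<bullet> (S *v x))"
      proof (intro add_left_mono mult_right_mono)
        have "t * (M + m) \<le> t * (2 * M)" using m t(1) by (intro mult_left_mono) auto
        then show "t * (M + m) \<le> 1" using t(2) by (simp add: algebra_simps)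
      qed fact
      finally have "t * ((R *v x) \<bullet> (R *v x)) \<le> t * m\<^sup>2 * (x \<bullet> x) + 1 * (x \<bullet> (S *v x))" .
      moreover have "t * (m\<^sup>2 * (x \<bullet> x)) \<le> t * (x \<bullet> (A *v x))"
        using t(1) by (intro mult_left_mono A1) auto
      moreover have "x \<bullet> (R *v x) = m * (x \<bullet> x) + x \<bullet> (S *v x)" by (simp add: Rx mv_simps)
      ultimately show ?thesis unfolding q by (simp add: mult.assoc)
    qed
    have hi: "x \<bullet> (?f R *v x) \<le> M * (x \<bullet> x)" for x
    proof -
      define S where "S = M *\<^sub>R mat 1 - R"
      have Rx: "R *v x = M *\<^sub>R x - S *v x" by (simp add: S_def mv_simps)
      have RR: "(R *v x) \<bullet> (R *v x) = M\<^sup>2 * (x \<bullet> x) - 2 * M * (x \<bullet> (S *v x)) + (S *v x) \<bullet> (S *v x)"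
        unfolding Rx by (simp add: mv_simps power2_eq_square inner_commute algebra_simps)
      have "t * ((R *v x) \<bullet> (R *v x)) \<ge> t * (M\<^sup>2 * (x \<bullet> x) - 2 * M * (x \<bullet> (S *v x)))"
        unfolding RR using t(1) by (intro mult_left_mono) auto
      moreover have "t * (M\<^sup>2 * (x \<bullet> x) - 2 * M * (x \<bullet> (S *v x))) = t * (M\<^sup>2 * (x \<bullet> x)) - (2 * t * M) * (x \<bullet> (S *v x))"
        by (simp add: algebra_simps)
      ultimately have "t * ((R *v x) \<bullet> (R *v x)) \<ge> t * (M\<^sup>2 * (x \<bullet> x)) - x \<bullet> (S *v x)"
        unfolding t(2) by simp
      moreover have "t * (x \<bullet> (A *v x)) \<le> t * (M\<^sup>2 * (x \<bullet> x))"
        using t(1) by (intro mult_left_mono A1) auto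
      moreover have "x \<bullet> (R *v x) = M * (x \<bullet> x) - x \<bullet> (S *v x)" by (simp add: Rx mv_simps)
      ultimately show ?thesis unfolding q by linarith
    qed
    show ?thesis unfolding loewner_box_def using sym lo hi by blast
  qed
  then have "?f \<in> loewner_box m M \<rightarrow> loewner_box m M" by blast
  moreover have "loewner_box m M \<noteq> ({} :: (real^'d^'d) set)"
    using box_mono[OF mat_in_box, of m m M] m by blast
  moreover have "continuous_on (loewner_box m M) ?f" by (intro continuous_intros)
  ultimately have "\<exists>R\<in>loewner_box m M. ?f R = R"
    using brouwer[OF compact_box convex_box, where f = ?f] by blast
  then obtain R where "R \<in> loewner_box m M" "?f R = R" by blast
  then show ?thesis using t(1) by (intro bexI[of _ R]) auto
qed

text \<open>Multiplying by the transpose of D and taking traces gives a vanishing sum of two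
  nonnegative numbers; definiteness of \<open>N1\<close> then kills D column by column. This yields
  uniqueness of roots and, later, that a root commutes with whatever its square commutes
  with.\<close>

lemma sylvester_eq_0:
  fixes D N1 N2 :: "real^'d^'d"
  assumes "pd N1" "pd N2" and eq: "N1 ** D + D ** N2 = 0"
  shows "D = 0"
proof -
  have tr: "trace (transpose X ** N ** X) = (\<Sum>i\<in>UNIV. (X *v axis i 1) \<bullet> (N *v (X *v axis i 1)))"
    for X N :: "real^'d^'d"
  proof -
    have "(transpose X ** N ** X) $ i $ i = (X *v axis i 1) \<bullet> (N *v (X *v axis i 1))" for i
    proof -
      have "(transpose X ** N ** X) $ i $ i = axis i 1 \<bullet> ((transpose X ** N ** X) *v axis i 1)"
        by (simp add: inner_axis' matrix_vector_mult_basis column_def)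
      also have "\<dots> = axis i 1 \<bullet> (transpose X *v (N *v (X *v axis i 1)))"
        by (simp only: matrix_vector_mul_assoc matrix_mul_assoc)
      also have "\<dots> = (X *v axis i 1) \<bullet> (N *v (X *v axis i 1))"
        by (metis dot_lmul_matrix vector_transpose_matrix)
      finally show ?thesis .
    qed
    then show ?thesis unfolding trace_def by simp
  qed
  have pos: "0 \<le> trace (transpose X ** N ** X)" if "pd N" for X N :: "real^'d^'d"
    unfolding tr using pd_imp_psd[OF that] by (intro sum_nonneg) (auto simp: psd_def)
  have 0: "transpose D ** (N1 ** D + D ** N2) = 0"
    unfolding eq by (simp add: vec_eq_iff matrix_matrix_mult_def)
  have "trace (transpose D ** N1 ** D) + trace (D ** N2 ** transpose D) = 0"
  proof -
    have "trace (D ** N2 ** transpose D) = trace (transpose D ** (D ** N2))" by (rule trace_mul_sym)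
    then have "trace (transpose D ** N1 ** D) + trace (D ** N2 ** transpose D) = trace (transpose D ** (N1 ** D + D ** N2))"
      by (simp add: trace_add matrix_add_ldistrib matrix_mul_assoc)
    then show ?thesis unfolding 0 by (simp add: trace_def)
  qed
  moreover have "0 \<le> trace (D ** N2 ** transpose D)" using pos[OF assms(2), of "transpose D"] by simp
  ultimately have "trace (transpose D ** N1 ** D) = 0" using pos[OF assms(1), of D] by linarith
  then have "(D *v axis i 1) \<bullet> (N1 *v (D *v axis i 1)) = 0" for i
    unfolding tr using pd_imp_psd[OF assms(1)]
    by (subst (asm) sum_nonneg_eq_0_iff) (auto simp: psd_def)
  then have "D *v axis i 1 = 0" for i using assms(1) unfolding pd_def by (metis less_irrefl)
  then have "column i D = 0" for i by (simp add: matrix_vector_mult_basis)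
  then show ?thesis by (simp add: vec_eq_iff column_def)
qed

lemma psd_root_pd:
  assumes "psd R" "R ** R = A" "pd A"
  shows "pd (R :: real^'d^'d)"
proof -
  have "0 < x \<bullet> (R *v x)" if "x \<noteq> 0" for x
  proof (rule ccontr)
    assume "\<not> 0 < x \<bullet> (R *v x)"
    then have "x \<bullet> (R *v x) = 0" using assms(1) unfolding psd_def by (metis less_eq_real_def)
    then have "R *v x = 0" using psd_form_eq_0 assms(1) by blast
    then have "A *v x = 0" by (simp add: assms(2)[symmetric] matrix_vector_mul_assoc[symmetric])
    then show False using assms(3) that unfolding pd_def by (metis inner_zero_right less_irrefl)
  qed
  then show ?thesis using assms(1) unfolding psd_def pd_def by blast
qed

text \<open>R^2 - S^2 = R (R - S) + (R - S) S holds without commutativity, so the difference of two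
  roots solves a Sylvester equation.\<close>

lemma root_unique:
  fixes A :: "real^'d^'d"
  assumes "pd A" "psd R" "R ** R = A" "psd S" "S ** S = A"
  shows "R = S"
proof -
  have "pd R" "pd S" using psd_root_pd assms by blast+
  moreover have "R ** (R - S) + (R - S) ** S = 0"
    by (simp add: matrix_ring_simps assms)
  ultimately have "R - S = 0" by (rule sylvester_eq_0)
  then show ?thesis by simp
qed

lemma msqrt_eqI:
  assumes "pd A" "psd R" "R ** R = A"
  shows "msqrt A = R"
  unfolding msqrt_def using assms root_unique by (intro the_equality) blast+

lemma msqrt_in_box:
  fixes A :: "real^'d^'d"
  assumes A: "A \<in> loewner_box (m\<^sup>2) (M\<^sup>2)" and m: "0 < m" "m \<le> M"
  shows "msqrt A \<in> loewner_box m M" "msqrt A ** msqrt A = A"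
proof -
  obtain R where R: "R \<in> loewner_box m M" "R ** R = A" using msqrt_exists_box[OF assms] by blast
  have "pd A" using box_pd[OF A] m by simp
  moreover have "psd R" using box_pd[OF R(1) m(1)] by (rule pd_imp_psd)
  ultimately have "msqrt A = R" using R(2) by (intro msqrt_eqI)
  then show "msqrt A \<in> loewner_box m M" "msqrt A ** msqrt A = A" using R by auto
qed

lemma msqrt_pd:
  fixes A :: "real^'d^'d"
  assumes "pd A"
  shows "pd (msqrt A)" "msqrt A ** msqrt A = A"
proof -
  obtain m M where m: "m > 0" "m \<le> M" "A \<in> loewner_box m M" using pd_in_box[OF assms] by blast
  then have A: "A \<in> loewner_box ((sqrt m)\<^sup>2) ((sqrt M)\<^sup>2)" by simp
  have sm: "0 < sqrt m" "sqrt m \<le> sqrt M" using m by auto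
  show "msqrt A ** msqrt A = A" using msqrt_in_box[OF A sm] by blast
  show "pd (msqrt A)" using msqrt_in_box[OF A sm] box_pd sm by blast
qed

text \<open>A continuous injection on a compact set has a continuous inverse: \<open>msqrt\<close>
  inverts squaring on \<open>loewner_box m M\<close>, and the image contains the interval with
  squared bounds.\<close>

lemma continuous_on_msqrt:
  assumes "0 < m" "m \<le> M"
  shows "continuous_on (loewner_box (m\<^sup>2) (M\<^sup>2) :: (real^'d^'d) set) msqrt"
proof (rule continuous_on_subset)
  show "continuous_on ((\<lambda>R. R ** R) ` (loewner_box m M :: (real^'d^'d) set)) msqrt"
  proof (rule continuous_on_inv)
    show "continuous_on (loewner_box m M) (\<lambda>R::real^'d^'d. R ** R)" by (intro continuous_intros)
    show "compact (loewner_box m M :: (real^'d^'d) set)" by (rule compact_box)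
    show "\<forall>R\<in>loewner_box m M. msqrt (R ** R) = (R :: real^'d^'d)"
    proof
      fix R :: "real^'d^'d" assume "R \<in> loewner_box m M"
      then have R: "pd R" using box_pd assms by blast
      have "0 < x \<bullet> ((R ** R) *v x)" if "x \<noteq> 0" for x
      proof -
        have "0 < x \<bullet> (R *v x)" using R that unfolding pd_def by blast
        then have "R *v x \<noteq> 0" by auto
        then have "0 < (R *v x) \<bullet> (R *v x)" by simp
        moreover have "(R *v x) \<bullet> (R *v x) = x \<bullet> ((R ** R) *v x)"
          using R by (simp add: pd_def sym_inner matrix_vector_mul_assoc)
        ultimately show ?thesis by simp
      qed
      then have "pd (R ** R)" using R by (simp add: pd_def matrix_transpose_mul)
      then show "msqrt (R ** R) = R" using pd_imp_psd[OF R] by (intro msqrt_eqI) auto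
    qed
  qed
  show "loewner_box (m\<^sup>2) (M\<^sup>2) \<subseteq> (\<lambda>R. R ** R) ` (loewner_box m M :: (real^'d^'d) set)"
    using msqrt_exists_box[OF _ assms] by blast
qed

section \<open>The fixed-point equation\<close>

text \<open>Squaring is not monotone in the Loewner order, but scalar bounds survive it: the upper
  one by \<open>psd_image_le\<close>, the lower one by Cauchy-Schwarz.\<close>

lemma box_square:
  fixes N :: "real^'d^'d"
  assumes N: "N \<in> loewner_box p q" and p: "0 < p" "p \<le> q"
  shows "N ** N \<in> loewner_box (p\<^sup>2) (q\<^sup>2)"
proof -
  have sym: "transpose N = N" using N by (simp add: loewner_box_def)
  have sq: "x \<bullet> ((N ** N) *v x) = (N *v x) \<bullet> (N *v x)" for x
    by (simp add: matrix_vector_mul_assoc[symmetric] sym_inner[OF sym])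
  have up: "x \<bullet> (N *v x) \<le> q * (x \<bullet> x)" for x using N by (simp add: loewner_box_def)
  have "x \<bullet> ((N ** N) *v x) \<le> q\<^sup>2 * (x \<bullet> x)" for x
  proof -
    have "(N *v x) \<bullet> (N *v x) \<le> q * (x \<bullet> (N *v x))"
      using pd_imp_psd[OF box_pd[OF N p(1)]] p up by (intro psd_image_le) auto
    also have "\<dots> \<le> q * (q * (x \<bullet> x))" using up p by (intro mult_left_mono) auto
    finally show ?thesis by (simp add: sq power2_eq_square)
  qed
  moreover have "p\<^sup>2 * (x \<bullet> x) \<le> x \<bullet> ((N ** N) *v x)" for x
  proof (cases "x = 0")
    case False
    have "p * (norm x * norm x) \<le> x \<bullet> (N *v x)"
      using N by (simp add: loewner_box_def dot_square_norm power2_eq_square)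
    also have "\<dots> \<le> norm x * norm (N *v x)" by (rule norm_cauchy_schwarz)
    finally have "p * norm x \<le> norm (N *v x)" using False by (simp add: field_simps)
    then have "(p * norm x)\<^sup>2 \<le> (norm (N *v x))\<^sup>2" using p by (intro power_mono) auto
    then show ?thesis by (simp add: sq dot_square_norm power_mult_distrib)
  qed simp
  moreover have "transpose (N ** N) = N ** N" by (simp add: matrix_transpose_mul sym)
  ultimately show ?thesis unfolding loewner_box_def by blast
qed

lemma box_shift:
  assumes "A \<in> loewner_box m M"
  shows "A + c *\<^sub>R mat 1 \<in> loewner_box (m + c) (M + c)"
  using assms unfolding loewner_box_def
  by (auto simp: transpose_add transpose_scalar mv_simps algebra_simps)

lemma box_sum:
  fixes N :: "'i \<Rightarrow> real^'d^'d"
  assumes "finite I" "\<And>k. k \<in> I \<Longrightarrow> N k \<in> loewner_box m M" "\<And>k. k \<in> I \<Longrightarrow> 0 \<le> w k" "sum w I = 1"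
  shows "(\<Sum>k\<in>I. w k *\<^sub>R N k) \<in> loewner_box m M"
  using convex_sum[OF assms(1) convex_box] assms by metis

text \<open>With R the root of B, the form of R A R at x is the form of A at R x, and |R x|^2 is the
  form of B at x, so the scalar bounds of A and B multiply.\<close>

lemma box_congruence:
  fixes A B :: "real^'d^'d"
  assumes A: "A \<in> loewner_box m M" and B: "B \<in> loewner_box m M" and m: "0 < m" "m \<le> M"
  shows "msqrt B ** A ** msqrt B \<in> loewner_box (m\<^sup>2) (M\<^sup>2)"
proof -
  define R where "R = msqrt B"
  have "pd B" using box_pd B m by blast
  then have RR: "R ** R = B" and sym: "transpose R = R" using msqrt_pd by (auto simp: R_def pd_def)
  have n: "(R *v x) \<bullet> (R *v x) = x \<bullet> (B *v x)" for x
    by (simp add: RR[symmetric] matrix_vector_mul_assoc[symmetric] sym_inner[OF sym])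
  have q: "x \<bullet> ((R ** A ** R) *v x) = (R *v x) \<bullet> (A *v (R *v x))" for x
    by (simp add: matrix_vector_mul_assoc[symmetric] sym_inner[OF sym])
  have "m\<^sup>2 * (x \<bullet> x) \<le> x \<bullet> ((R ** A ** R) *v x)" for x
  proof -
    have "m * (m * (x \<bullet> x)) \<le> m * ((R *v x) \<bullet> (R *v x))"
      unfolding n using B m by (intro mult_left_mono) (auto simp: loewner_box_def)
    also have "\<dots> \<le> (R *v x) \<bullet> (A *v (R *v x))" using A by (simp add: loewner_box_def)
    finally show ?thesis by (simp add: q power2_eq_square)
  qed
  moreover have "x \<bullet> ((R ** A ** R) *v x) \<le> M\<^sup>2 * (x \<bullet> x)" for x
  proof -
    have "(R *v x) \<bullet> (A *v (R *v x)) \<le> M * ((R *v x) \<bullet> (R *v x))" using A by (simp add: loewner_box_def)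
    also have "\<dots> \<le> M * (M * (x \<bullet> x))"
      unfolding n using B m by (intro mult_left_mono) (auto simp: loewner_box_def)
    finally show ?thesis by (simp add: q power2_eq_square)
  qed
  moreover have "transpose (R ** A ** R) = R ** A ** R"
    using A sym by (simp add: matrix_transpose_mul loewner_box_def matrix_mul_assoc)
  ultimately show ?thesis unfolding loewner_box_def R_def by blast
qed

text \<open>The equation always has the solution B = 0, so the fixed point is sought in an interval
  bounded away from 0; any interval m Id \<le> X \<le> M Id with m > 0 that contains all
  \<open>A k\<close> is invariant. The map solves the equation for the B on its right-hand side:
  square the left-hand side, subtract s^2 Id, take the root.\<close>

lemma barycenter_equation_solvable:
  fixes A :: "'i \<Rightarrow> real^'d^'d" and w :: "'i \<Rightarrow> real" and s :: real
  assumes I: "finite I" and A: "\<And>k. k \<in> I \<Longrightarrow> pd (A k)"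
    and w: "\<And>k. k \<in> I \<Longrightarrow> 0 \<le> w k" "sum w I = 1"
  shows "\<exists>B. pd B \<and> (\<Sum>k\<in>I. w k *\<^sub>R msqrt (msqrt B ** A k ** msqrt B + s\<^sup>2 *\<^sub>R mat 1))
      = msqrt (B ** B + s\<^sup>2 *\<^sub>R mat 1)"
proof -
  have ne: "I \<noteq> {}" using w(2) by auto
  have "\<forall>k\<in>I. \<exists>m M. 0 < m \<and> m \<le> M \<and> A k \<in> loewner_box m M"
    using pd_in_box[OF A] by blast
  then obtain mm MM where mM: "\<And>k. k \<in> I \<Longrightarrow> 0 < mm k \<and> mm k \<le> MM k \<and> A k \<in> loewner_box (mm k) (MM k)"
    by metis
  define m where "m = Min (mm ` I)"
  define M where "M = Max (MM ` I)"
  have mk: "m \<le> mm k" "MM k \<le> M" if "k \<in> I" for k using that I by (auto simp: m_def M_def)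
  have "m \<in> mm ` I" unfolding m_def using I ne by (intro Min_in) auto
  then have m0: "0 < m" using mM by auto
  obtain k0 where "k0 \<in> I" using ne by blast
  then have mleM: "m \<le> M" using mM[of k0] mk[of k0] by linarith
  have AB: "A k \<in> loewner_box m M" if "k \<in> I" for k using mM[OF that] mk[OF that] box_mono by blast
  \<comment> \<open>Bounds after adding s^2 and taking a root. Averaging preserves [p, q], and
    undoing the two operations returns exactly to [m, M], so \<Phi> maps the interval into
    itself.\<close>
  define p where "p = sqrt (m\<^sup>2 + s\<^sup>2)"
  define q where "q = sqrt (M\<^sup>2 + s\<^sup>2)"
  have p2: "p\<^sup>2 = m\<^sup>2 + s\<^sup>2" and q2: "q\<^sup>2 = M\<^sup>2 + s\<^sup>2" by (auto simp: p_def q_def)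
  have p0: "0 < p" using m0 by (simp add: p_def add_pos_nonneg)
  have pq: "p \<le> q" using m0 mleM by (auto simp: p_def q_def intro: power_mono)
  define T where "T k B = msqrt B ** A k ** msqrt B + s\<^sup>2 *\<^sub>R mat 1" for k B
  define N where "N B = (\<Sum>k\<in>I. w k *\<^sub>R msqrt (T k B))" for B
  define \<Phi> where "\<Phi> B = msqrt (N B ** N B + (- (s\<^sup>2)) *\<^sub>R mat 1)" for B
  have T: "T k B \<in> loewner_box (p\<^sup>2) (q\<^sup>2)" if "k \<in> I" "B \<in> loewner_box m M" for k B
    unfolding T_def p2 q2 by (intro box_shift box_congruence AB that m0 mleM)
  have N: "N B \<in> loewner_box p q" if "B \<in> loewner_box m M" for B
    unfolding N_def using w that by (intro box_sum I msqrt_in_box T p0 pq) auto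
  have NN: "N B ** N B + (- (s\<^sup>2)) *\<^sub>R mat 1 \<in> loewner_box (m\<^sup>2) (M\<^sup>2)" if "B \<in> loewner_box m M" for B
    using box_shift[OF box_square[OF N[OF that] p0 pq], of "- (s\<^sup>2)"] by (simp add: p2 q2)
  have Phi: "\<Phi> B \<in> loewner_box m M" "\<Phi> B ** \<Phi> B = N B ** N B + (- (s\<^sup>2)) *\<^sub>R mat 1" if "B \<in> loewner_box m M" for B
    unfolding \<Phi>_def using msqrt_in_box[OF NN[OF that] m0 mleM] by auto
  have cR: "continuous_on (loewner_box m M) (msqrt :: real^'d^'d \<Rightarrow> _)"
    using continuous_on_msqrt[of "sqrt m" "sqrt M"] m0 mleM by simp
  have cT: "continuous_on (loewner_box m M) (T k)" for k
    unfolding T_def by (intro continuous_intros cR)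
  have cN: "continuous_on (loewner_box m M) N"
    unfolding N_def
  proof (intro continuous_on_sum continuous_on_scaleR continuous_on_const)
    fix k assume "k \<in> I"
    then show "continuous_on (loewner_box m M) (\<lambda>B. msqrt (T k B))"
      using T by (intro continuous_on_compose2[OF continuous_on_msqrt[OF p0 pq] cT]) auto
  qed
  have "continuous_on (loewner_box m M) \<Phi>"
    unfolding \<Phi>_def using NN
    by (intro continuous_on_compose2[OF continuous_on_msqrt[OF m0 mleM]] continuous_intros cN) auto
  moreover have "\<Phi> \<in> loewner_box m M \<rightarrow> loewner_box m M" using Phi by blast
  moreover have "loewner_box m M \<noteq> ({} :: (real^'d^'d) set)" using \<open>k0 \<in> I\<close> AB by blast
  ultimately have "\<exists>B\<in>loewner_box m M. \<Phi> B = B"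
    using brouwer[OF compact_box convex_box, where f = \<Phi>] by blast
  then obtain B where B: "B \<in> loewner_box m M" "\<Phi> B = B" by blast
  have eq: "N B ** N B = B ** B + s\<^sup>2 *\<^sub>R mat 1" using Phi(2)[OF B(1)] B(2) by simp
  have "pd (B ** B + s\<^sup>2 *\<^sub>R mat 1)"
    using box_pd[OF box_square[OF N[OF B(1)] p0 pq]] p0 by (simp add: eq)
  then have "msqrt (B ** B + s\<^sup>2 *\<^sub>R mat 1) = N B"
    using pd_imp_psd[OF box_pd[OF N[OF B(1)] p0]] eq by (intro msqrt_eqI)
  then show ?thesis using box_pd[OF B(1) m0] by (auto simp: N_def T_def)
qed

section \<open>Matrices of the Gaussian potentials\<close>

lemma pd_inverse:
  fixes N :: "real^'d^'d"
  assumes "pd N"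
  obtains Z where "N ** Z = mat 1" "Z ** N = mat 1" "pd Z"
proof -
  have "inj ((*v) N)"
  proof (rule injI)
    fix x y assume "N *v x = N *v y"
    then have "(x - y) \<bullet> (N *v (x - y)) = 0" by (simp add: mv_simps)
    then show "x = y" using assms unfolding pd_def by (metis eq_iff_diff_eq_0 less_irrefl)
  qed
  then obtain Z where Z: "Z ** N = mat 1" using matrix_left_invertible_injective by blast
  then have NZ: "N ** Z = mat 1" by (simp add: matrix_left_right_inverse)
  have sym: "transpose N = N" using assms by (simp add: pd_def)
  have "transpose Z ** N = mat 1"
    using arg_cong[OF NZ, of transpose] by (simp add: matrix_transpose_mul sym)
  then have tZ: "transpose Z = Z" by (metis NZ matrix_mul_assoc matrix_mul_lid matrix_mul_rid)
  have "0 < x \<bullet> (Z *v x)" if "x \<noteq> 0" for x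
  proof -
    have x: "x = N *v (Z *v x)" by (simp add: matrix_vector_mul_assoc NZ)
    then have "Z *v x \<noteq> 0" using that by auto
    then have "0 < (Z *v x) \<bullet> (N *v (Z *v x))" using assms unfolding pd_def by blast
    then show ?thesis by (simp add: x[symmetric] inner_commute)
  qed
  then have "pd Z" using tZ by (simp add: pd_def)
  then show ?thesis using that Z NZ by blast
qed

lemma pd_congruence:
  fixes X C :: "real^'d^'d"
  assumes "pd X" "pd C"
  shows "pd (C ** X ** C)"
proof -
  have tC: "transpose C = C" using assms by (simp add: pd_def)
  have "0 < x \<bullet> ((C ** X ** C) *v x)" if "x \<noteq> 0" for x
  proof -
    have "0 < x \<bullet> (C *v x)" using that assms unfolding pd_def by blast
    then have "C *v x \<noteq> 0" by auto
    then have "0 < (C *v x) \<bullet> (X *v (C *v x))" using assms unfolding pd_def by blast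
    then show ?thesis by (simp add: matrix_vector_mul_assoc[symmetric] sym_inner[OF tC])
  qed
  then show ?thesis using assms unfolding pd_def
    by (simp add: matrix_transpose_mul matrix_mul_assoc)
qed

text \<open>\<open>Q\<close> and \<open>P\<close> are the quadratic forms of the two Schroedinger potentials of centred Gaussians
  with covariances \<open>A\<close> and \<open>B\<close>; equation by equation, \<open>Q\<^sup>-\<^sup>1 = P + 2s A\<^sup>-\<^sup>1\<close> and
  \<open>P\<^sup>-\<^sup>1 = Q + 2s B\<^sup>-\<^sup>1\<close>.\<close>

lemma gaussian_schroedinger_matrices:
  fixes A B Ri :: "real^'d^'d" and s :: real
  assumes A: "pd A" and B: "pd B" and s: "0 < s" and Ri: "Ri ** msqrt B = mat 1" "msqrt B ** Ri = mat 1" "pd Ri"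
  defines "Q \<equiv> Ri ** (msqrt (msqrt B ** A ** msqrt B + s\<^sup>2 *\<^sub>R mat 1) - s *\<^sub>R mat 1) ** Ri"
  shows "pd Q"
    and "\<exists>P. psd P \<and> (2 * s) *\<^sub>R Q + A ** P ** Q = A \<and> (2 * s) *\<^sub>R P + B ** Q ** P = B"
    and "A = B \<Longrightarrow> (2 * s) *\<^sub>R Q + B ** Q ** Q = B"
proof -
  define R where "R = msqrt B"
  have R: "pd R" "R ** R = B" using msqrt_pd[OF B] by (auto simp: R_def)
  have tR: "transpose R = R" using R by (simp add: pd_def)
  define X where "X = R ** A ** R"
  have X: "pd X" unfolding X_def using pd_congruence A R by blast
  obtain m M where mM: "m > 0" "m \<le> M" "X \<in> loewner_box m M" using pd_in_box[OF X] by blast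
  define p where "p = sqrt (m + s\<^sup>2)"
  define q where "q = sqrt (M + s\<^sup>2)"
  have p2: "p\<^sup>2 = m + s\<^sup>2" and q2: "q\<^sup>2 = M + s\<^sup>2" using mM by (auto simp: p_def q_def)
  have p0: "0 < p" using mM by (simp add: p_def add_pos_nonneg)
  have pq: "p \<le> q" using mM by (auto simp: p_def q_def)
  \<comment> \<open>Strict because m > 0; this makes Y, and with it Q, positive definite.\<close>
  have ps: "s < p" unfolding p_def using mM s by (intro real_less_rsqrt) auto
  define N where "N = msqrt (X + s\<^sup>2 *\<^sub>R mat 1)"
  have "X + s\<^sup>2 *\<^sub>R mat 1 \<in> loewner_box (p\<^sup>2) (q\<^sup>2)" unfolding p2 q2 by (intro box_shift mM)
  then have N: "N \<in> loewner_box p q" "N ** N = X + s\<^sup>2 *\<^sub>R mat 1"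
    unfolding N_def using msqrt_in_box p0 pq by blast+
  define Y where "Y = N - s *\<^sub>R mat 1"
  have "Y \<in> loewner_box (p + - s) (q + - s)" using box_shift[OF N(1), of "- s"] by (simp add: Y_def)
  then have Y: "pd Y" using ps by (intro box_pd) auto
  \<comment> \<open>W and Y are N + s Id and N - s Id, so their product is the difference of squares
    N^2 - s^2 Id = X.\<close>
  define W where "W = Y + (2 * s) *\<^sub>R mat 1"
  have "(2 * s) *\<^sub>R (mat 1 :: real^'d^'d) = s *\<^sub>R mat 1 + s *\<^sub>R mat 1"
    by (simp add: scaleR_add_left[symmetric])
  then have WN: "W = N + s *\<^sub>R mat 1" by (simp add: W_def Y_def)
  have "W \<in> loewner_box (p + s) (q + s)" using box_shift[OF N(1), of s] by (simp add: WN)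
  from box_pd[OF this] have W: "pd W" using p0 s by simp
  obtain Z where Z: "W ** Z = mat 1" "Z ** W = mat 1" "pd Z" using pd_inverse[OF W] by blast
  have WY: "W ** Y = X" "Y ** W = X"
    using N(2) by (simp_all add: WN Y_def matrix_ring_simps power2_eq_square scaleR_add_right scaleR_diff_right)
  have Ri': "Ri ** R = mat 1" "R ** Ri = mat 1" using Ri by (auto simp: R_def)
  have Rc: "Ri ** (R ** C) = C" "R ** (Ri ** C) = C" "W ** (Z ** C) = C" "Z ** (W ** C) = C" for C
    by (simp_all add: matrix_mul_assoc Ri' Z)
  note as = matrix_mul_assoc[symmetric] Rc Ri' Z(1,2)
  have Q: "Q = Ri ** (Y ** Ri)" by (simp add: Q_def Y_def N_def X_def R_def matrix_mul_assoc)
  have "A = Ri ** (X ** Ri)" by (simp add: X_def as)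
  then have A': "A = Ri ** (Y ** (W ** Ri))" by (simp add: WY(2)[symmetric] as)
  \<comment> \<open>R Z R is the inverse of Ri W Ri, and W = Y + 2s Id makes the latter Q plus 2s
    times the inverse of B.\<close>
  define P where "P = R ** (Z ** R)"
  show "pd Q" using pd_congruence[OF Y Ri(3)] by (simp add: Q as)
  have "psd P" using pd_imp_psd[OF pd_congruence[OF Z(3) R(1)]] by (simp add: P_def as)
  moreover have "(2 * s) *\<^sub>R Q + A ** P ** Q = A"
  proof -
    have ZY: "Z ** Y = Y ** Z"
    proof -
      have "Z ** Y = Z ** ((Y ** W) ** Z)" by (simp add: as)
      also have "\<dots> = Z ** ((W ** Y) ** Z)" by (simp add: WY)
      also have "\<dots> = Y ** Z" by (simp add: as)
      finally show ?thesis .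
    qed
    have "A ** P ** Q = Ri ** (Y ** (Y ** Ri))"
      unfolding Q P_def A' by (simp add: as)
    moreover have "A = Ri ** (Y ** (Y ** Ri)) + (2 * s) *\<^sub>R Q"
      unfolding A' Q W_def by (simp add: matrix_add_ldistrib matrix_add_rdistrib matrix_scaleR_left matrix_scaleR_right)
    ultimately show ?thesis by simp
  qed
  moreover have BQP: "(2 * s) *\<^sub>R P + B ** Q ** P = B"
  proof -
    have "B ** Q ** P = R ** (Y ** (Z ** R))" unfolding Q P_def R(2)[symmetric] by (simp add: as)
    then have "(2 * s) *\<^sub>R P + B ** Q ** P = R ** (W ** (Z ** R))"
      unfolding P_def W_def by (simp add: matrix_add_ldistrib matrix_add_rdistrib matrix_scaleR_left matrix_scaleR_right)
    then show ?thesis by (simp add: as R(2))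
  qed
  ultimately show "\<exists>P. psd P \<and> (2 * s) *\<^sub>R Q + A ** P ** Q = A \<and> (2 * s) *\<^sub>R P + B ** Q ** P = B"
    by blast
  show "(2 * s) *\<^sub>R Q + B ** Q ** Q = B" if "A = B"
  proof -
    \<comment> \<open>Here X is the fourth power of R, so N^2 = X + s^2 Id commutes with R. The
      commutator of N and R therefore solves a Sylvester equation and vanishes; then all factors
      commute and Q = P.\<close>
    have XR: "X ** R = R ** X" unfolding X_def that R(2)[symmetric] by (simp add: as)
    have NR: "N ** (N ** C) = (X + s\<^sup>2 *\<^sub>R mat 1) ** C" for C by (simp add: N(2)[symmetric] as)
    have "N ** (N ** R - R ** N) + (N ** R - R ** N) ** N = 0"
      using XR by (simp add: matrix_diff_ldistrib matrix_diff_rdistrib as NR)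
        (simp add: N(2) matrix_ring_simps)
    then have "N ** R - R ** N = 0"
      using sylvester_eq_0 box_pd[OF N(1) p0] by blast
    then have "W ** R = R ** W" by (simp add: WN matrix_ring_simps)
    then have ZR: "Z ** R = R ** Z" by (metis Z(1,2) matrix_mul_assoc matrix_mul_lid matrix_mul_rid)
    have "Q = Ri ** (X ** (Z ** Ri))" unfolding Q WY(2)[symmetric] by (simp add: as)
    also have "\<dots> = R ** (R ** (R ** (Z ** Ri)))" unfolding X_def that R(2)[symmetric] by (simp add: as)
    also have "R ** (Z ** Ri) = Z"  using ZR by (metis Ri'(2) matrix_mul_assoc matrix_mul_rid)
    also have "R ** (R ** Z) = P" by (simp add: P_def ZR)
    finally show ?thesis using BQP by simp
  qed
qed

section \<open>Duality for entropic transport\<close>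

lemma P2_D:
  assumes "\<mu> \<in> P2"
  shows "prob_space \<mu>" "sets \<mu> = sets borel" "integrable \<mu> (\<lambda>x. (norm x)\<^sup>2)" "space \<mu> = UNIV"
  using assms sets_eq_imp_space_eq[of \<mu> borel] by (auto simp: P2_def)

lemma measurable_pair_borel_cong:
  assumes "sets \<alpha> = sets borel" "sets \<beta> = sets borel"
  shows "measurable (\<alpha> \<Otimes>\<^sub>M \<beta>) N = measurable (borel \<Otimes>\<^sub>M borel) N"
  using assms by (intro measurable_cong_sets sets_pair_measure_cong refl)

lemma coupling_marginals:
  fixes \<alpha> \<beta> :: "(real^'d) measure"
  assumes \<alpha>: "\<alpha> \<in> P2" and \<beta>: "\<beta> \<in> P2" and \<pi>: "\<pi> \<in> couplings \<alpha> \<beta>"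
  shows "measurable \<pi> N = measurable (borel \<Otimes>\<^sub>M borel) N"
    and "\<And>f::real^'d \<Rightarrow> real. integrable \<alpha> f \<Longrightarrow> integrable \<pi> (\<lambda>z. f (fst z))"
    and "\<And>f::real^'d \<Rightarrow> real. integrable \<alpha> f \<Longrightarrow> (\<integral>z. f (fst z) \<partial>\<pi>) = (\<integral>x. f x \<partial>\<alpha>)"
    and "\<And>f::real^'d \<Rightarrow> real. integrable \<beta> f \<Longrightarrow> integrable \<pi> (\<lambda>z. f (snd z))"
    and "\<And>f::real^'d \<Rightarrow> real. integrable \<beta> f \<Longrightarrow> (\<integral>z. f (snd z) \<partial>\<pi>) = (\<integral>x. f x \<partial>\<beta>)"
proof -
  have s: "sets \<alpha> = sets borel" "sets \<beta> = sets borel" using P2_D \<alpha> \<beta> by auto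
  have c: "sets \<pi> = sets (\<alpha> \<Otimes>\<^sub>M \<beta>)" "distr \<pi> borel fst = \<alpha>" "distr \<pi> borel snd = \<beta>"
    using \<pi> by (auto simp: couplings_def)
  show m: "measurable \<pi> N = measurable (borel \<Otimes>\<^sub>M borel) N" for N :: "'x measure"
    using measurable_cong_sets[OF c(1) refl] measurable_pair_borel_cong[OF s] by metis
  have fs: "fst \<in> measurable \<pi> borel" "snd \<in> measurable \<pi> borel" unfolding m by auto
  { fix f :: "real^'d \<Rightarrow> real" assume f: "integrable \<alpha> f"
    then have fm: "f \<in> borel_measurable borel" using s measurable_cong_sets by blast
    have i: "integrable (distr \<pi> borel fst) f" using f by (simp add: c)
    show "integrable \<pi> (\<lambda>z. f (fst z))" using integrable_distr[OF fs(1) i] .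
    show "(\<integral>z. f (fst z) \<partial>\<pi>) = (\<integral>x. f x \<partial>\<alpha>)" using integral_distr[OF fs(1) fm] by (simp add: c) }
  { fix f :: "real^'d \<Rightarrow> real" assume f: "integrable \<beta> f"
    then have fm: "f \<in> borel_measurable borel" using s measurable_cong_sets by blast
    have i: "integrable (distr \<pi> borel snd) f" using f by (simp add: c)
    show "integrable \<pi> (\<lambda>z. f (snd z))" using integrable_distr[OF fs(2) i] .
    show "(\<integral>z. f (snd z) \<partial>\<pi>) = (\<integral>x. f x \<partial>\<beta>)" using integral_distr[OF fs(2) fm] by (simp add: c) }
qed

lemma coupling_cost_integrable:
  fixes \<alpha> \<beta> :: "(real^'d) measure"
  assumes \<alpha>: "\<alpha> \<in> P2" and \<beta>: "\<beta> \<in> P2" and \<pi>: "\<pi> \<in> couplings \<alpha> \<beta>"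
  shows "integrable \<pi> (\<lambda>(x, y). (norm (x - y))\<^sup>2)"
proof (rule Bochner_Integration.integrable_bound)
  note cm = coupling_marginals[OF assms]
  show "integrable \<pi> (\<lambda>z. 2 * (norm (fst z))\<^sup>2 + 2 * (norm (snd z))\<^sup>2)"
    using cm(2)[OF P2_D(3)[OF \<alpha>]] cm(4)[OF P2_D(3)[OF \<beta>]] by auto
  show "(\<lambda>(x, y). (norm (x - y))\<^sup>2) \<in> borel_measurable \<pi>" unfolding cm(1) by measurable
  have "(norm (x - y))\<^sup>2 \<le> 2 * (norm x)\<^sup>2 + 2 * (norm y)\<^sup>2" for x y :: "real^'d"
  proof -
    have "2 * (norm x)\<^sup>2 + 2 * (norm y)\<^sup>2 - (norm (x - y))\<^sup>2 = (norm (x + y))\<^sup>2"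
      by (simp add: power2_norm_eq_inner algebra_simps)
    then show ?thesis by (smt (verit) zero_le_power2)
  qed
  then show "AE z in \<pi>. norm (case z of (x, y) \<Rightarrow> (norm (x - y))\<^sup>2) \<le> norm (2 * (norm (fst z))\<^sup>2 + 2 * (norm (snd z))\<^sup>2)"
    by (auto intro!: AE_I2)
qed

lemma coupling_potential_integral:
  fixes \<alpha> \<beta> :: "(real^'d) measure" and f g :: "real^'d \<Rightarrow> real"
  assumes \<alpha>: "\<alpha> \<in> P2" and \<beta>: "\<beta> \<in> P2" and \<pi>: "\<pi> \<in> couplings \<alpha> \<beta>"
    and f: "integrable \<alpha> f" and g: "integrable \<beta> g"
  shows "integrable \<pi> (\<lambda>(x, y). (f x + g y - (norm (x - y))\<^sup>2) / e)"
    and "(\<integral>z. (case z of (x, y) \<Rightarrow> (f x + g y - (norm (x - y))\<^sup>2) / e) \<partial>\<pi>)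
       = ((\<integral>x. f x \<partial>\<alpha>) + (\<integral>y. g y \<partial>\<beta>) - (\<integral>z. (case z of (x, y) \<Rightarrow> (norm (x - y))\<^sup>2) \<partial>\<pi>)) / e"
proof -
  note cm = coupling_marginals[OF \<alpha> \<beta> \<pi>]
  note i = cm(2)[OF f] cm(4)[OF g] coupling_cost_integrable[OF \<alpha> \<beta> \<pi>, unfolded case_prod_beta]
  show "integrable \<pi> (\<lambda>(x, y). (f x + g y - (norm (x - y))\<^sup>2) / e)"
    unfolding case_prod_beta using i by auto
  show "(\<integral>z. (case z of (x, y) \<Rightarrow> (f x + g y - (norm (x - y))\<^sup>2) / e) \<partial>\<pi>)
       = ((\<integral>x. f x \<partial>\<alpha>) + (\<integral>y. g y \<partial>\<beta>) - (\<integral>z. (case z of (x, y) \<Rightarrow> (norm (x - y))\<^sup>2) \<partial>\<pi>)) / e"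
    unfolding case_prod_beta using i cm(3)[OF f] cm(5)[OF g] by simp
qed

lemma log_exp_1 [simp]: "log (exp 1) x = ln x"
  by (simp add: log_def)

text \<open>With u the exponent in \<open>le\<close> and D the density of \<pi>, the inequality ln t
  \<le> t - 1 at t = exp(u) / D bounds the entropy below by the integral of u + 1 - exp(u) / D under
  \<pi>, and exp(u) / D integrates to at most 1. The constraint concerns total mass, so it can be
  checked by integrating over either variable first.\<close>

lemma OT_lower:
  fixes \<alpha> \<beta> :: "(real^'d) measure" and f g :: "real^'d \<Rightarrow> real"
  assumes \<sigma>: "\<sigma> > 0" and \<alpha>: "\<alpha> \<in> P2" and \<beta>: "\<beta> \<in> P2"
    and f: "integrable \<alpha> f" and g: "integrable \<beta> g"
    and le: "(\<integral>\<^sup>+x. \<integral>\<^sup>+y. ennreal (exp ((f x + g y - (norm (x - y))\<^sup>2) / (2 * \<sigma>\<^sup>2))) \<partial>\<beta> \<partial>\<alpha>) \<le> 1"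
  shows "ereal ((\<integral>x. f x \<partial>\<alpha>) + (\<integral>y. g y \<partial>\<beta>)) \<le> OT \<sigma> \<alpha> \<beta>"
  unfolding OT_def
proof (rule INF_greatest)
  fix \<pi> assume \<pi>: "\<pi> \<in> couplings \<alpha> \<beta>"
  interpret A: prob_space \<alpha> using P2_D[OF \<alpha>] by auto
  interpret B: prob_space \<beta> using P2_D[OF \<beta>] by auto
  interpret AB: pair_prob_space \<alpha> \<beta> ..
  interpret P: prob_space \<pi> using \<pi> by (auto simp: couplings_def)
  have sets: "sets \<alpha> = sets borel" "sets \<beta> = sets borel" "sets \<pi> = sets (\<alpha> \<Otimes>\<^sub>M \<beta>)"
    using P2_D \<alpha> \<beta> \<pi> by (auto simp: couplings_def)
  have [measurable]: "f \<in> borel_measurable borel" "g \<in> borel_measurable borel"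
    using f g sets measurable_cong_sets by blast+
  define c where "c = (\<lambda>(x::real^'d, y). (norm (x - y))\<^sup>2)"
  have c: "integrable \<pi> c" unfolding c_def using coupling_cost_integrable[OF \<alpha> \<beta> \<pi>] .
  have c_nn: "(\<integral>\<^sup>+(x, y). ennreal ((norm (x - y))\<^sup>2) \<partial>\<pi>) = ennreal (\<integral>z. c z \<partial>\<pi>)"
    using nn_integral_eq_integral[OF c] unfolding c_def case_prod_unfold by simp
  define u where "u = (\<lambda>(x, y). (f x + g y - (norm (x - y))\<^sup>2) / (2 * \<sigma>\<^sup>2))"
  note ui = coupling_potential_integral[OF \<alpha> \<beta> \<pi> f g, of "2 * \<sigma>\<^sup>2", folded u_def c_def]
  let ?M = "\<alpha> \<Otimes>\<^sub>M \<beta>"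
  let ?L = "enn2ereal (\<integral>\<^sup>+(x, y). ennreal ((norm (x - y))\<^sup>2) \<partial>\<pi>) + ereal (2 * \<sigma>\<^sup>2) * KL \<pi> ?M"
  show "ereal ((\<integral>x. f x \<partial>\<alpha>) + (\<integral>y. g y \<partial>\<beta>)) \<le> ?L"
  proof (cases "absolutely_continuous ?M \<pi> \<and> integrable \<pi> (entropy_density (exp 1) ?M \<pi>)")
    case False
    then have "KL \<pi> ?M = \<infinity>" by (simp add: KL_def)
    then have "?L = \<infinity>" using \<sigma> by (simp add: c_nn)
    then show ?thesis by (metis ereal_less_eq(1))
  next
    case True
    then have ac: "absolutely_continuous ?M \<pi>" and int: "integrable \<pi> (entropy_density (exp 1) ?M \<pi>)" by auto
    obtain D where D [measurable]: "D \<in> borel_measurable ?M" and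
      D': "AE x in ?M. RN_deriv ?M \<pi> x = ennreal (D x)" "AE x in \<pi>. 0 < D x" "\<And>x. 0 \<le> D x"
      using AB.P.real_RN_deriv[OF P.finite_measure_axioms ac sets(3)] by blast
    have \<pi>D: "\<pi> = density ?M (\<lambda>x. ennreal (D x))"
      using AB.P.density_RN_deriv[OF ac sets(3)] density_cong[OF _ _ D'(1)] by auto
    have "AE x in \<pi>. RN_deriv ?M \<pi> x = ennreal (D x)"
      using absolutely_continuous_AE[OF sets(3) ac D'(1)] .
    then have AE: "AE x in \<pi>. entropy_density (exp 1) ?M \<pi> x = ln (D x)"
      by eventually_elim (simp add: entropy_density_def D'(3))
    have lnD: "integrable \<pi> (\<lambda>x. ln (D x))"
      using int AE by (subst integrable_cong_AE[symmetric]) (auto simp: \<pi>D)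
    have "(\<integral>x. entropy_density (exp 1) ?M \<pi> x \<partial>\<pi>) = (\<integral>x. ln (D x) \<partial>\<pi>)"
      by (rule integral_cong_AE) (use int lnD AE in auto)
    then have KL: "KL \<pi> ?M = ereal (\<integral>x. ln (D x) \<partial>\<pi>)"
      unfolding KL_def KL_divergence_def using True by simp
    have um [measurable]: "u \<in> borel_measurable ?M"
      unfolding measurable_pair_borel_cong[OF sets(1,2)] u_def by measurable
    have nn: "(\<integral>\<^sup>+z. ennreal (exp (u z) / D z) \<partial>\<pi>) \<le> 1"
    proof -
      have "(\<integral>\<^sup>+z. ennreal (exp (u z) / D z) \<partial>\<pi>) = (\<integral>\<^sup>+z. ennreal (D z) * ennreal (exp (u z) / D z) \<partial>?M)"
        by (subst \<pi>D) (simp add: nn_integral_density)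
      \<comment> \<open>Only an inequality: where D vanishes the quotient is 0 by convention, while
        \<open>exp (u z)\<close> is positive.\<close>
      also have "\<dots> \<le> (\<integral>\<^sup>+z. ennreal (exp (u z)) \<partial>?M)"
        using D'(3) by (intro nn_integral_mono) (auto simp: ennreal_mult[symmetric])
      also have "\<dots> = (\<integral>\<^sup>+x. \<integral>\<^sup>+y. ennreal (exp (u (x, y))) \<partial>\<beta> \<partial>\<alpha>)"
        by (subst B.nn_integral_fst[symmetric]) auto
      also have "\<dots> \<le> 1" using le by (simp add: u_def)
      finally show ?thesis .
    qed
    have i: "integrable \<pi> (\<lambda>z. exp (u z) / D z)"
      using nn D'(3) by (intro integrableI_nonneg) (auto simp: \<pi>D less_top[symmetric] top_unique)
    have "ennreal (\<integral>z. exp (u z) / D z \<partial>\<pi>) \<le> 1"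
      using nn nn_integral_eq_integral[OF i] D'(3) by simp
    then have i1: "(\<integral>z. exp (u z) / D z \<partial>\<pi>) \<le> 1" by simp
    have "(\<integral>z. u z + (1 - exp (u z) / D z) \<partial>\<pi>) \<le> (\<integral>z. ln (D z) \<partial>\<pi>)"
    proof (rule integral_mono_AE)
      show "AE z in \<pi>. u z + (1 - exp (u z) / D z) \<le> ln (D z)"
        using D'(2)
      proof eventually_elim
        case (elim z)
        have "ln (exp (u z) / D z) \<le> exp (u z) / D z - 1" using elim by (intro ln_le_minus_one) auto
        then show ?case using elim by (simp add: ln_div)
      qed
    qed (use ui i lnD in auto)
    then have "(\<integral>z. u z \<partial>\<pi>) + (1 - (\<integral>z. exp (u z) / D z \<partial>\<pi>)) \<le> (\<integral>z. ln (D z) \<partial>\<pi>)"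
      using ui i by (simp add: P.prob_space)
    then have "(\<integral>z. u z \<partial>\<pi>) \<le> (\<integral>z. ln (D z) \<partial>\<pi>)" using i1 by linarith
    then have "(\<integral>x. f x \<partial>\<alpha>) + (\<integral>y. g y \<partial>\<beta>) \<le> (\<integral>z. c z \<partial>\<pi>) + 2 * \<sigma>\<^sup>2 * (\<integral>z. ln (D z) \<partial>\<pi>)"
      unfolding ui(2) using \<sigma> by (simp add: field_simps)
    moreover have "0 \<le> (\<integral>z. c z \<partial>\<pi>)" by (intro integral_nonneg_AE) (auto simp: c_def)
    ultimately show ?thesis by (simp add: c_nn KL)
  qed
qed

text \<open>Any p with unit partial integrals gives a competitor in the infimum. Tonelli turns those
  integrals into the marginals, and uniqueness of densities identifies the Radon-Nikodym derivative
  in the relative entropy with p.\<close>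

lemma OT_le_density:
  fixes \<alpha> \<beta> :: "(real^'d) measure" and p :: "(real^'d) \<times> (real^'d) \<Rightarrow> real"
  assumes \<sigma>: "\<sigma> > 0" and \<alpha>: "\<alpha> \<in> P2" and \<beta>: "\<beta> \<in> P2"
    and p [measurable]: "p \<in> borel_measurable (borel \<Otimes>\<^sub>M borel)" and p0: "\<And>z. 0 \<le> p z"
    and m1: "AE x in \<alpha>. (\<integral>\<^sup>+y. ennreal (p (x, y)) \<partial>\<beta>) = 1"
    and m2: "AE y in \<beta>. (\<integral>\<^sup>+x. ennreal (p (x, y)) \<partial>\<alpha>) = 1"
  defines "\<pi> \<equiv> density (\<alpha> \<Otimes>\<^sub>M \<beta>) p"
  shows "\<pi> \<in> couplings \<alpha> \<beta>"
    and "integrable \<pi> (\<lambda>z. ln (p z)) \<Longrightarrow>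
      OT \<sigma> \<alpha> \<beta> \<le> ereal ((\<integral>z. (case z of (x, y) \<Rightarrow> (norm (x - y))\<^sup>2) \<partial>\<pi>) + 2 * \<sigma>\<^sup>2 * (\<integral>z. ln (p z) \<partial>\<pi>))"
proof -
  interpret A: prob_space \<alpha> using P2_D[OF \<alpha>] by auto
  interpret B: prob_space \<beta> using P2_D[OF \<beta>] by auto
  interpret AB: pair_prob_space \<alpha> \<beta> ..
  let ?M = "\<alpha> \<Otimes>\<^sub>M \<beta>"
  have sets: "sets \<alpha> = sets borel" "sets \<beta> = sets borel" using P2_D \<alpha> \<beta> by auto
  have spaces: "space \<alpha> = UNIV" "space \<beta> = UNIV" using P2_D(4) \<alpha> \<beta> by blast+
  have pm [measurable]: "p \<in> borel_measurable ?M" unfolding measurable_pair_borel_cong[OF sets] by (rule p)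
  have fs [measurable]: "fst \<in> measurable ?M borel" "snd \<in> measurable ?M borel"
    unfolding measurable_pair_borel_cong[OF sets] by auto
  have e1: "emeasure \<pi> (fst -` X \<inter> space \<pi>) = emeasure \<alpha> X" if [measurable]: "X \<in> sets borel" for X
  proof -
    have Xa [measurable]: "X \<in> sets \<alpha>" using that sets by simp
    have "emeasure \<pi> (fst -` X \<inter> space \<pi>) = (\<integral>\<^sup>+z. ennreal (p z) * indicator (fst -` X \<inter> space ?M) z \<partial>?M)"
      unfolding \<pi>_def by (simp add: emeasure_density measurable_sets[OF fs(1) that])
    also have "\<dots> = (\<integral>\<^sup>+z. ennreal (p z) * indicator X (fst z) \<partial>?M)"
      by (intro nn_integral_cong) (auto simp: indicator_def)
    also have "\<dots> = (\<integral>\<^sup>+x. \<integral>\<^sup>+y. ennreal (p (x, y)) * indicator X x \<partial>\<beta> \<partial>\<alpha>)"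
      by (subst B.nn_integral_fst[symmetric]) auto
    also have "\<dots> = (\<integral>\<^sup>+x. (\<integral>\<^sup>+y. ennreal (p (x, y)) \<partial>\<beta>) * indicator X x \<partial>\<alpha>)"
      by (intro nn_integral_cong nn_integral_multc) (use spaces in measurable)
    also have "\<dots> = (\<integral>\<^sup>+x. indicator X x \<partial>\<alpha>)"
      using m1 by (intro nn_integral_cong_AE) auto
    finally show ?thesis by simp
  qed
  have e2: "emeasure \<pi> (snd -` X \<inter> space \<pi>) = emeasure \<beta> X" if [measurable]: "X \<in> sets borel" for X
  proof -
    have Xa [measurable]: "X \<in> sets \<beta>" using that sets by simp
    have "emeasure \<pi> (snd -` X \<inter> space \<pi>) = (\<integral>\<^sup>+z. ennreal (p z) * indicator (snd -` X \<inter> space ?M) z \<partial>?M)"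
      unfolding \<pi>_def by (simp add: emeasure_density measurable_sets[OF fs(2) that])
    also have "\<dots> = (\<integral>\<^sup>+z. ennreal (p z) * indicator X (snd z) \<partial>?M)"
      by (intro nn_integral_cong) (auto simp: indicator_def)
    also have "\<dots> = (\<integral>\<^sup>+y. \<integral>\<^sup>+x. ennreal (p (x, y)) * indicator X y \<partial>\<alpha> \<partial>\<beta>)"
      by (subst AB.nn_integral_snd[symmetric]) auto
    also have "\<dots> = (\<integral>\<^sup>+y. (\<integral>\<^sup>+x. ennreal (p (x, y)) \<partial>\<alpha>) * indicator X y \<partial>\<beta>)"
      by (intro nn_integral_cong nn_integral_multc) (use spaces in measurable)
    also have "\<dots> = (\<integral>\<^sup>+y. indicator X y \<partial>\<beta>)"
      using m2 by (intro nn_integral_cong_AE) auto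
    finally show ?thesis by simp
  qed
  have fs\<pi>: "fst \<in> measurable \<pi> borel" "snd \<in> measurable \<pi> borel" unfolding \<pi>_def by auto
  have prob: "prob_space \<pi>"
  proof
    show "emeasure \<pi> (space \<pi>) = 1" using e1[of UNIV] A.emeasure_space_1 spaces by simp
  qed
  have d: "distr \<pi> borel fst = \<alpha>" "distr \<pi> borel snd = \<beta>"
    by (auto intro!: measure_eqI simp: sets emeasure_distr fs\<pi> e1 e2)
  show \<pi>: "\<pi> \<in> couplings \<alpha> \<beta>"
    unfolding couplings_def using prob d by (simp add: \<pi>_def)
  show "OT \<sigma> \<alpha> \<beta> \<le> ereal ((\<integral>z. (case z of (x, y) \<Rightarrow> (norm (x - y))\<^sup>2) \<partial>\<pi>) + 2 * \<sigma>\<^sup>2 * (\<integral>z. ln (p z) \<partial>\<pi>))"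
    if int: "integrable \<pi> (\<lambda>z. ln (p z))"
  proof -
    define c where "c = (\<lambda>(x::real^'d, y). (norm (x - y))\<^sup>2)"
    have c: "integrable \<pi> c" unfolding c_def using coupling_cost_integrable[OF \<alpha> \<beta> \<pi>] .
    have c_nn: "(\<integral>\<^sup>+(x, y). ennreal ((norm (x - y))\<^sup>2) \<partial>\<pi>) = ennreal (\<integral>z. c z \<partial>\<pi>)"
      using nn_integral_eq_integral[OF c] unfolding c_def case_prod_unfold by simp
    have ac: "absolutely_continuous ?M \<pi>" unfolding \<pi>_def by (rule absolutely_continuousI_density) simp
    have "density ?M (RN_deriv ?M \<pi>) = \<pi>"
      using AB.P.density_RN_deriv[OF ac] by (simp add: \<pi>_def)
    then have "AE z in ?M. RN_deriv ?M \<pi> z = ennreal (p z)"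
      unfolding \<pi>_def by (intro AB.P.density_unique) auto
    then have "AE z in \<pi>. RN_deriv ?M \<pi> z = ennreal (p z)"
      using absolutely_continuous_AE[OF _ ac] by (simp add: \<pi>_def)
    then have AE: "AE x in \<pi>. entropy_density (exp 1) ?M \<pi> x = ln (p x)"
      by eventually_elim (simp add: entropy_density_def p0)
    have em [measurable]: "entropy_density (exp 1) ?M \<pi> \<in> borel_measurable \<pi>"
      by (simp add: \<pi>_def entropy_density_def comp_def)
    have "integrable \<pi> (entropy_density (exp 1) ?M \<pi>)"
      using int AE by (subst integrable_cong_AE) (auto simp: \<pi>_def[symmetric])
    then have KL: "KL \<pi> ?M = ereal (\<integral>x. ln (p x) \<partial>\<pi>)"
      unfolding KL_def KL_divergence_def using ac AE int
      by (auto intro!: integral_cong_AE)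
    have "OT \<sigma> \<alpha> \<beta> \<le> enn2ereal (\<integral>\<^sup>+(x, y). ennreal ((norm (x - y))\<^sup>2) \<partial>\<pi>) + ereal (2 * \<sigma>\<^sup>2) * KL \<pi> ?M"
      unfolding OT_def by (rule INF_lower[OF \<pi>])
    also have "\<dots> = ereal ((\<integral>z. c z \<partial>\<pi>) + 2 * \<sigma>\<^sup>2 * (\<integral>x. ln (p x) \<partial>\<pi>))"
    proof -
      have "0 \<le> (\<integral>z. c z \<partial>\<pi>)" by (intro integral_nonneg_AE) (auto simp: c_def)
      then show ?thesis by (simp add: c_nn KL)
    qed
    finally show ?thesis by (simp add: c_def)
  qed
qed

text \<open>The product coupling bounds the cost above and zero potentials in weak duality bound it
  below, so that later arguments can compute in the reals.\<close>

lemma OT_finite: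
  fixes \<alpha> \<beta> :: "(real^'d) measure"
  assumes \<sigma>: "\<sigma> > 0" and \<alpha>: "\<alpha> \<in> P2" and \<beta>: "\<beta> \<in> P2"
  obtains r where "OT \<sigma> \<alpha> \<beta> = ereal r"
proof -
  interpret A: prob_space \<alpha> using P2_D[OF \<alpha>] by auto
  interpret B: prob_space \<beta> using P2_D[OF \<beta>] by auto
  have "OT \<sigma> \<alpha> \<beta> < \<infinity>"
    using OT_le_density(2)[OF \<sigma> \<alpha> \<beta>, of "\<lambda>_. 1"] A.emeasure_space_1 B.emeasure_space_1
    by (auto simp: less_top[symmetric] top_unique)
  moreover have "ereal 0 \<le> OT \<sigma> \<alpha> \<beta>"
  proof -
    have "(\<integral>\<^sup>+x. \<integral>\<^sup>+y. ennreal (exp ((0 + 0 - (norm (x - y))\<^sup>2) / (2 * \<sigma>\<^sup>2))) \<partial>\<beta> \<partial>\<alpha>)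
        \<le> (\<integral>\<^sup>+x. \<integral>\<^sup>+y. 1 \<partial>\<beta> \<partial>\<alpha>)"
      by (intro nn_integral_mono) auto
    also have "\<dots> = 1" using A.emeasure_space_1 B.emeasure_space_1 by simp
    finally show ?thesis using OT_lower[OF \<sigma> \<alpha> \<beta>, of "\<lambda>_. 0" "\<lambda>_. 0"] by simp
  qed
  ultimately show ?thesis using that by (cases "OT \<sigma> \<alpha> \<beta>") auto
qed

text \<open>e is the Gibbs density of f and g, and \<rho> repairs its marginals. With u the exponent
  of e, ln (e \<rho>) \<le> u + \<rho> - 1, so the entropy is at most the integral of u provided
  \<rho> integrates to at most 1 under \<pi>, that is, e \<rho>^2 does under the product. The case
  \<rho> = 1 is optimality of exact potentials; \<open>OT_self_le\<close> relies on the general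
  form.\<close>

lemma OT_upper:
  fixes \<alpha> \<beta> :: "(real^'d) measure" and f g :: "real^'d \<Rightarrow> real" and \<rho> :: "(real^'d) \<times> (real^'d) \<Rightarrow> real"
  assumes \<sigma>: "\<sigma> > 0" and \<alpha>: "\<alpha> \<in> P2" and \<beta>: "\<beta> \<in> P2"
    and f: "integrable \<alpha> f" and g: "integrable \<beta> g"
    and \<rho> [measurable]: "\<rho> \<in> borel_measurable (borel \<Otimes>\<^sub>M borel)" and \<rho>0: "\<And>z. 0 \<le> \<rho> z"
  defines "e \<equiv> \<lambda>(x, y). exp ((f x + g y - (norm (x - y))\<^sup>2) / (2 * \<sigma>\<^sup>2))"
  assumes m1: "AE x in \<alpha>. (\<integral>\<^sup>+y. ennreal (e (x, y) * \<rho> (x, y)) \<partial>\<beta>) = 1"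
    and m2: "AE y in \<beta>. (\<integral>\<^sup>+x. ennreal (e (x, y) * \<rho> (x, y)) \<partial>\<alpha>) = 1"
    and le: "(\<integral>\<^sup>+x. \<integral>\<^sup>+y. ennreal (e (x, y) * (\<rho> (x, y))\<^sup>2) \<partial>\<beta> \<partial>\<alpha>) \<le> 1"
  shows "OT \<sigma> \<alpha> \<beta> \<le> ereal ((\<integral>x. f x \<partial>\<alpha>) + (\<integral>y. g y \<partial>\<beta>))"
proof -
  interpret A: prob_space \<alpha> using P2_D[OF \<alpha>] by auto
  interpret B: prob_space \<beta> using P2_D[OF \<beta>] by auto
  interpret AB: pair_prob_space \<alpha> \<beta> ..
  let ?M = "\<alpha> \<Otimes>\<^sub>M \<beta>"
  have sets: "sets \<alpha> = sets borel" "sets \<beta> = sets borel" using P2_D \<alpha> \<beta> by auto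
  have [measurable]: "f \<in> borel_measurable borel" "g \<in> borel_measurable borel"
    using f g sets measurable_cong_sets by blast+
  have e [measurable]: "e \<in> borel_measurable (borel \<Otimes>\<^sub>M borel)" unfolding e_def by measurable
  have e0: "0 < e z" for z by (simp add: e_def case_prod_beta)
  define p where "p z = e z * \<rho> z" for z
  have p [measurable]: "p \<in> borel_measurable (borel \<Otimes>\<^sub>M borel)" unfolding p_def by measurable
  have p0: "0 \<le> p z" for z using e0[of z] \<rho>0[of z] by (simp add: p_def)
  have pm [measurable]: "p \<in> borel_measurable ?M" "\<rho> \<in> borel_measurable ?M" "e \<in> borel_measurable ?M"
    unfolding measurable_pair_borel_cong[OF sets] by (rule p \<rho> e)+
  define \<pi> where "\<pi> = density ?M p"
  note up = OT_le_density[OF \<sigma> \<alpha> \<beta> p p0, unfolded p_def, OF m1 m2, folded p_def, folded \<pi>_def]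
  interpret P: prob_space \<pi> using up(1) by (auto simp: couplings_def)
  define u where "u = (\<lambda>(x, y). (f x + g y - (norm (x - y))\<^sup>2) / (2 * \<sigma>\<^sup>2))"
  note ui = coupling_potential_integral[OF \<alpha> \<beta> up(1) f g, of "2 * \<sigma>\<^sup>2", folded u_def]
  have eu: "e z = exp (u z)" for z by (simp add: e_def u_def case_prod_beta)
  have AEp: "AE z in \<pi>. 0 < p z"
    unfolding \<pi>_def using p0 by (subst AE_density) (auto simp: less_le)
  have nn1: "(\<integral>\<^sup>+z. ennreal (\<rho> z) \<partial>\<pi>) \<le> 1"
  proof -
    have "(\<integral>\<^sup>+z. ennreal (\<rho> z) \<partial>\<pi>) = (\<integral>\<^sup>+z. ennreal (e z * (\<rho> z)\<^sup>2) \<partial>?M)"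
      unfolding \<pi>_def by (subst nn_integral_density)
        (auto intro!: nn_integral_cong simp: p_def p0[unfolded p_def] \<rho>0 ennreal_mult[symmetric] power2_eq_square mult.assoc)
    also have "\<dots> = (\<integral>\<^sup>+x. \<integral>\<^sup>+y. ennreal (e (x, y) * (\<rho> (x, y))\<^sup>2) \<partial>\<beta> \<partial>\<alpha>)"
      by (subst B.nn_integral_fst[symmetric]) auto
    finally show ?thesis using le by simp
  qed
  have i1: "integrable \<pi> \<rho>"
    using nn1 \<rho>0 by (intro integrableI_nonneg) (auto simp: \<pi>_def less_top[symmetric] top_unique)
  have i1': "(\<integral>z. \<rho> z \<partial>\<pi>) \<le> 1"
    using nn1 nn_integral_eq_integral[OF i1] \<rho>0 by simp
  \<comment> \<open>Integrability of ln p also requires a bound from below: ln p \<ge> 1 - 1/p, and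
    1/p integrates to at most 1 under \<pi>.\<close>
  have nn2: "(\<integral>\<^sup>+z. ennreal (1 / p z) \<partial>\<pi>) \<le> 1"
  proof -
    have "(\<integral>\<^sup>+z. ennreal (1 / p z) \<partial>\<pi>) = (\<integral>\<^sup>+z. ennreal (p z) * ennreal (1 / p z) \<partial>?M)"
      unfolding \<pi>_def by (subst nn_integral_density) auto
    also have "\<dots> \<le> (\<integral>\<^sup>+z. 1 \<partial>?M)"
      using p0 by (intro nn_integral_mono) (auto simp: ennreal_mult[symmetric] ennreal_le_1)
    finally show ?thesis using AB.P.emeasure_space_1 by simp
  qed
  have i2: "integrable \<pi> (\<lambda>z. 1 / p z)"
    using nn2 p0 by (intro integrableI_nonneg) (auto simp: \<pi>_def less_top[symmetric] top_unique)
  have bounds: "AE z in \<pi>. 1 - 1 / p z \<le> ln (p z) \<and> ln (p z) \<le> u z + (\<rho> z - 1)"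
    using AEp
  proof eventually_elim
    case (elim z)
    have "ln (1 / p z) \<le> 1 / p z - 1" using elim by (intro ln_le_minus_one) auto
    then have 1: "1 - 1 / p z \<le> ln (p z)" using elim by (simp add: ln_div)
    have r: "0 < \<rho> z" using elim e0[of z] by (simp add: p_def zero_less_mult_iff)
    have "ln (p z) = u z + ln (\<rho> z)" using r by (simp add: p_def eu ln_mult)
    also have "ln (\<rho> z) \<le> \<rho> z - 1" using r by (rule ln_le_minus_one)
    finally show ?case using 1 by simp
  qed
  have int: "integrable \<pi> (\<lambda>z. ln (p z))"
  proof (rule Bochner_Integration.integrable_bound)
    show "integrable \<pi> (\<lambda>z. \<bar>u z\<bar> + \<bar>\<rho> z\<bar> + 2 + \<bar>1 / p z\<bar>)" using ui(1) i1 i2 by (intro Bochner_Integration.integrable_add integrable_abs) auto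
    show "(\<lambda>z. ln (p z)) \<in> borel_measurable \<pi>" by (simp add: \<pi>_def)
    show "AE z in \<pi>. norm (ln (p z)) \<le> norm (\<bar>u z\<bar> + \<bar>\<rho> z\<bar> + 2 + \<bar>1 / p z\<bar>)"
      using bounds
    proof eventually_elim
      case (elim z)
      have "1 / p z \<le> \<bar>1 / p z\<bar>" "u z \<le> \<bar>u z\<bar>" "\<rho> z \<le> \<bar>\<rho> z\<bar>" by (rule abs_ge_self)+
      moreover have "0 \<le> \<bar>1 / p z\<bar>" "0 \<le> \<bar>u z\<bar>" "0 \<le> \<bar>\<rho> z\<bar>" by (rule abs_ge_zero)+
      ultimately have "ln (p z) \<le> \<bar>u z\<bar> + \<bar>\<rho> z\<bar> + 2 + \<bar>1 / p z\<bar>" "- ln (p z) \<le> \<bar>u z\<bar> + \<bar>\<rho> z\<bar> + 2 + \<bar>1 / p z\<bar>"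
        using elim by linarith+
      then show ?case unfolding real_norm_def by (metis abs_ge_self abs_leI order_trans)
    qed
  qed
  have "(\<integral>z. ln (p z) \<partial>\<pi>) \<le> (\<integral>z. u z + (\<rho> z - 1) \<partial>\<pi>)"
    using bounds ui(1) i1 int by (intro integral_mono_AE) auto
  also have "\<dots> \<le> (\<integral>z. u z \<partial>\<pi>)" using ui(1) i1 i1' by (simp add: P.prob_space)
  finally have l: "(\<integral>z. ln (p z) \<partial>\<pi>) \<le> (\<integral>z. u z \<partial>\<pi>)" .
  have "OT \<sigma> \<alpha> \<beta> \<le> ereal ((\<integral>z. (case z of (x, y) \<Rightarrow> (norm (x - y))\<^sup>2) \<partial>\<pi>) + 2 * \<sigma>\<^sup>2 * (\<integral>z. ln (p z) \<partial>\<pi>))"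
    by (rule up(2)[OF int])
  also have "\<dots> \<le> ereal ((\<integral>z. (case z of (x, y) \<Rightarrow> (norm (x - y))\<^sup>2) \<partial>\<pi>) + 2 * \<sigma>\<^sup>2 * (\<integral>z. u z \<partial>\<pi>))"
    using l by (simp add: mult_left_mono)
  also have "\<dots> = ereal ((\<integral>x. f x \<partial>\<alpha>) + (\<integral>y. g y \<partial>\<beta>))"
    unfolding ui(2) using \<sigma> by simp
  finally show ?thesis .
qed

section \<open>An explicit self-coupling\<close>

lemma nn_integral_lborel_translate:
  fixes t :: "'a::euclidean_space"
  assumes [measurable]: "f \<in> borel_measurable borel"
  shows "(\<integral>\<^sup>+x. f (t + x) \<partial>lborel) = (\<integral>\<^sup>+x. f x \<partial>lborel)"
  by (subst (2) lborel_affine[of 1 t])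
    (simp_all add: nn_integral_density nn_integral_distr)

lemma prod_Basis_vec: "(\<Prod>b\<in>Basis. f (x \<bullet> b)) = (\<Prod>i\<in>UNIV. f ((x::real^'d) $ i))"
proof (rule prod.reindex_cong)
  show "inj (\<lambda>i::'d. axis i (1::real))" by (auto simp: inj_on_def axis_eq_axis)
  show "Basis = range (\<lambda>i::'d. axis i (1::real))" by (auto simp: Basis_vec_def)
qed (simp add: inner_axis)

lemma exp_norm_sq_prod: "exp (a * (norm (x::real^'d))\<^sup>2) = (\<Prod>i\<in>UNIV. exp (a * (x $ i)\<^sup>2))"
  by (simp add: exp_sum[symmetric] norm_vec_def L2_set_def sum_nonneg sum_distrib_left)

lemma nn_integral_prod_vec:
  fixes f :: "real \<Rightarrow> real"
  assumes [measurable]: "f \<in> borel_measurable borel" and "\<And>t. 0 \<le> f t"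
  shows "(\<integral>\<^sup>+x. ennreal (\<Prod>i\<in>UNIV. f ((x::real^'d) $ i)) \<partial>lborel) = (\<integral>\<^sup>+t. ennreal (f t) \<partial>lborel) ^ CARD('d)"
  using nn_integral_lborel_prod[where ?'a = "real^'d" and f = "\<lambda>_. f"] assms
  by (simp add: prod_Basis_vec[symmetric] prod_ennreal)

lemma gaussian_mass_1:
  assumes "a > 0"
  shows "(\<integral>\<^sup>+t. ennreal (exp (- a * t\<^sup>2)) \<partial>lborel) = ennreal (sqrt (pi / a))"
proof -
  define s where "s = sqrt (1 / (2 * a))"
  have s: "s > 0" "s\<^sup>2 = 1 / (2 * a)" using assms by (auto simp: s_def)
  have eq: "exp (- a * t\<^sup>2) = sqrt (pi / a) * normal_density 0 s t" for t
    using assms by (simp add: normal_density_def s field_simps real_sqrt_divide)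
  have "(\<integral>\<^sup>+t. ennreal (exp (- a * t\<^sup>2)) \<partial>lborel) = ennreal (sqrt (pi / a)) * (\<integral>\<^sup>+t. ennreal (normal_density 0 s t) \<partial>lborel)"
    unfolding eq using assms by (subst nn_integral_cmult[symmetric]) (auto simp: ennreal_mult)
  also have "(\<integral>\<^sup>+t. ennreal (normal_density 0 s t) \<partial>lborel) = 1"
    using nn_integral_eq_integral[OF integrable_normal_density[OF s(1), of 0]] s by simp
  finally show ?thesis by simp
qed

lemma gaussian_mass:
  assumes "a > 0"
  shows "(\<integral>\<^sup>+x. ennreal (exp (- a * (norm (x::real^'d))\<^sup>2)) \<partial>lborel) = ennreal (sqrt (pi / a) ^ CARD('d))"
  unfolding exp_norm_sq_prod using nn_integral_prod_vec[where ?'d = 'd and f = "\<lambda>t. exp (- a * t\<^sup>2)"] gaussian_mass_1[OF assms] assms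
  by (simp add: ennreal_power)

text \<open>A square root under convolution of the Gibbs kernel
  \<open>exp (- |x - y|^2 / (2 \<sigma>^2))\<close>. The denominator is the root of the integral of
  \<open>exp (- 2 |z|^2 / \<sigma>^2)\<close>, the factor left after completing the square, so the
  convolution identity holds with constant 1.\<close>

definition root_kernel :: "real \<Rightarrow> real^'d \<Rightarrow> real^'d \<Rightarrow> real" where
  "root_kernel \<sigma> x z = exp (- ((norm (x - z))\<^sup>2) / \<sigma>\<^sup>2) / sqrt (sqrt (pi / (2 / \<sigma>\<^sup>2)) ^ CARD('d))"

lemma root_kernel_pos: "\<sigma> > 0 \<Longrightarrow> 0 < root_kernel \<sigma> x z"
  by (simp add: root_kernel_def)

lemma root_kernel_measurable [measurable]:
  "(\<lambda>(x, z). root_kernel \<sigma> x z) \<in> borel_measurable (borel \<Otimes>\<^sub>M borel)"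
  unfolding root_kernel_def by measurable

text \<open>The parallelogram law around the midpoint of x and y separates z from x - y; what
  remains in z is a translated Gaussian.\<close>

lemma root_kernel_convolution:
  fixes x y :: "real^'d"
  assumes "\<sigma> > 0"
  shows "(\<integral>\<^sup>+z. ennreal (root_kernel \<sigma> x z * root_kernel \<sigma> y z) \<partial>lborel)
    = ennreal (exp (- ((norm (x - y))\<^sup>2) / (2 * \<sigma>\<^sup>2)))"
proof -
  define C where "C = sqrt (pi / (2 / \<sigma>\<^sup>2)) ^ CARD('d)"
  define m where "m = (1/2) *\<^sub>R (x + y)"
  have C: "C > 0" using assms by (simp add: C_def)
  have q: "(norm (x - z))\<^sup>2 + (norm (y - z))\<^sup>2 = 2 * (norm (- m + z))\<^sup>2 + (norm (x - y))\<^sup>2 / 2" for z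
    unfolding m_def power2_norm_eq_inner
    by (simp add: inner_diff_left inner_diff_right inner_add_left inner_add_right inner_commute field_simps)
  have "root_kernel \<sigma> x z * root_kernel \<sigma> y z
      = exp (- ((norm (x - y))\<^sup>2) / (2 * \<sigma>\<^sup>2)) / C * exp (- (2 / \<sigma>\<^sup>2) * (norm (- m + z))\<^sup>2)" for z
  proof -
    have "root_kernel \<sigma> x z * root_kernel \<sigma> y z
       = exp (- ((norm (x - z))\<^sup>2) / \<sigma>\<^sup>2 + - ((norm (y - z))\<^sup>2) / \<sigma>\<^sup>2) / C"
      using C unfolding root_kernel_def C_def[symmetric] exp_add by (simp add: field_simps)
    also have "- ((norm (x - z))\<^sup>2) / \<sigma>\<^sup>2 + - ((norm (y - z))\<^sup>2) / \<sigma>\<^sup>2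
       = - (((norm (x - z))\<^sup>2 + (norm (y - z))\<^sup>2) / \<sigma>\<^sup>2)" by (simp add: add_divide_distrib)
    also have "\<dots> = - ((norm (x - y))\<^sup>2) / (2 * \<sigma>\<^sup>2) + - (2 / \<sigma>\<^sup>2) * (norm (- m + z))\<^sup>2"
      unfolding q by (simp add: add_divide_distrib)
    finally show ?thesis by (simp only: exp_add times_divide_eq_left)
  qed
  then have "(\<integral>\<^sup>+z. ennreal (root_kernel \<sigma> x z * root_kernel \<sigma> y z) \<partial>lborel)
     = (\<integral>\<^sup>+z. ennreal (exp (- ((norm (x - y))\<^sup>2) / (2 * \<sigma>\<^sup>2)) / C) * ennreal (exp (- (2 / \<sigma>\<^sup>2) * (norm (- m + z))\<^sup>2)) \<partial>lborel)"
    using C by (simp add: ennreal_mult[symmetric])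
  also have "\<dots> = ennreal (exp (- ((norm (x - y))\<^sup>2) / (2 * \<sigma>\<^sup>2)) / C) * (\<integral>\<^sup>+z. ennreal (exp (- (2 / \<sigma>\<^sup>2) * (norm (- m + z))\<^sup>2)) \<partial>lborel)"
    by (rule nn_integral_cmult) measurable
  also have "(\<integral>\<^sup>+z. ennreal (exp (- (2 / \<sigma>\<^sup>2) * (norm (- m + z))\<^sup>2)) \<partial>lborel)
      = (\<integral>\<^sup>+z. ennreal (exp (- (2 / \<sigma>\<^sup>2) * (norm (z::real^'d))\<^sup>2)) \<partial>lborel)"
    using nn_integral_lborel_translate[of "\<lambda>z. ennreal (exp (- (2 / \<sigma>\<^sup>2) * (norm z)\<^sup>2))" "- m"] by simp
  also have "\<dots> = ennreal C" unfolding C_def using assms by (intro gaussian_mass) auto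
  finally show ?thesis using C by (simp add: ennreal_mult[symmetric])
qed

text \<open>The coupling below draws \<open>x\<close> from \<open>\<beta>\<close>, then \<open>z\<close> from the density
  \<open>root_kernel \<sigma> x z * a x * E \<gamma> z\<close>, then \<open>y\<close> from the posterior of \<open>x\<close> given \<open>z\<close>. It need not be
  optimal, but its cost already obeys the bound, so the potential of \<open>\<beta>\<close> itself is never needed.\<close>

lemma OT_self_le:
  fixes \<beta> \<gamma> :: "(real^'d) measure" and h :: "real^'d \<Rightarrow> real"
  assumes \<sigma>: "\<sigma> > 0" and \<beta>: "\<beta> \<in> P2" and \<gamma>: "prob_space \<gamma>" "sets \<gamma> = sets borel"
    and h: "integrable \<beta> h"
    and H: "\<And>x. (\<integral>\<^sup>+y. ennreal (exp ((h x + h y - (norm (x - y))\<^sup>2) / (2 * \<sigma>\<^sup>2))) \<partial>\<gamma>) = 1"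
  shows "OT \<sigma> \<beta> \<beta> \<le> ereal (2 * (\<integral>x. h x \<partial>\<beta>))"
proof -
  interpret B: prob_space \<beta> using P2_D[OF \<beta>] by auto
  interpret G: prob_space \<gamma> by fact
  interpret LB: pair_sigma_finite lborel \<beta> ..
  interpret LG: pair_sigma_finite lborel \<gamma> ..
  interpret BB: pair_sigma_finite \<beta> \<beta> ..
  have sets: "sets \<beta> = sets borel" using P2_D \<beta> by auto
  note [measurable_cong] = sets \<gamma>(2)
  have hm [measurable]: "h \<in> borel_measurable borel"
    using h sets measurable_cong_sets by blast
  define \<psi> where "\<psi> = (root_kernel \<sigma> :: real^'d \<Rightarrow> real^'d \<Rightarrow> real)"
  have psim: "(\<lambda>(x, z). \<psi> x z) \<in> borel_measurable (borel \<Otimes>\<^sub>M borel)"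
    unfolding \<psi>_def by (rule root_kernel_measurable)
  have [measurable]: "(\<lambda>w. \<psi> (f w) (g w)) \<in> borel_measurable N"
    if [measurable]: "f \<in> measurable N borel" "g \<in> measurable N borel" for f g and N :: "'x measure"
    using measurable_compose[OF measurable_Pair[OF that] psim] by simp
  have psi0: "0 < \<psi> x z" for x z unfolding \<psi>_def using root_kernel_pos[OF \<sigma>] .
  define a where "a x = exp (h x / (2 * \<sigma>\<^sup>2))" for x
  have [measurable]: "a \<in> borel_measurable borel" unfolding a_def by measurable
  have a0: "0 < a x" for x by (simp add: a_def)
  have pa0: "\<not> \<psi> x z * a x \<le> 0" for x z using psi0[of x z] a0[of x] by (simp add: not_le)
  define k where "k x y = exp (- ((norm (x - y))\<^sup>2) / (2 * \<sigma>\<^sup>2))" for x y :: "real^'d"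
  have k0: "0 < k x y" for x y by (simp add: k_def)
  have conv: "(\<integral>\<^sup>+z. ennreal (\<psi> x z * \<psi> y z) \<partial>lborel) = ennreal (k x y)" for x y
    unfolding \<psi>_def k_def by (rule root_kernel_convolution[OF \<sigma>])
  have split: "exp ((h x + h y - (norm (x - y))\<^sup>2) / (2 * \<sigma>\<^sup>2)) = a x * a y * k x y" for x y
    by (simp add: a_def k_def exp_add[symmetric] add_divide_distrib diff_divide_distrib)
  \<comment> \<open>Likelihood of the centre z under \<mu>. By \<open>psiE\<close> below, \<psi> x z
    times a x times \<open>E \<gamma> z\<close> is a probability density in z for each x; hence so
    is \<open>E \<mu> z * E \<gamma> z\<close> for every probability \<mu>, which is
    \<open>EE\<close>.\<close>
  define E where "E \<mu> z = (\<integral>\<^sup>+x. ennreal (\<psi> x z * a x) \<partial>\<mu>)" for \<mu> z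
  have EG [measurable]: "E \<gamma> \<in> borel_measurable borel" unfolding E_def by measurable
  have EB [measurable]: "E \<beta> \<in> borel_measurable borel" unfolding E_def by measurable
  have Epos: "0 < E \<beta> z" for z
  proof (rule ccontr)
    assume "\<not> 0 < E \<beta> z"
    then have "E \<beta> z = 0" by (simp add: not_less)
    then have "AE x in \<beta>. ennreal (\<psi> x z * a x) = 0"
      unfolding E_def by (subst (asm) nn_integral_0_iff_AE) auto
    then have "AE x in \<beta>. False" by (simp add: ennreal_eq_0_iff pa0)
    then show False by simp
  qed
  have k\<gamma>: "(\<integral>\<^sup>+y. ennreal (k x y * a y) \<partial>\<gamma>) = ennreal (1 / a x)" for x
  proof -
    have "1 = (\<integral>\<^sup>+y. ennreal (a x) * ennreal (k x y * a y) \<partial>\<gamma>)"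
      using H[of x] a0 k0 by (simp add: split ennreal_mult[symmetric] less_imp_le mult_ac)
    also have "\<dots> = ennreal (a x) * (\<integral>\<^sup>+y. ennreal (k x y * a y) \<partial>\<gamma>)"
      by (rule nn_integral_cmult) (simp add: k_def)
    finally have "ennreal (1 / a x) * 1 = ennreal (1 / a x) * (ennreal (a x) * (\<integral>\<^sup>+y. ennreal (k x y * a y) \<partial>\<gamma>))"
      by simp
    also have "\<dots> = (\<integral>\<^sup>+y. ennreal (k x y * a y) \<partial>\<gamma>)"
      using a0[of x] by (simp add: mult.assoc[symmetric] ennreal_mult[symmetric])
    finally show ?thesis by simp
  qed
  have psiE: "(\<integral>\<^sup>+z. ennreal (\<psi> x z) * E \<gamma> z \<partial>lborel) = ennreal (1 / a x)" for x
  proof -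
    have "(\<integral>\<^sup>+z. ennreal (\<psi> x z) * E \<gamma> z \<partial>lborel) = (\<integral>\<^sup>+z. \<integral>\<^sup>+y. ennreal (\<psi> x z) * ennreal (\<psi> y z * a y) \<partial>\<gamma> \<partial>lborel)"
      unfolding E_def by (subst nn_integral_cmult) auto
    also have "\<dots> = (\<integral>\<^sup>+y. \<integral>\<^sup>+z. ennreal (\<psi> x z) * ennreal (\<psi> y z * a y) \<partial>lborel \<partial>\<gamma>)"
      by (rule LG.Fubini'[symmetric]) measurable
    also have "\<dots> = (\<integral>\<^sup>+y. (\<integral>\<^sup>+z. ennreal (\<psi> x z * \<psi> y z) \<partial>lborel) * ennreal (a y) \<partial>\<gamma>)"
      using psi0 a0 by (subst nn_integral_multc[symmetric]) (auto intro!: nn_integral_cong simp: ennreal_mult[symmetric] less_imp_le mult_ac)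
    also have "\<dots> = ennreal (1 / a x)"
      unfolding conv k\<gamma>[symmetric] using k0 a0 by (simp add: ennreal_mult less_imp_le)
    finally show ?thesis .
  qed
  have EE: "(\<integral>\<^sup>+z. E \<mu> z * E \<gamma> z \<partial>lborel) = 1"
    if \<mu>: "prob_space \<mu>" and [measurable_cong]: "sets \<mu> = sets borel" for \<mu>
  proof -
    interpret M: prob_space \<mu> by fact
    interpret LM: pair_sigma_finite lborel \<mu> ..
    have "(\<integral>\<^sup>+z. E \<mu> z * E \<gamma> z \<partial>lborel) = (\<integral>\<^sup>+z. \<integral>\<^sup>+x. ennreal (\<psi> x z * a x) * E \<gamma> z \<partial>\<mu> \<partial>lborel)"
      unfolding E_def[of \<mu>] by (subst nn_integral_multc) auto
    also have "\<dots> = (\<integral>\<^sup>+x. \<integral>\<^sup>+z. ennreal (\<psi> x z * a x) * E \<gamma> z \<partial>lborel \<partial>\<mu>)"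
      by (rule LM.Fubini'[symmetric]) measurable
    also have "\<dots> = (\<integral>\<^sup>+x. ennreal (a x) * (\<integral>\<^sup>+z. ennreal (\<psi> x z) * E \<gamma> z \<partial>lborel) \<partial>\<mu>)"
      using psi0 a0 by (subst nn_integral_cmult[symmetric]) (auto intro!: nn_integral_cong simp: ennreal_mult less_imp_le mult_ac)
    also have "\<dots> = (\<integral>\<^sup>+x. 1 \<partial>\<mu>)"
      unfolding psiE using a0 by (intro nn_integral_cong) (simp add: ennreal_mult[symmetric] less_imp_le less_imp_neq[THEN not_sym])
    finally show ?thesis using M.emeasure_space_1 by simp
  qed
  \<comment> \<open>h is merely integrable, so E may be infinite at some z; the finite integrals in
    \<open>EE\<close> exclude this almost everywhere because \<open>E \<gamma>\<close> is
    positive.\<close>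
  have fin: "AE z in lborel. E \<beta> z < \<infinity> \<and> E \<gamma> z < \<infinity>"
  proof -
    have "AE z in lborel. E \<beta> z * E \<gamma> z \<noteq> \<infinity>" "AE z in lborel. E \<gamma> z * E \<gamma> z \<noteq> \<infinity>"
      by (rule nn_integral_PInf_AE; simp add: EE[OF B.prob_space_axioms sets] EE[OF \<gamma>])+
    moreover have "AE z in lborel. E \<gamma> z \<noteq> 0"
    proof (rule AE_I2)
      fix z show "E \<gamma> z \<noteq> 0"
      proof
        assume "E \<gamma> z = 0"
        then have "AE x in \<gamma>. ennreal (\<psi> x z * a x) = 0"
          unfolding E_def by (subst (asm) nn_integral_0_iff_AE) auto
        then have "AE x in \<gamma>. False" by (simp add: ennreal_eq_0_iff pa0)
        then show False by simp
      qed
    qed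
    ultimately show ?thesis
      by eventually_elim (auto simp: ennreal_mult_eq_top_iff less_top[symmetric])
  qed
  \<comment> \<open>Given z, the points x and y are independent with density \<psi> a / E \<beta>,
    while z has density E \<beta> E \<gamma>; the joint density therefore carries the factor E
    \<gamma> / E \<beta>. Integrating z out gives \<open>KT\<close>.\<close>
  define T where "T z = E \<gamma> z / E \<beta> z" for z
  have [measurable]: "T \<in> borel_measurable borel" unfolding T_def by measurable
  have TE: "AE z in lborel. T z * E \<beta> z = E \<gamma> z"
    using fin
  proof eventually_elim
    case (elim z)
    then show ?case using Epos[of z] unfolding T_def
      by (metis ennreal_divide_times ennreal_divide_self ennreal_times_divide infinity_ennreal_def less_irrefl mult.right_neutral not_gr_zero order_less_le)
  qed
  define KT where "KT x y = (\<integral>\<^sup>+z. ennreal (\<psi> x z * \<psi> y z) * T z \<partial>lborel)" for x y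
  have KTm [measurable]: "(\<lambda>w. KT (f w) (g w)) \<in> borel_measurable N"
    if [measurable]: "f \<in> measurable N borel" "g \<in> measurable N borel" for f g and N :: "'x measure"
    unfolding KT_def by measurable
  have KTsym: "KT x y = KT y x" for x y unfolding KT_def by (simp add: mult.commute)
  have marg: "(\<integral>\<^sup>+y. ennreal (a x * a y) * KT x y \<partial>\<beta>) = 1" for x
  proof -
    have "(\<integral>\<^sup>+y. ennreal (a x * a y) * KT x y \<partial>\<beta>)
        = (\<integral>\<^sup>+y. \<integral>\<^sup>+z. ennreal (a x) * (ennreal (\<psi> x z) * T z) * ennreal (\<psi> y z * a y) \<partial>lborel \<partial>\<beta>)"
      unfolding KT_def using psi0 a0
      by (subst nn_integral_cmult[symmetric]) (auto intro!: nn_integral_cong simp: ennreal_mult less_imp_le mult_ac)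
    also have "\<dots> = (\<integral>\<^sup>+z. \<integral>\<^sup>+y. ennreal (a x) * (ennreal (\<psi> x z) * T z) * ennreal (\<psi> y z * a y) \<partial>\<beta> \<partial>lborel)"
      by (rule LB.Fubini') measurable
    also have "\<dots> = (\<integral>\<^sup>+z. ennreal (a x) * (ennreal (\<psi> x z) * T z) * E \<beta> z \<partial>lborel)"
      unfolding E_def by (subst nn_integral_cmult) auto
    also have "\<dots> = (\<integral>\<^sup>+z. ennreal (a x) * (ennreal (\<psi> x z) * E \<gamma> z) \<partial>lborel)"
      using TE by (intro nn_integral_cong_AE) (auto simp: mult.assoc)
    also have "\<dots> = ennreal (a x) * ennreal (1 / a x)"
      unfolding psiE[symmetric] by (rule nn_integral_cmult) measurable
    also have "\<dots> = 1" using a0[of x] by (simp add: ennreal_mult[symmetric])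
    finally show ?thesis .
  qed
  have KTfin: "AE y in \<beta>. KT x y < \<infinity>" for x
  proof -
    have "AE y in \<beta>. ennreal (a x * a y) * KT x y \<noteq> \<infinity>"
      using marg[of x] by (intro nn_integral_PInf_AE) auto
    then show ?thesis
      by eventually_elim (use a0 in \<open>auto simp: ennreal_mult_eq_top_iff less_top[symmetric] ennreal_eq_0_iff not_le\<close>)
  qed
  \<comment> \<open>Cauchy-Schwarz for the functions 1 and T under the measure \<psi> x z \<psi> y z
    dz, whose total mass is \<open>k x y\<close>. This is where the Gram structure of the kernel is
    exploited.\<close>
  have cs: "(KT x y)\<^sup>2 \<le> ennreal (k x y) * (\<integral>\<^sup>+z. ennreal (\<psi> x z * \<psi> y z) * (T z)\<^sup>2 \<partial>lborel)" for x y
  proof -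
    define r where "r z = sqrt (\<psi> x z * \<psi> y z)" for z
    have [measurable]: "r \<in> borel_measurable borel" unfolding r_def by measurable
    have r: "ennreal (r z) * ennreal (r z) = ennreal (\<psi> x z * \<psi> y z)" for z
      using psi0[of x z] psi0[of y z] by (simp add: r_def ennreal_mult[symmetric] less_imp_le)
    have "(\<integral>\<^sup>+z. ennreal (r z) * (ennreal (r z) * T z) \<partial>lborel)\<^sup>2
      \<le> (\<integral>\<^sup>+z. (ennreal (r z))\<^sup>2 \<partial>lborel) * (\<integral>\<^sup>+z. (ennreal (r z) * T z)\<^sup>2 \<partial>lborel)"
      by (rule Cauchy_Schwarz_nn_integral) measurable
    moreover have "ennreal (r z) * (ennreal (r z) * T z) = ennreal (\<psi> x z * \<psi> y z) * T z" for z
      by (simp add: r[symmetric] mult_ac)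
    moreover have "(ennreal (r z) * T z)\<^sup>2 = ennreal (\<psi> x z * \<psi> y z) * (T z)\<^sup>2" for z
      by (simp add: r[symmetric] power2_eq_square mult_ac)
    moreover have "(ennreal (r z))\<^sup>2 = ennreal (\<psi> x z * \<psi> y z)" for z
      by (simp add: r[symmetric] power2_eq_square)
    ultimately show ?thesis by (simp only: KT_def conv)
  qed
  \<comment> \<open>Integrating out x and y leaves the integral of T^2 (E \<beta>)^2 = (E
    \<gamma>)^2. So \<beta> drops out, and \<open>EE\<close> for \<gamma> itself gives 1.\<close>
  have total: "(\<integral>\<^sup>+x. \<integral>\<^sup>+y. ennreal (a x * a y) * (\<integral>\<^sup>+z. ennreal (\<psi> x z * \<psi> y z) * (T z)\<^sup>2 \<partial>lborel) \<partial>\<beta> \<partial>\<beta>) = 1"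
  proof -
    have "(\<integral>\<^sup>+y. ennreal (a x * a y) * (\<integral>\<^sup>+z. ennreal (\<psi> x z * \<psi> y z) * (T z)\<^sup>2 \<partial>lborel) \<partial>\<beta>)
        = (\<integral>\<^sup>+z. ennreal (\<psi> x z * a x) * ((T z)\<^sup>2 * E \<beta> z) \<partial>lborel)" for x
    proof -
      have "(\<integral>\<^sup>+y. ennreal (a x * a y) * (\<integral>\<^sup>+z. ennreal (\<psi> x z * \<psi> y z) * (T z)\<^sup>2 \<partial>lborel) \<partial>\<beta>)
        = (\<integral>\<^sup>+y. \<integral>\<^sup>+z. ennreal (\<psi> x z * a x) * (T z)\<^sup>2 * ennreal (\<psi> y z * a y) \<partial>lborel \<partial>\<beta>)"
        using psi0 a0
        by (subst nn_integral_cmult[symmetric]) (auto intro!: nn_integral_cong simp: ennreal_mult less_imp_le mult_ac)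
      also have "\<dots> = (\<integral>\<^sup>+z. \<integral>\<^sup>+y. ennreal (\<psi> x z * a x) * (T z)\<^sup>2 * ennreal (\<psi> y z * a y) \<partial>\<beta> \<partial>lborel)"
        by (rule LB.Fubini') measurable
      also have "\<dots> = (\<integral>\<^sup>+z. ennreal (\<psi> x z * a x) * (T z)\<^sup>2 * E \<beta> z \<partial>lborel)"
        unfolding E_def by (subst nn_integral_cmult) auto
      finally show ?thesis by (simp add: mult.assoc)
    qed
    then have "(\<integral>\<^sup>+x. \<integral>\<^sup>+y. ennreal (a x * a y) * (\<integral>\<^sup>+z. ennreal (\<psi> x z * \<psi> y z) * (T z)\<^sup>2 \<partial>lborel) \<partial>\<beta> \<partial>\<beta>)
       = (\<integral>\<^sup>+x. \<integral>\<^sup>+z. ennreal (\<psi> x z * a x) * ((T z)\<^sup>2 * E \<beta> z) \<partial>lborel \<partial>\<beta>)" by simp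
    also have "\<dots> = (\<integral>\<^sup>+z. \<integral>\<^sup>+x. ennreal (\<psi> x z * a x) * ((T z)\<^sup>2 * E \<beta> z) \<partial>\<beta> \<partial>lborel)"
      by (rule LB.Fubini') measurable
    also have "\<dots> = (\<integral>\<^sup>+z. E \<beta> z * ((T z)\<^sup>2 * E \<beta> z) \<partial>lborel)"
      unfolding E_def[of \<beta>] by (subst nn_integral_multc) (auto simp: E_def[symmetric])
    also have "\<dots> = (\<integral>\<^sup>+z. E \<gamma> z * E \<gamma> z \<partial>lborel)"
    proof (rule nn_integral_cong_AE)
      show "AE z in lborel. E \<beta> z * ((T z)\<^sup>2 * E \<beta> z) = E \<gamma> z * E \<gamma> z"
        using TE by eventually_elim (metis mult.assoc mult.commute power2_eq_square)
    qed
    also have "\<dots> = 1" by (rule EE[OF \<gamma>])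
    finally show ?thesis .
  qed
  \<comment> \<open>\<rho> compares the density of the coupling with the Gibbs density of the pair
    (h, h). \<open>enn2real\<close> sends an infinite \<open>KT\<close> to 0, which by
    \<open>KTfin\<close> concerns only a null set.\<close>
  define \<rho> where "\<rho> = (\<lambda>(x, y). enn2real (KT x y) / k x y)"
  define e where "e = (\<lambda>(x, y). exp ((h x + h y - (norm (x - y))\<^sup>2) / (2 * \<sigma>\<^sup>2)))"
  have er: "e (x, y) * \<rho> (x, y) = a x * a y * enn2real (KT x y)" for x y
    using k0[of x y] by (simp add: e_def \<rho>_def split)
  have m: "(\<integral>\<^sup>+y. ennreal (e (x, y) * \<rho> (x, y)) \<partial>\<beta>) = 1" for x
    unfolding marg[of x, symmetric] er
  proof (rule nn_integral_cong_AE)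
    show "AE y in \<beta>. ennreal (a x * a y * enn2real (KT x y)) = ennreal (a x * a y) * KT x y"
      using KTfin[of x] by eventually_elim (use a0 in \<open>auto simp: ennreal_mult less_imp_le ennreal_enn2real\<close>)
  qed
  have "OT \<sigma> \<beta> \<beta> \<le> ereal ((\<integral>x. h x \<partial>\<beta>) + (\<integral>x. h x \<partial>\<beta>))"
  proof (rule OT_upper[OF \<sigma> \<beta> \<beta> h h, of \<rho>, folded e_def])
    show "\<rho> \<in> borel_measurable (borel \<Otimes>\<^sub>M borel)" unfolding \<rho>_def k_def by measurable
    show "0 \<le> \<rho> z" for z using k0 by (simp add: \<rho>_def case_prod_beta less_imp_le)
    show "AE x in \<beta>. (\<integral>\<^sup>+y. ennreal (e (x, y) * \<rho> (x, y)) \<partial>\<beta>) = 1" using m by simp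
    have "e (x, y) * \<rho> (x, y) = e (y, x) * \<rho> (y, x)" for x y
      unfolding er by (simp add: KTsym[of x y] mult_ac)
    then show "AE y in \<beta>. (\<integral>\<^sup>+x. ennreal (e (x, y) * \<rho> (x, y)) \<partial>\<beta>) = 1" using m by simp
    show "(\<integral>\<^sup>+x. \<integral>\<^sup>+y. ennreal (e (x, y) * (\<rho> (x, y))\<^sup>2) \<partial>\<beta> \<partial>\<beta>) \<le> 1"
      unfolding total[symmetric]
    proof (intro nn_integral_mono)
      fix x y
      let ?I = "\<integral>\<^sup>+z. ennreal (\<psi> x z * \<psi> y z) * (T z)\<^sup>2 \<partial>lborel"
      have "e (x, y) * (\<rho> (x, y))\<^sup>2 = a x * a y / k x y * (enn2real (KT x y))\<^sup>2"
      proof -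
        have "e (x, y) = a x * a y * k x y" by (simp add: e_def split)
        then show ?thesis using k0[of x y] by (simp add: \<rho>_def power2_eq_square)
      qed
      then have "ennreal (e (x, y) * (\<rho> (x, y))\<^sup>2) = ennreal (a x * a y / k x y) * (ennreal (enn2real (KT x y)))\<^sup>2"
        using a0 k0 by (simp add: ennreal_mult[symmetric] less_imp_le ennreal_power)
      also have "\<dots> \<le> ennreal (a x * a y / k x y) * (KT x y)\<^sup>2"
        by (intro mult_left_mono power_mono) (auto simp: ennreal_enn2real_if)
      also have "\<dots> \<le> ennreal (a x * a y / k x y) * (ennreal (k x y) * ?I)"
        by (intro mult_left_mono cs) auto
      also have "\<dots> = ennreal (a x * a y) * ?I"
        using a0 k0[of x y] by (simp add: mult.assoc[symmetric] ennreal_mult[symmetric] less_imp_le)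
      finally show "ennreal (e (x, y) * (\<rho> (x, y))\<^sup>2) \<le> ennreal (a x * a y) * ?I" .
    qed
  qed
  then show ?thesis by simp
qed

section \<open>Uniqueness of the Laplace transform\<close>

text \<open>Once the lower coefficients are gone, dividing by \<open>x ^ n\<close> and letting x
  tend to 0 isolates \<open>a n\<close>.\<close>

lemma powser_zero_coeffs:
  fixes a :: "nat \<Rightarrow> real"
  assumes "\<And>x. (\<lambda>n. a n * x ^ n) sums 0"
  shows "a n = 0"
proof (induction n rule: less_induct)
  case (less n)
  have "(\<lambda>i. a (i + n) * x ^ i) sums 0" if "x \<noteq> 0" for x
  proof -
    have "(\<lambda>i. a (i + n) * x ^ (i + n)) sums (0 - (\<Sum>i<n. a i * x ^ i))"
      using assms[of x] by (subst sums_iff_shift) simp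
    then have "(\<lambda>i. a (i + n) * x ^ (i + n)) sums 0" using less by simp
    from sums_divide[OF this, of "x ^ n"] show ?thesis using that by (simp add: power_add)
  qed
  from powser_limit_0_strong[OF zero_less_one this]
  have "((\<lambda>x::real. 0) \<longlongrightarrow> a n) (at 0)" by simp
  then show ?case using tendsto_unique[OF trivial_limit_at] tendsto_const by (metis (full_types))
qed

text \<open>Dominated convergence with the majorant exp(c t) + exp(- c t), c = |z|. The argument is
  complex so that one series serves both the real transform and the characteristic function.\<close>

lemma integral_exp_series:
  fixes M :: "real measure" and z :: complex
  assumes [measurable_cong]: "sets M = sets borel"
    and int: "\<And>s. integrable M (\<lambda>t. exp (s * t))"
  shows "(\<lambda>n. complex_of_real (\<integral>t. t ^ n \<partial>M) * (z ^ n / fact n)) sums (\<integral>t. exp (z * complex_of_real t) \<partial>M)"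
proof -
  define w where "w c t = exp (c * t) + exp (- c * t)" for c t :: real
  have wi: "integrable M (w c)" for c unfolding w_def using int[of c] int[of "- c"] by simp
  have ew: "exp (c * \<bar>t\<bar>) \<le> w c t" for c t by (cases "t \<ge> 0") (auto simp: w_def)
  have mom: "integrable M (\<lambda>t. t ^ n)" for n
  proof (rule Bochner_Integration.integrable_bound)
    show "integrable M (\<lambda>t. fact n * w 1 t)" using wi by simp
    have "\<bar>t\<bar> ^ n \<le> fact n * w 1 t" for t
    proof -
      have "\<bar>t\<bar> ^ n /\<^sub>R fact n \<le> (\<Sum>i. \<bar>t\<bar> ^ i /\<^sub>R fact i)"
        using sum_le_suminf[OF summable_exp_generic[of "\<bar>t\<bar>"], of "{n}"] by simp
      also have "\<dots> = exp (1 * \<bar>t\<bar>)" by (simp add: exp_def)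
      also have "\<dots> \<le> w 1 t" by (rule ew)
      finally show ?thesis by (simp add: field_simps)
    qed
    then show "AE t in M. norm (t ^ n) \<le> norm (fact n * w 1 t)"
      by (auto simp: power_abs w_def intro!: AE_I2)
  qed simp
  let ?s = "\<lambda>n t. \<Sum>i<n. complex_of_real (t ^ i) * (z ^ i / fact i)"
  have trm: "complex_of_real (t ^ i) * (z ^ i / fact i) = (z * complex_of_real t) ^ i /\<^sub>R fact i" for t i
    by (simp add: power_mult_distrib scaleR_conv_of_real divide_inverse mult_ac)
  have "(\<lambda>n. \<integral>t. ?s n t \<partial>M) \<longlonglongrightarrow> (\<integral>t. exp (z * complex_of_real t) \<partial>M)"
  proof (rule integral_dominated_convergence)
    show "integrable M (w (norm z))" by (rule wi)
    show "AE t in M. (\<lambda>n. ?s n t) \<longlonglongrightarrow> exp (z * complex_of_real t)"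
      unfolding trm by (intro AE_I2 exp_converges[unfolded sums_def])
    show "AE t in M. norm (?s n t) \<le> w (norm z) t" for n
    proof (rule AE_I2)
      fix t
      have "norm (?s n t) \<le> (\<Sum>i<n. (norm z * \<bar>t\<bar>) ^ i /\<^sub>R fact i)"
        unfolding trm by (rule order_trans[OF norm_sum]) (simp add: norm_power norm_mult)
      also have "\<dots> \<le> (\<Sum>i. (norm z * \<bar>t\<bar>) ^ i /\<^sub>R fact i)"
        by (intro sum_le_suminf summable_exp_generic) auto
      also have "\<dots> = exp (norm z * \<bar>t\<bar>)" by (simp add: exp_def)
      also have "\<dots> \<le> w (norm z) t" by (rule ew)
      finally show "norm (?s n t) \<le> w (norm z) t" .
    qed
  qed measurable
  moreover have "(\<integral>t. ?s n t \<partial>M) = (\<Sum>i<n. complex_of_real (\<integral>t. t ^ i \<partial>M) * (z ^ i / fact i))" for n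
  proof -
    have "(\<integral>t. ?s n t \<partial>M) = (\<Sum>i<n. (\<integral>t. complex_of_real (t ^ i) * (z ^ i / fact i) \<partial>M))"
      by (rule Bochner_Integration.integral_sum) (intro integrable_mult_left integrable_of_real mom)
    also have "\<dots> = (\<Sum>i<n. complex_of_real (\<integral>t. t ^ i \<partial>M) * (z ^ i / fact i))"
      by (intro sum.cong refl, subst integral_mult_left_zero) (simp only: integral_complex_of_real)
    finally show ?thesis .
  qed
  ultimately show ?thesis unfolding sums_def by simp
qed

text \<open>On the real axis the series identifies all moments; at imaginary arguments the same
  moments give the characteristic function, which determines the law.\<close>

lemma mgf_unique_real_distribution:
  fixes M N :: "real measure"
  assumes M: "real_distribution M" and N: "real_distribution N"
    and iM: "\<And>s. integrable M (\<lambda>t. exp (s * t))" and iN: "\<And>s. integrable N (\<lambda>t. exp (s * t))"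
    and eq: "\<And>s. (\<integral>t. exp (s * t) \<partial>M) = (\<integral>t. exp (s * t) \<partial>N)"
  shows "M = N"
proof (rule Levy_uniqueness[OF M N])
  interpret M: real_distribution M by fact
  interpret N: real_distribution N by fact
  have sM: "sets M = sets borel" and sN: "sets N = sets borel" by auto
  have "(\<integral>t. t ^ n \<partial>M) / fact n - (\<integral>t. t ^ n \<partial>N) / fact n = 0" for n
  proof (rule powser_zero_coeffs)
    fix x :: real
    have *: "(\<lambda>n. (\<integral>t. t ^ n \<partial>L) / fact n * x ^ n) sums (\<integral>t. exp (x * t) \<partial>L)"
      if "sets L = sets borel" "\<And>s. integrable L (\<lambda>t. exp (s * t))" for L :: "real measure"
    proof -
      have e: "exp (complex_of_real x * complex_of_real t) = complex_of_real (exp (x * t))" for t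
        by (simp add: exp_of_real[symmetric])
      have "(\<lambda>n. complex_of_real ((\<integral>t. t ^ n \<partial>L) / fact n * x ^ n)) sums complex_of_real (\<integral>t. exp (x * t) \<partial>L)"
        using integral_exp_series[OF that, of "complex_of_real x"] unfolding e integral_complex_of_real by simp
      then show ?thesis by (simp only: sums_of_real_iff)
    qed
    from sums_diff[OF *[OF sM iM] *[OF sN iN]]
    show "(\<lambda>n. ((\<integral>t. t ^ n \<partial>M) / fact n - (\<integral>t. t ^ n \<partial>N) / fact n) * x ^ n) sums 0"
      by (simp add: eq left_diff_distrib)
  qed
  then have mom: "(\<integral>t. t ^ n \<partial>M) = (\<integral>t. t ^ n \<partial>N)" for n by (simp add: field_simps)
  have "(\<integral>t. exp (z * complex_of_real t) \<partial>M) = (\<integral>t. exp (z * complex_of_real t) \<partial>N)" for z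
    using integral_exp_series[OF sM iM, of z] integral_exp_series[OF sN iN, of z] sums_unique2
    unfolding mom by blast
  from this[of "\<i> * complex_of_real _"] show "char M = char N"
    unfolding char_def fun_eq_iff by (simp add: mult.assoc)
qed

text \<open>Division by the common total mass, the transform at 0, reduces to probability measures.
  The version for finite measures is the one that \<open>laplace_unique\<close> applies to weighted
  marginals.\<close>

lemma mgf_unique_real:
  fixes M N :: "real measure"
  assumes sM: "sets M = sets borel" and sN: "sets N = sets borel"
    and fin: "\<And>s. (\<integral>\<^sup>+t. ennreal (exp (s * t)) \<partial>M) < \<infinity>"
    and eq: "\<And>s. (\<integral>\<^sup>+t. ennreal (exp (s * t)) \<partial>M) = (\<integral>\<^sup>+t. ennreal (exp (s * t)) \<partial>N)"
  shows "M = N"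
proof -
  have sp: "space M = UNIV" "space N = UNIV" using sets_eq_imp_space_eq[OF sM] sets_eq_imp_space_eq[OF sN] by auto
  define m where "m = emeasure M UNIV"
  have m: "emeasure N UNIV = m" "m < \<infinity>" using eq[of 0] fin[of 0] sp by (auto simp: m_def)
  show ?thesis
  proof (cases "m = 0")
    case True
    have "emeasure M X = emeasure N X" for X
    proof -
      have "emeasure M X \<le> emeasure M (space M)" "emeasure N X \<le> emeasure N (space N)"
        by (rule emeasure_space)+
      then show ?thesis using True m sp by (simp add: m_def)
    qed
    then show ?thesis using sM sN by (intro measure_eqI) auto
  next
    case False
    define L where "L K = density K (\<lambda>_. 1 / m)" for K :: "real measure"
    have mm: "1 / m * m = 1" "m * (1 / m) = 1" using False m(2)
      by (auto simp: ennreal_times_divide ennreal_divide_self mult.commute[of _ m])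
    have L: "real_distribution (L K) \<and> (\<integral>\<^sup>+t. ennreal (exp (s * t)) \<partial>(L K)) = 1 / m * (\<integral>\<^sup>+t. ennreal (exp (s * t)) \<partial>K)
        \<and> density (L K) (\<lambda>_. m) = K"
      if K: "sets K = sets borel" "emeasure K UNIV = m" for K s
    proof -
      note [measurable_cong] = K(1)
      have "space K = UNIV" using sets_eq_imp_space_eq[OF K(1)] by simp
      then have "prob_space (L K)"
        by (intro prob_spaceI) (use K mm in \<open>simp add: L_def emeasure_density\<close>)
      then have "real_distribution (L K)"
        by (intro real_distribution.intro) (auto simp: real_distribution_axioms_def L_def K)
      moreover have "(\<integral>\<^sup>+t. ennreal (exp (s * t)) \<partial>(L K)) = 1 / m * (\<integral>\<^sup>+t. ennreal (exp (s * t)) \<partial>K)"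
        unfolding L_def by (simp add: nn_integral_density nn_integral_cmult)
      moreover have "density (L K) (\<lambda>_. m) = K"
        unfolding L_def by (subst density_density_eq) (auto simp: mm density_1 one_ennreal_def[symmetric])
      ultimately show ?thesis by blast
    qed
    note LM = L[OF sM m_def[symmetric]] and LN = L[OF sN m(1)]
    have "1 / m \<noteq> \<infinity>" using mm(1) False by (auto simp: ennreal_top_mult)
    then have f: "(\<integral>\<^sup>+t. ennreal (exp (s * t)) \<partial>(L M)) < \<infinity>" for s
      using LM[of s] fin[of s] by (simp add: ennreal_mult_eq_top_iff less_top[symmetric])
    have e: "(\<integral>\<^sup>+t. ennreal (exp (s * t)) \<partial>(L M)) = (\<integral>\<^sup>+t. ennreal (exp (s * t)) \<partial>(L N))" for s
      using LM LN eq by simp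
    interpret M: real_distribution "L M" using LM by blast
    interpret N: real_distribution "L N" using LN by blast
    have i: "integrable (L M) (\<lambda>t. exp (s * t))" "integrable (L N) (\<lambda>t. exp (s * t))" for s
      using f[of s] e[of s] by (auto intro!: integrableI_nonneg)
    have "(\<integral>t. exp (s * t) \<partial>(L M)) = (\<integral>t. exp (s * t) \<partial>(L N))" for s
      by (subst (1 2) integral_eq_nn_integral) (auto simp: e)
    then have "L M = L N" using LM LN i by (intro mgf_unique_real_distribution) auto
    then show ?thesis using LM LN by metis
  qed
qed

text \<open>The exponentials are traded for indicators of half-lines one coordinate at a time; each trade
  is the one-dimensional uniqueness theorem for a positive measure on the line.\<close>

lemma laplace_unique:
  fixes M N :: "(real^'d) measure"
  assumes sM [measurable_cong]: "sets M = sets borel" and sN [measurable_cong]: "sets N = sets borel"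
    and fin: "\<And>x. (\<integral>\<^sup>+y. ennreal (exp (x \<bullet> y)) \<partial>M) < \<infinity>"
    and eq: "\<And>x. (\<integral>\<^sup>+y. ennreal (exp (x \<bullet> y)) \<partial>M) = (\<integral>\<^sup>+y. ennreal (exp (x \<bullet> y)) \<partial>N)"
  shows "M = N"
proof -
  \<comment> \<open>S is the set of coordinates already traded for half-lines. An indicator is at
    most 1, the exponential with coefficient 0, which keeps every intermediate integral
    finite.\<close>
  define F where "F S x b y = (\<Prod>i\<in>UNIV. if i \<in> S then indicator {..b $ i} (y $ i) else exp (x $ i * y $ i))"
    for S and x b y :: "real^'d"
  have F0: "0 \<le> F S x b y" for S x b y unfolding F_def by (intro prod_nonneg) auto
  have Fm [measurable]: "F S x b \<in> borel_measurable borel" for S x b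
    unfolding F_def by (intro borel_measurable_prod) auto
  have Fempty: "F {} x b y = exp (x \<bullet> y)" for x b y
    by (simp add: F_def exp_sum[symmetric] inner_vec_def)
  have Fle: "F S x b y \<le> exp (x' \<bullet> y)" if "\<And>i. i \<notin> S \<Longrightarrow> x' $ i = x $ i" "\<And>i. i \<in> S \<Longrightarrow> x' $ i = 0" for S x x' b y
    unfolding Fempty[symmetric, of x' y b] F_def using that
    by (intro prod_mono) (auto simp: indicator_def)
  have Ffin: "(\<integral>\<^sup>+y. ennreal (F S x b y) \<partial>M) < \<infinity>" for S x b
  proof -
    have "(\<integral>\<^sup>+y. ennreal (F S x b y) \<partial>M) \<le> (\<integral>\<^sup>+y. ennreal (exp ((\<chi> i. if i \<in> S then 0 else x $ i) \<bullet> y)) \<partial>M)"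
      by (intro nn_integral_mono ennreal_leI Fle) auto
    then show ?thesis using fin order_le_less_trans by blast
  qed
  have main: "(\<integral>\<^sup>+y. ennreal (F S x b y) \<partial>M) = (\<integral>\<^sup>+y. ennreal (F S x b y) \<partial>N)" if "finite S" for S x b
    using that
  proof (induction S arbitrary: x b)
    case empty
    then show ?case using eq by (simp add: Fempty)
  next
    case (insert j S)
    define G where "G y = (\<Prod>i\<in>UNIV - {j}. if i \<in> S then indicator {..b $ i} (y $ i) else exp (x $ i * y $ i))"
      for y :: "real^'d"
    have G0: "0 \<le> G y" for y unfolding G_def by (intro prod_nonneg) auto
    have Gm [measurable]: "G \<in> borel_measurable borel"
      unfolding G_def by (intro borel_measurable_prod) auto
    have FG1: "F S (\<chi> i. if i = j then s else x $ i) b y = G y * exp (s * y $ j)" for s y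
    proof -
      let ?x = "(\<chi> i. if i = j then s else x $ i) :: real^'d"
      have "F S ?x b y = exp (s * y $ j) * (\<Prod>i\<in>UNIV - {j}. if i \<in> S then indicator {..b $ i} (y $ i) else exp (?x $ i * y $ i))"
        unfolding F_def using insert(2) by (subst prod.remove[of UNIV j]) auto
      also have "(\<Prod>i\<in>UNIV - {j}. if i \<in> S then indicator {..b $ i} (y $ i) else exp (?x $ i * y $ i)) = G y"
        unfolding G_def by (rule prod.cong) auto
      finally show ?thesis by simp
    qed
    have FG2: "F (insert j S) x b y = G y * indicator {..b $ j} (y $ j)" for y
      unfolding F_def G_def
      by (subst prod.remove[of UNIV j]) (auto simp: mult.commute intro!: prod.cong)
    \<comment> \<open>The law of coordinate j weighted by all other factors. Its exponential
      transform at s is the induction hypothesis with \<open>x $ j\<close> replaced by s; its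
      half-line masses are the claim for \<open>insert j S\<close>.\<close>
    define P where "P K = distr (density K (\<lambda>y. ennreal (G y))) borel (\<lambda>y. y $ j)" for K
    have P: "(\<integral>\<^sup>+t. ennreal (f t) \<partial>(P K)) = (\<integral>\<^sup>+y. ennreal (G y * f (y $ j)) \<partial>K)"
      if [measurable_cong]: "sets K = sets borel" and [measurable]: "f \<in> borel_measurable borel" for K and f :: "real \<Rightarrow> real"
      unfolding P_def using G0 by (simp add: nn_integral_distr nn_integral_density ennreal_mult')
    have "P M = P N"
    proof (rule mgf_unique_real)
      show "(\<integral>\<^sup>+t. ennreal (exp (s * t)) \<partial>(P M)) < \<infinity>" for s
        using Ffin[of S "\<chi> i. if i = j then s else x $ i" b] by (simp add: P[OF sM] FG1)
      show "(\<integral>\<^sup>+t. ennreal (exp (s * t)) \<partial>(P M)) = (\<integral>\<^sup>+t. ennreal (exp (s * t)) \<partial>(P N))" for s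
        using insert(3)[of "\<chi> i. if i = j then s else x $ i" b] by (simp add: P[OF sM] P[OF sN] FG1)
    qed (auto simp: P_def)
    then show ?case
      using P[OF sM, of "indicator {..b $ j}"] P[OF sN, of "indicator {..b $ j}"] by (simp add: FG2)
  qed
  have em: "emeasure K {..b} = (\<integral>\<^sup>+y. ennreal (F UNIV x b y) \<partial>K)" if [measurable_cong]: "sets K = sets borel" for K x b
  proof -
    have "ennreal (F UNIV x b y) = indicator {..b} y" for y
    proof (cases "y \<le> b")
      case True
      then show ?thesis by (auto simp: F_def indicator_def less_eq_vec_def)
    next
      case False
      then have "\<exists>i\<in>UNIV. \<not> y $ i \<le> b $ i" by (auto simp: less_eq_vec_def)
      then have "F UNIV x b y = 0" unfolding F_def by (intro prod_zero) (auto simp: indicator_def)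
      then show ?thesis using False by simp
    qed
    then show ?thesis using that by simp
  qed
  show ?thesis
  proof (rule measure_eqI_generator_eq)
    let ?E = "range (\<lambda>b::real^'d. {..b})"
    have "{..a} \<inter> {..b} = {..(\<chi> i. min (a $ i) (b $ i))}" for a b :: "real^'d"
      by (auto simp: less_eq_vec_def)
    then show "Int_stable ?E" by (auto simp: Int_stable_def)
    show "?E \<subseteq> Pow UNIV" by simp
    show "emeasure M X = emeasure N X" if "X \<in> ?E" for X
      using that em[OF sM] em[OF sN] main by auto
    have "sets borel = sigma_sets UNIV ?E" unfolding borel_eq_atMost by simp
    then show "sets M = sigma_sets UNIV ?E" "sets N = sigma_sets UNIV ?E" using sM sN by auto
    show "range (\<lambda>n. {..(\<chi> i. real n)}) \<subseteq> ?E" by auto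
    show "(\<Union>n. {..(\<chi> i. real n) :: real^'d}) = UNIV"
    proof -
      have "\<exists>n. y \<le> (\<chi> i. real n)" for y :: "real^'d"
      proof -
        obtain n where "norm y \<le> real n" using real_arch_simple by blast
        then show ?thesis
          by (intro exI[of _ n]) (auto simp: less_eq_vec_def intro: order_trans[OF abs_le_D1[OF component_le_norm_cart]])
      qed
      then show ?thesis by auto
    qed
    show "emeasure M {..(\<chi> i. real n)} \<noteq> \<infinity>" for n
      using Ffin em[OF sM] by (metis less_irrefl)
  qed
qed

section \<open>Gaussian measures\<close>

lemma std_gaussian_eq:
  "(std_gaussian :: (real^'d) measure)
    = density lborel (\<lambda>z. ennreal ((1 / sqrt (2 * pi)) ^ CARD('d) * exp (- (norm z)\<^sup>2 / 2)))"
proof -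
  have "(\<Prod>i\<in>UNIV. std_normal_density (z $ i)) = (1 / sqrt (2 * pi)) ^ CARD('d) * exp (- (norm z)\<^sup>2 / 2)"
    for z :: "real^'d"
    using exp_norm_sq_prod[of "- 1 / 2" z]
    by (simp add: std_normal_density_def prod.distrib prod_dividef power_divide)
  then show ?thesis unfolding std_gaussian_def by simp
qed

lemma sets_std_gaussian [measurable_cong, simp]: "sets std_gaussian = sets borel"
  by (simp add: std_gaussian_def)

lemma space_std_gaussian [simp]: "space std_gaussian = UNIV"
  by (simp add: std_gaussian_def)

lemma nn_integral_std_gaussian:
  assumes [measurable]: "f \<in> borel_measurable borel"
  shows "(\<integral>\<^sup>+z. f (z::real^'d) \<partial>std_gaussian)
    = (\<integral>\<^sup>+z. ennreal ((1 / sqrt (2 * pi)) ^ CARD('d) * exp (- (norm z)\<^sup>2 / 2)) * f z \<partial>lborel)"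
  unfolding std_gaussian_eq by (subst nn_integral_density) auto

lemma prob_space_std_gaussian: "prob_space (std_gaussian :: (real^'d) measure)"
proof
  have "emeasure (std_gaussian :: (real^'d) measure) (space std_gaussian) = (\<integral>\<^sup>+z. 1 \<partial>(std_gaussian :: (real^'d) measure))"
    by simp
  also have "\<dots> = (\<integral>\<^sup>+z. ennreal (\<Prod>i\<in>UNIV. std_normal_density ((z::real^'d) $ i)) \<partial>lborel)"
    unfolding std_gaussian_def by (subst nn_integral_density) auto
  also have "\<dots> = (\<integral>\<^sup>+t. ennreal (std_normal_density t) \<partial>lborel) ^ CARD('d)"
    by (rule nn_integral_prod_vec) auto
  also have "(\<integral>\<^sup>+t. ennreal (std_normal_density t) \<partial>lborel) = 1"
    using nn_integral_eq_integral[OF integrable_normal_density[of 1 0]] by simp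
  finally show "emeasure (std_gaussian :: (real^'d) measure) (space std_gaussian) = 1" by simp
qed

lemma matrix_vector_measurable [measurable]:
  "(\<lambda>w. (S::real^'d^'d) *v f w) \<in> borel_measurable M" if [measurable]: "f \<in> borel_measurable M"
proof -
  have "(*v) S \<in> borel_measurable borel"
    by (intro borel_measurable_continuous_onI linear_continuous_on matrix_vector_mul_bounded_linear)
  then show ?thesis using that by (rule measurable_compose[rotated])
qed

lemma sets_gaussian [measurable_cong, simp]: "sets (gaussian m S) = sets borel"
  by (simp add: gaussian_def)

lemma prob_space_gaussian: "prob_space (gaussian m S)"
  unfolding gaussian_def by (intro prob_space.prob_space_distr prob_space_std_gaussian) measurable

lemma nn_integral_gaussian:
  assumes [measurable]: "f \<in> borel_measurable borel"
  shows "(\<integral>\<^sup>+x. f x \<partial>(gaussian m S)) = (\<integral>\<^sup>+z. f (m + msqrt S *v z) \<partial>std_gaussian)"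
  unfolding gaussian_def by (subst nn_integral_distr) auto

lemma subgaussian_I:
  fixes \<mu> :: "(real^'d) measure"
  assumes \<mu>: "prob_space \<mu>" "sets \<mu> = sets borel" and q: "q > 0"
    and fin: "(\<integral>\<^sup>+x. ennreal (exp (q * (norm x)\<^sup>2)) \<partial>\<mu>) < \<infinity>"
  shows "\<mu> \<in> subgaussian"
proof -
  note [measurable_cong] = \<mu>(2)
  have i: "integrable \<mu> (\<lambda>x. exp (q * (norm x)\<^sup>2))" using fin by (intro integrableI_nonneg) auto
  have "integrable \<mu> (\<lambda>x. (norm x)\<^sup>2)"
  proof (rule Bochner_Integration.integrable_bound)
    show "integrable \<mu> (\<lambda>x. 1 / q * exp (q * (norm x)\<^sup>2))" using i by simp
    have "(norm x)\<^sup>2 \<le> 1 / q * exp (q * (norm x)\<^sup>2)" for x :: "real^'d"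
    proof -
      have "q * (norm x)\<^sup>2 \<le> exp (q * (norm x)\<^sup>2)"
        using exp_ge_add_one_self[of "q * (norm x)\<^sup>2"] by linarith
      then show ?thesis using q by (simp add: field_simps)
    qed
    then show "AE x in \<mu>. norm ((norm x)\<^sup>2) \<le> norm (1 / q * exp (q * (norm x)\<^sup>2))"
      using q by (auto intro!: AE_I2)
  qed measurable
  then show ?thesis using \<mu> q i by (auto simp: subgaussian_def P2_def)
qed

lemma gaussian_subgaussian: "gaussian m S \<in> subgaussian" for m :: "real^'d"
proof -
  \<comment> \<open>L bounds the squared operator norm of the root, the added 1 keeping it positive.
    The choice of q then makes the quadratic part of the exponent at most |z|^2 / 4, half of what
    the Gaussian density provides.\<close>
  define L where "L = (onorm ((*v) (msqrt S)))\<^sup>2 + 1"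
  define q where "q = 1 / (8 * L)"
  have L: "L > 0" by (simp add: L_def add_nonneg_pos)
  have q: "q > 0" "2 * q * L = 1 / 4" using L by (auto simp: q_def)
  define c where "c = (1 / sqrt (2 * pi)) ^ CARD('d)"
  have c: "c > 0" by (simp add: c_def)
  have bound: "q * (norm (m + msqrt S *v z))\<^sup>2 \<le> 2 * q * (norm m)\<^sup>2 + 1 / 4 * (norm z)\<^sup>2" for z
  proof -
    have "(norm (m + v))\<^sup>2 \<le> 2 * (norm m)\<^sup>2 + 2 * (norm v)\<^sup>2" for v
    proof -
      have "2 * (norm m)\<^sup>2 + 2 * (norm v)\<^sup>2 - (norm (m + v))\<^sup>2 = (norm (m - v))\<^sup>2"
        by (simp add: power2_norm_eq_inner algebra_simps)
      then show ?thesis by (smt (verit) zero_le_power2)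
    qed
    moreover have "(norm (msqrt S *v z))\<^sup>2 \<le> L * (norm z)\<^sup>2"
    proof -
      have "(norm (msqrt S *v z))\<^sup>2 \<le> (onorm ((*v) (msqrt S)) * norm z)\<^sup>2"
        by (intro power_mono onorm) auto
      also have "\<dots> \<le> L * (norm z)\<^sup>2" by (simp add: L_def power_mult_distrib mult_right_mono)
      finally show ?thesis .
    qed
    ultimately have "(norm (m + msqrt S *v z))\<^sup>2 \<le> 2 * (norm m)\<^sup>2 + 2 * (L * (norm z)\<^sup>2)"
      by (smt (verit))
    then have "q * (norm (m + msqrt S *v z))\<^sup>2 \<le> q * (2 * (norm m)\<^sup>2 + 2 * (L * (norm z)\<^sup>2))"
      using q by (intro mult_left_mono) auto
    also have "\<dots> = 2 * q * (norm m)\<^sup>2 + (2 * q * L) * (norm z)\<^sup>2" by (simp add: algebra_simps)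
    finally show ?thesis by (simp add: q)
  qed
  have "(\<integral>\<^sup>+x. ennreal (exp (q * (norm x)\<^sup>2)) \<partial>(gaussian m S))
      = (\<integral>\<^sup>+z. ennreal (c * exp (- (norm z)\<^sup>2 / 2)) * ennreal (exp (q * (norm (m + msqrt S *v z))\<^sup>2)) \<partial>lborel)"
    by (subst nn_integral_gaussian) (simp_all add: nn_integral_std_gaussian c_def)
  also have "\<dots> \<le> (\<integral>\<^sup>+z. ennreal (c * exp (2 * q * (norm m)\<^sup>2)) * ennreal (exp (- (1 / 4) * (norm (z::real^'d))\<^sup>2)) \<partial>lborel)"
  proof (intro nn_integral_mono)
    fix z :: "real^'d"
    have "c * exp (- (norm z)\<^sup>2 / 2) * exp (q * (norm (m + msqrt S *v z))\<^sup>2)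
       = c * exp (- (norm z)\<^sup>2 / 2 + q * (norm (m + msqrt S *v z))\<^sup>2)" by (simp only: exp_add mult.assoc)
    also have "\<dots> \<le> c * exp (2 * q * (norm m)\<^sup>2 + - (1 / 4) * (norm z)\<^sup>2)"
      using bound[of z] c by (intro mult_left_mono) auto
    also have "\<dots> = c * exp (2 * q * (norm m)\<^sup>2) * exp (- (1 / 4) * (norm z)\<^sup>2)" by (simp only: exp_add mult.assoc)
    finally show "ennreal (c * exp (- (norm z)\<^sup>2 / 2)) * ennreal (exp (q * (norm (m + msqrt S *v z))\<^sup>2))
      \<le> ennreal (c * exp (2 * q * (norm m)\<^sup>2)) * ennreal (exp (- (1 / 4) * (norm z)\<^sup>2))"
      using c by (simp only: ennreal_mult'[symmetric] exp_ge_zero ennreal_leI mult_nonneg_nonneg less_imp_le)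
  qed
  also have "\<dots> = ennreal (c * exp (2 * q * (norm m)\<^sup>2)) * (\<integral>\<^sup>+z. ennreal (exp (- (1 / 4) * (norm (z::real^'d))\<^sup>2)) \<partial>lborel)"
    by (rule nn_integral_cmult) measurable
  also have "\<dots> < \<infinity>"
    using gaussian_mass[where ?'d = 'd, of "1/4"] by (simp add: ennreal_mult_less_top)
  finally show ?thesis by (intro subgaussian_I[OF prob_space_gaussian _ q(1)]) auto
qed

lemma gaussian_P2: "gaussian m S \<in> P2"
  using gaussian_subgaussian[of m S] by (simp add: subgaussian_def)

text \<open>The equation says that Q is the inverse of P + \<sigma>^2 A^-1. After substituting x = a
  + R z the exponent is a concave quadratic in z with maximiser R^-1 Q y, and completing the square
  leaves the form of Q at y. Translation invariance of Lebesgue measure makes the remaining integral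
  C independent of y.\<close>

lemma gaussian_laplace_quadratic:
  fixes A P Q :: "real^'d^'d"
  assumes A: "pd A" and P: "psd P" and \<sigma>: "\<sigma> > 0" and eq: "\<sigma>\<^sup>2 *\<^sub>R Q + A ** P ** Q = A"
  obtains C where "C > 0"
    "\<And>y. (\<integral>\<^sup>+x. ennreal (exp ((2 * ((x - a) \<bullet> y) - (x - a) \<bullet> (P *v (x - a))) / (2 * \<sigma>\<^sup>2))) \<partial>(gaussian a A))
       = ennreal (C * exp ((y \<bullet> (Q *v y)) / (2 * \<sigma>\<^sup>2)))"
proof -
  define R where "R = msqrt A"
  have R: "pd R" "R ** R = A" using msqrt_pd[OF A] by (auto simp: R_def)
  obtain Ri where Ri: "R ** Ri = mat 1" "Ri ** R = mat 1" "pd Ri" using pd_inverse[OF R(1)] by blast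
  have sR: "transpose R = R" "transpose Ri = Ri" "transpose P = P" using R Ri P by (auto simp: pd_def psd_def)
  define c where "c = (1 / sqrt (2 * pi)) ^ CARD('d)"
  have c: "c > 0" by (simp add: c_def)
  define \<phi> where "\<phi> z = - (z \<bullet> z) / 2 - ((R *v z) \<bullet> (P *v (R *v z))) / (2 * \<sigma>\<^sup>2)" for z
  have \<phi>m [measurable]: "\<phi> \<in> borel_measurable borel" unfolding \<phi>_def by measurable
  have meq: "\<sigma>\<^sup>2 *\<^sub>R (Ri ** (Ri ** Q)) + P ** Q = mat 1"
  proof -
    have "Ri ** (Ri ** (\<sigma>\<^sup>2 *\<^sub>R Q + A ** P ** Q)) = Ri ** (Ri ** A)" by (simp only: eq)
    moreover have inv: "Ri ** (Ri ** (A ** C)) = C" for C :: "real^'d^'d"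
      unfolding R(2)[symmetric] by (metis Ri(2) matrix_mul_assoc matrix_mul_lid)
    ultimately show ?thesis using inv[of "mat 1"]
      by (simp add: matrix_add_ldistrib matrix_scaleR_right matrix_mul_assoc[symmetric])
  qed
  have yeq: "\<sigma>\<^sup>2 *\<^sub>R (Ri *v (Ri *v (Q *v y))) + P *v (Q *v y) = y" for y
    using arg_cong[OF meq, of "\<lambda>X. X *v y"] by (simp add: mv_simps)
  have RRi: "R *v (Ri *v v) = v" "Ri *v (R *v v) = v" for v by (simp_all add: matrix_vector_mul_assoc Ri)
  have shift: "\<phi> z + ((R *v z) \<bullet> y) / \<sigma>\<^sup>2 = \<phi> (- (Ri *v (Q *v y)) + z) + (y \<bullet> (Q *v y)) / (2 * \<sigma>\<^sup>2)" for y z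
  proof -
    define t where "t = Ri *v (Q *v y)"
    have Rt: "R *v t = Q *v y" by (simp add: t_def RRi)
    have Pq: "P *v (Q *v y) = y - \<sigma>\<^sup>2 *\<^sub>R (Ri *v t)" using yeq[of y] by (simp add: t_def algebra_simps)
    have zt: "(R *v z) \<bullet> (Ri *v t) = z \<bullet> t"
      using sym_inner[OF sR(2), of "R *v z" t] by (simp add: RRi)
    have tt: "(Q *v y) \<bullet> (Ri *v t) = t \<bullet> t"
      using sym_inner[OF sR(2), of "Q *v y" t] by (simp add: t_def)
    have cross: "(Q *v y) \<bullet> (P *v (R *v z)) = (R *v z) \<bullet> y - \<sigma>\<^sup>2 * (z \<bullet> t)"
      using sym_inner[OF sR(3), of "Q *v y" "R *v z"]
      by (simp add: Pq inner_diff_left inner_commute[of y] inner_commute[of "Ri *v t"] zt)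
    have cross': "(R *v z) \<bullet> (P *v (Q *v y)) = (R *v z) \<bullet> y - \<sigma>\<^sup>2 * (z \<bullet> t)"
      by (simp add: Pq inner_diff_right zt)
    have self: "(Q *v y) \<bullet> (P *v (Q *v y)) = y \<bullet> (Q *v y) - \<sigma>\<^sup>2 * (t \<bullet> t)"
      by (simp add: Pq inner_diff_right tt inner_commute)
    have "R *v (- t + z) = R *v z - Q *v y" using Rt by (simp add: mv_simps)
    then have "\<phi> (- t + z) = - ((z - t) \<bullet> (z - t)) / 2 - ((R *v z - Q *v y) \<bullet> (P *v (R *v z - Q *v y))) / (2 * \<sigma>\<^sup>2)"
      by (simp add: \<phi>_def)
    also have "(z - t) \<bullet> (z - t) = z \<bullet> z - 2 * (z \<bullet> t) + t \<bullet> t"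
      by (simp add: inner_diff_left inner_diff_right inner_commute)
    also have "(R *v z - Q *v y) \<bullet> (P *v (R *v z - Q *v y))
        = (R *v z) \<bullet> (P *v (R *v z)) - 2 * ((R *v z) \<bullet> y - \<sigma>\<^sup>2 * (z \<bullet> t)) + (y \<bullet> (Q *v y) - \<sigma>\<^sup>2 * (t \<bullet> t))"
      by (simp add: matrix_vector_mult_diff_distrib inner_diff_left inner_diff_right cross cross' self)
    finally have fin: "\<phi> (- t + z) = - (z \<bullet> z - 2 * (z \<bullet> t) + t \<bullet> t) / 2
      - ((R *v z) \<bullet> (P *v (R *v z)) - 2 * ((R *v z) \<bullet> y - \<sigma>\<^sup>2 * (z \<bullet> t)) + (y \<bullet> (Q *v y) - \<sigma>\<^sup>2 * (t \<bullet> t))) / (2 * \<sigma>\<^sup>2)" .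
    show ?thesis unfolding t_def[symmetric] fin using \<sigma> by (simp add: \<phi>_def[of z] field_simps)
  qed
  define C where "C = enn2real (\<integral>\<^sup>+z. ennreal (c * exp (\<phi> z)) \<partial>lborel)"
  have \<phi>le: "\<phi> z \<le> - (1 / 2) * (norm z)\<^sup>2" for z
    using P \<sigma> by (simp add: \<phi>_def psd_def power2_norm_eq_inner)
  have fin: "(\<integral>\<^sup>+z. ennreal (c * exp (\<phi> z)) \<partial>lborel) < \<infinity>"
  proof -
    have "(\<integral>\<^sup>+z. ennreal (c * exp (\<phi> z)) \<partial>lborel) \<le> (\<integral>\<^sup>+z. ennreal c * ennreal (exp (- (1 / 2) * (norm (z::real^'d))\<^sup>2)) \<partial>lborel)"
      using c \<phi>le by (intro nn_integral_mono) (simp add: ennreal_mult'[symmetric] ennreal_leI)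
    also have "\<dots> = ennreal c * (\<integral>\<^sup>+z. ennreal (exp (- (1 / 2) * (norm (z::real^'d))\<^sup>2)) \<partial>lborel)"
      by (rule nn_integral_cmult) measurable
    also have "\<dots> < \<infinity>" using gaussian_mass[where ?'d = 'd, of "1/2"] by (simp add: ennreal_mult_less_top)
    finally show ?thesis .
  qed
  have pos: "(\<integral>\<^sup>+z. ennreal (c * exp (\<phi> z)) \<partial>lborel) \<noteq> 0"
  proof
    assume "(\<integral>\<^sup>+z. ennreal (c * exp (\<phi> z)) \<partial>lborel) = 0"
    then have "AE z in (lborel::(real^'d) measure). ennreal (c * exp (\<phi> z)) = 0"
      by (subst (asm) nn_integral_0_iff_AE) auto
    then have "AE z in (lborel::(real^'d) measure). False"
      using c by (simp add: ennreal_eq_0_iff mult_le_0_iff not_le)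
    then show False by (simp add: trivial_limit_def[symmetric] ae_filter_eq_bot_iff)
  qed
  have C: "ennreal C = (\<integral>\<^sup>+z. ennreal (c * exp (\<phi> z)) \<partial>lborel)" using fin by (simp add: C_def)
  have C0: "C > 0" using fin pos by (simp add: C_def enn2real_positive_iff zero_less_iff_neq_zero)
  show thesis
  proof (rule that[OF C0])
    fix y :: "real^'d"
    have "(\<integral>\<^sup>+x. ennreal (exp ((2 * ((x - a) \<bullet> y) - (x - a) \<bullet> (P *v (x - a))) / (2 * \<sigma>\<^sup>2))) \<partial>(gaussian a A))
       = (\<integral>\<^sup>+z. ennreal (c * exp (- (norm z)\<^sup>2 / 2)) * ennreal (exp ((2 * ((R *v z) \<bullet> y) - (R *v z) \<bullet> (P *v (R *v z))) / (2 * \<sigma>\<^sup>2))) \<partial>lborel)"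
      by (subst nn_integral_gaussian) (simp_all add: nn_integral_std_gaussian c_def R_def)
    also have "\<dots> = (\<integral>\<^sup>+z. ennreal (exp ((y \<bullet> (Q *v y)) / (2 * \<sigma>\<^sup>2))) * ennreal (c * exp (\<phi> (- (Ri *v (Q *v y)) + z))) \<partial>lborel)"
    proof (intro nn_integral_cong)
      fix z :: "real^'d"
      have "- (norm z)\<^sup>2 / 2 + (2 * ((R *v z) \<bullet> y) - (R *v z) \<bullet> (P *v (R *v z))) / (2 * \<sigma>\<^sup>2) = \<phi> z + ((R *v z) \<bullet> y) / \<sigma>\<^sup>2"
        by (simp add: \<phi>_def power2_norm_eq_inner diff_divide_distrib)
      then have "exp (- (norm z)\<^sup>2 / 2) * exp ((2 * ((R *v z) \<bullet> y) - (R *v z) \<bullet> (P *v (R *v z))) / (2 * \<sigma>\<^sup>2))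
        = exp ((y \<bullet> (Q *v y)) / (2 * \<sigma>\<^sup>2)) * exp (\<phi> (- (Ri *v (Q *v y)) + z))"
        by (metis shift exp_add mult.commute)
      then show "ennreal (c * exp (- (norm z)\<^sup>2 / 2)) * ennreal (exp ((2 * ((R *v z) \<bullet> y) - (R *v z) \<bullet> (P *v (R *v z))) / (2 * \<sigma>\<^sup>2)))
        = ennreal (exp ((y \<bullet> (Q *v y)) / (2 * \<sigma>\<^sup>2))) * ennreal (c * exp (\<phi> (- (Ri *v (Q *v y)) + z)))"
        using c by (simp add: ennreal_mult'[symmetric] mult_ac)
    qed
    also have "\<dots> = ennreal (exp ((y \<bullet> (Q *v y)) / (2 * \<sigma>\<^sup>2))) * (\<integral>\<^sup>+z. ennreal (c * exp (\<phi> (- (Ri *v (Q *v y)) + z))) \<partial>lborel)"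
      by (rule nn_integral_cmult) measurable
    also have "(\<integral>\<^sup>+z. ennreal (c * exp (\<phi> (- (Ri *v (Q *v y)) + z))) \<partial>lborel) = ennreal C"
      unfolding C by (rule nn_integral_lborel_translate[of "\<lambda>z. ennreal (c * exp (\<phi> z))"]) measurable
    finally show "(\<integral>\<^sup>+x. ennreal (exp ((2 * ((x - a) \<bullet> y) - (x - a) \<bullet> (P *v (x - a))) / (2 * \<sigma>\<^sup>2))) \<partial>(gaussian a A))
       = ennreal (C * exp ((y \<bullet> (Q *v y)) / (2 * \<sigma>\<^sup>2)))"
      using C0 by (simp add: ennreal_mult'[symmetric] mult.commute)
  qed
qed

text \<open>The set where f and g differ pulls back to an open Lebesgue null set, which must be
  empty; invertibility of the root of S carries this back to every x.\<close>

lemma AE_gaussian_continuous: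
  fixes f g :: "real^'d \<Rightarrow> real"
  assumes S: "pd S" and f: "continuous_on UNIV f" and g: "continuous_on UNIV g"
    and AE: "AE x in gaussian m S. f x = g x"
  shows "f x = g x"
proof -
  define R where "R = msqrt S"
  obtain Ri where Ri: "R ** Ri = mat 1" using pd_inverse msqrt_pd(1)[OF S] unfolding R_def by metis
  have [measurable]: "f \<in> borel_measurable borel" "g \<in> borel_measurable borel"
    using f g by (auto intro: borel_measurable_continuous_onI)
  have "AE z in std_gaussian. f (m + R *v z) = g (m + R *v z)"
    using AE unfolding gaussian_def R_def by (subst (asm) AE_distr_iff) auto
  then have ae: "AE z in lborel. f (m + R *v z) = g (m + R *v z)"
    unfolding std_gaussian_eq by (subst (asm) AE_density) (auto simp: ennreal_zero_less_mult_iff)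
  define U where "U = {z. f (m + R *v z) \<noteq> g (m + R *v z)}"
  have cR: "continuous_on UNIV (\<lambda>z. m + R *v z)"
    by (intro continuous_intros linear_continuous_on matrix_vector_mul_bounded_linear)
  have "open U" unfolding U_def
    by (intro open_Collect_neq continuous_on_compose2[OF f cR] continuous_on_compose2[OF g cR]) auto
  have "U = {}"
  proof (rule ccontr)
    assume "U \<noteq> {}"
    then have "\<not> negligible U" using open_not_negligible \<open>open U\<close> by blast
    moreover have "U \<in> null_sets lborel"
      using ae \<open>open U\<close> AE_iff_null_sets[of U lborel] by (auto simp: U_def)
    ultimately show False
      using negligible_iff_null_sets null_sets_completionI by blast
  qed
  then have "f (m + R *v (Ri *v (x - m))) = g (m + R *v (Ri *v (x - m)))" unfolding U_def by blast
  then show ?thesis by (simp add: matrix_vector_mul_assoc Ri)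
qed

section \<open>Schroedinger potentials of Gaussians\<close>

text \<open>Potential on the side with mean a when the other side has mean b. The linear term
  absorbs the mixed terms caused by the offset of the means, so only centred variables survive in
  \<open>gauss_gibbs\<close>.\<close>

definition quad_potential :: "real^'d \<Rightarrow> real^'d \<Rightarrow> real^'d^'d \<Rightarrow> real^'d \<Rightarrow> real" where
  "quad_potential a b P x = (norm (x - a))\<^sup>2 - (x - a) \<bullet> (P *v (x - a)) + 2 * ((a - b) \<bullet> (x - a))"

text \<open>For matched P and Q and the right \<kappa> this is the density of the optimal coupling
  of two Gaussians relative to their product.\<close>

definition gauss_gibbs ::
  "real \<Rightarrow> real \<Rightarrow> real^'d \<Rightarrow> real^'d \<Rightarrow> real^'d^'d \<Rightarrow> real^'d^'d \<Rightarrow> real^'d \<Rightarrow> real^'d \<Rightarrow> real" where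
  "gauss_gibbs \<sigma> \<kappa> a b P Q x y =
     exp ((2 * ((x - a) \<bullet> (y - b)) - (x - a) \<bullet> (P *v (x - a)) - (y - b) \<bullet> (Q *v (y - b)) + \<kappa>) / (2 * \<sigma>\<^sup>2))"

lemma quad_potential_gibbs:
  "exp (((quad_potential a b P x + ((norm (a - b))\<^sup>2 + \<kappa>)) + quad_potential b a Q y - (norm (x - y))\<^sup>2) / (2 * \<sigma>\<^sup>2))
    = gauss_gibbs \<sigma> \<kappa> a b P Q x y"
proof -
  have "(norm (x - y))\<^sup>2 = (norm ((x - a) - (y - b) + (a - b)))\<^sup>2" by (simp add: algebra_simps)
  also have "\<dots> = (norm (x - a))\<^sup>2 + (norm (y - b))\<^sup>2 + (norm (a - b))\<^sup>2 - 2 * ((x - a) \<bullet> (y - b))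
      + 2 * ((a - b) \<bullet> (x - a)) - 2 * ((a - b) \<bullet> (y - b))"
    unfolding power2_norm_eq_inner
    by (simp add: inner_add_left inner_add_right inner_diff_left inner_diff_right inner_commute)
  finally have "(quad_potential a b P x + ((norm (a - b))\<^sup>2 + \<kappa>)) + quad_potential b a Q y - (norm (x - y))\<^sup>2
     = 2 * ((x - a) \<bullet> (y - b)) - (x - a) \<bullet> (P *v (x - a)) - (y - b) \<bullet> (Q *v (y - b)) + \<kappa>
      + 2 * ((b - a) \<bullet> (y - b)) + 2 * ((a - b) \<bullet> (y - b))"
    by (simp add: quad_potential_def)
  also have "\<dots> = 2 * ((x - a) \<bullet> (y - b)) - (x - a) \<bullet> (P *v (x - a)) - (y - b) \<bullet> (Q *v (y - b)) + \<kappa>"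
    by (simp add: inner_diff_left)
  finally show ?thesis unfolding gauss_gibbs_def by simp
qed

lemma quad_potential_measurable [measurable]: "quad_potential a b P \<in> borel_measurable borel"
  unfolding quad_potential_def by measurable

lemma gauss_gibbs_measurable [measurable]:
  "(\<lambda>w. gauss_gibbs \<sigma> \<kappa> a b P Q (f w) (g w)) \<in> borel_measurable N"
  if [measurable]: "f \<in> borel_measurable N" "g \<in> borel_measurable N"
  unfolding gauss_gibbs_def by measurable

lemma gauss_gibbs_pos: "0 < gauss_gibbs \<sigma> \<kappa> a b P Q x y"
  by (simp add: gauss_gibbs_def)

lemma quad_potential_integrable:
  fixes \<mu> :: "(real^'d) measure"
  assumes "\<mu> \<in> P2"
  shows "integrable \<mu> (quad_potential a b P)"
proof -
  note [measurable_cong] = P2_D(2)[OF assms]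
  interpret prob_space \<mu> using P2_D(1)[OF assms] .
  obtain L where L: "L > 0" "\<And>x. \<bar>x \<bullet> (P *v x)\<bar> \<le> L * (x \<bullet> x)" using quadratic_form_le by blast
  define c where "c = 1 + L + 2 * norm (a - b)"
  have c: "c \<ge> 0" using L by (simp add: c_def)
  show ?thesis
  proof (rule Bochner_Integration.integrable_bound)
    show "integrable \<mu> (\<lambda>x. c * (1 + (2 * (norm x)\<^sup>2 + 2 * (norm a)\<^sup>2)))"
      using P2_D(3)[OF assms] by auto
    have "\<bar>quad_potential a b P x\<bar> \<le> c * (1 + (2 * (norm x)\<^sup>2 + 2 * (norm a)\<^sup>2))" for x
    proof -
      define v where "v = x - a"
      have "norm v \<le> 1 + (norm v)\<^sup>2"
      proof -
        have "0 \<le> (norm v - 1/2)\<^sup>2" by simp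
        then show ?thesis unfolding power2_diff by (simp add: power_divide)
      qed
      have "\<bar>(a - b) \<bullet> v\<bar> \<le> norm (a - b) * norm v" by (rule Cauchy_Schwarz_ineq2)
      also have "\<dots> \<le> norm (a - b) * (1 + (norm v)\<^sup>2)"
        using \<open>norm v \<le> 1 + (norm v)\<^sup>2\<close> by (intro mult_left_mono) auto
      finally have i: "\<bar>(a - b) \<bullet> v\<bar> \<le> norm (a - b) * (1 + (norm v)\<^sup>2)" .
      have "\<bar>v \<bullet> (P *v v)\<bar> \<le> L * (norm v)\<^sup>2" using L(2)[of v] by (simp add: power2_norm_eq_inner)
      also have "\<dots> \<le> L * (1 + (norm v)\<^sup>2)" using L(1) by (intro mult_left_mono) auto
      finally have q: "\<bar>v \<bullet> (P *v v)\<bar> \<le> L * (1 + (norm v)\<^sup>2)" .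
      have "\<bar>quad_potential a b P x\<bar> \<le> (norm v)\<^sup>2 + \<bar>v \<bullet> (P *v v)\<bar> + 2 * \<bar>(a - b) \<bullet> v\<bar>"
        unfolding quad_potential_def v_def[symmetric] using zero_le_power2[of "norm v"] by linarith
      also have "\<dots> \<le> (1 + (norm v)\<^sup>2) + L * (1 + (norm v)\<^sup>2) + 2 * (norm (a - b) * (1 + (norm v)\<^sup>2))"
        using i q by linarith
      also have "\<dots> = c * (1 + (norm v)\<^sup>2)" by (simp add: c_def algebra_simps)
      also have "\<dots> \<le> c * (1 + (2 * (norm x)\<^sup>2 + 2 * (norm a)\<^sup>2))"
      proof -
        have "2 * (norm x)\<^sup>2 + 2 * (norm a)\<^sup>2 - (norm v)\<^sup>2 = (norm (x + a))\<^sup>2"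
          by (simp add: v_def power2_norm_eq_inner algebra_simps)
        then have "(norm v)\<^sup>2 \<le> 2 * (norm x)\<^sup>2 + 2 * (norm a)\<^sup>2" by (smt (verit) zero_le_power2)
        then show ?thesis using c by (intro mult_left_mono) auto
      qed
      finally show ?thesis .
    qed
    then show "AE x in \<mu>. norm (quad_potential a b P x) \<le> norm (c * (1 + (2 * (norm x)\<^sup>2 + 2 * (norm a)\<^sup>2)))"
      by (intro AE_I2) (metis abs_ge_self order_trans real_norm_def)
  qed measurable
qed

text \<open>\<kappa> normalises the x-integral for every y at once, since the dependence on y
  cancels by \<open>gaussian_laplace_quadratic\<close>. The y-integral is then some constant, and
  Tonelli for the total mass forces it to be 1.\<close>

lemma gauss_gibbs_marginals:
  fixes A B P Q :: "real^'d^'d"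
  assumes \<sigma>: "\<sigma> > 0" and A: "pd A" and B: "pd B" and P: "psd P" and Q: "psd Q"
    and eq: "\<sigma>\<^sup>2 *\<^sub>R Q + A ** P ** Q = A" "\<sigma>\<^sup>2 *\<^sub>R P + B ** Q ** P = B"
  obtains \<kappa> where
    "\<And>y. (\<integral>\<^sup>+x. ennreal (gauss_gibbs \<sigma> \<kappa> a b P Q x y) \<partial>(gaussian a A)) = 1"
    "\<And>x. (\<integral>\<^sup>+y. ennreal (gauss_gibbs \<sigma> \<kappa> a b P Q x y) \<partial>(gaussian b B)) = 1"
proof -
  interpret A: prob_space "gaussian a A" by (rule prob_space_gaussian)
  interpret B: prob_space "gaussian b B" by (rule prob_space_gaussian)
  interpret AB: pair_sigma_finite "gaussian a A" "gaussian b B" ..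
  obtain C1 where C1: "C1 > 0"
    "\<And>y. (\<integral>\<^sup>+x. ennreal (exp ((2 * ((x - a) \<bullet> y) - (x - a) \<bullet> (P *v (x - a))) / (2 * \<sigma>\<^sup>2))) \<partial>(gaussian a A))
       = ennreal (C1 * exp ((y \<bullet> (Q *v y)) / (2 * \<sigma>\<^sup>2)))"
    by (rule gaussian_laplace_quadratic[OF A P \<sigma> eq(1), of a]) (rule that)
  obtain C2 where C2: "C2 > 0"
    "\<And>y. (\<integral>\<^sup>+x. ennreal (exp ((2 * ((x - b) \<bullet> y) - (x - b) \<bullet> (Q *v (x - b))) / (2 * \<sigma>\<^sup>2))) \<partial>(gaussian b B))
       = ennreal (C2 * exp ((y \<bullet> (P *v y)) / (2 * \<sigma>\<^sup>2)))"
    by (rule gaussian_laplace_quadratic[OF B Q \<sigma> eq(2), of b]) (rule that)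
  define \<kappa> where "\<kappa> = - 2 * \<sigma>\<^sup>2 * ln C1"
  have k: "exp (\<kappa> / (2 * \<sigma>\<^sup>2)) = 1 / C1" proof -
    have "\<kappa> / (2 * \<sigma>\<^sup>2) = - ln C1" using \<sigma> by (simp add: \<kappa>_def)
    then show ?thesis using C1(1) by (simp add: exp_minus inverse_eq_divide)
  qed
  let ?E = "gauss_gibbs \<sigma> \<kappa> a b P Q"
  have m1: "(\<integral>\<^sup>+x. ennreal (?E x y) \<partial>(gaussian a A)) = 1" for y
  proof -
    let ?c = "1 / C1 * exp (- ((y - b) \<bullet> (Q *v (y - b))) / (2 * \<sigma>\<^sup>2))"
    have "?E x y = ?c * exp ((2 * ((x - a) \<bullet> (y - b)) - (x - a) \<bullet> (P *v (x - a))) / (2 * \<sigma>\<^sup>2))" for x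
      unfolding gauss_gibbs_def k[symmetric] exp_add[symmetric] by (simp add: add_divide_distrib diff_divide_distrib)
    then have "(\<integral>\<^sup>+x. ennreal (?E x y) \<partial>(gaussian a A))
      = (\<integral>\<^sup>+x. ennreal ?c * ennreal (exp ((2 * ((x - a) \<bullet> (y - b)) - (x - a) \<bullet> (P *v (x - a))) / (2 * \<sigma>\<^sup>2))) \<partial>(gaussian a A))"
      using C1(1) by (simp add: ennreal_mult'[symmetric])
    also have "\<dots> = ennreal ?c * ennreal (C1 * exp (((y - b) \<bullet> (Q *v (y - b))) / (2 * \<sigma>\<^sup>2)))"
      unfolding C1(2)[symmetric] by (rule nn_integral_cmult) measurable
    also have "\<dots> = ennreal (exp (- ((y - b) \<bullet> (Q *v (y - b))) / (2 * \<sigma>\<^sup>2)) * exp (((y - b) \<bullet> (Q *v (y - b))) / (2 * \<sigma>\<^sup>2)))"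
      using C1(1) by (simp add: ennreal_mult'[symmetric])
    also have "\<dots> = 1" by (simp add: exp_add[symmetric])
    finally show ?thesis .
  qed
  have m2: "(\<integral>\<^sup>+y. ennreal (?E x y) \<partial>(gaussian b B)) = ennreal (C2 / C1)" for x
  proof -
    let ?c = "1 / C1 * exp (- ((x - a) \<bullet> (P *v (x - a))) / (2 * \<sigma>\<^sup>2))"
    have "?E x y = ?c * exp ((2 * ((y - b) \<bullet> (x - a)) - (y - b) \<bullet> (Q *v (y - b))) / (2 * \<sigma>\<^sup>2))" for y
      unfolding gauss_gibbs_def k[symmetric] exp_add[symmetric] inner_commute[of "y - b" "x - a"]
      by (simp add: add_divide_distrib diff_divide_distrib)
    then have "(\<integral>\<^sup>+y. ennreal (?E x y) \<partial>(gaussian b B))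
      = (\<integral>\<^sup>+y. ennreal ?c * ennreal (exp ((2 * ((y - b) \<bullet> (x - a)) - (y - b) \<bullet> (Q *v (y - b))) / (2 * \<sigma>\<^sup>2))) \<partial>(gaussian b B))"
      using C1(1) by (simp add: ennreal_mult'[symmetric])
    also have "\<dots> = ennreal ?c * ennreal (C2 * exp (((x - a) \<bullet> (P *v (x - a))) / (2 * \<sigma>\<^sup>2)))"
      unfolding C2(2)[symmetric] by (rule nn_integral_cmult) measurable
    also have "\<dots> = ennreal (C2 / C1 * (exp (- ((x - a) \<bullet> (P *v (x - a))) / (2 * \<sigma>\<^sup>2)) * exp (((x - a) \<bullet> (P *v (x - a))) / (2 * \<sigma>\<^sup>2))))"
      using C1(1) C2(1) by (simp add: ennreal_mult'[symmetric])
    also have "\<dots> = ennreal (C2 / C1)" by (simp add: exp_add[symmetric])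
    finally show ?thesis .
  qed
  have "ennreal (C2 / C1) = (\<integral>\<^sup>+x. \<integral>\<^sup>+y. ennreal (?E x y) \<partial>(gaussian b B) \<partial>(gaussian a A))"
    by (simp add: m2 A.emeasure_space_1)
  also have "\<dots> = (\<integral>\<^sup>+y. \<integral>\<^sup>+x. ennreal (?E x y) \<partial>(gaussian a A) \<partial>(gaussian b B))"
    by (rule AB.Fubini'[symmetric]) measurable
  also have "\<dots> = 1" by (simp add: m1 B.emeasure_space_1)
  finally have "(\<integral>\<^sup>+y. ennreal (?E x y) \<partial>(gaussian b B)) = 1" for x using m2 by simp
  then show thesis using that m1 by blast
qed

text \<open>Equality in weak duality forces the first marginal of the Gibbs measure built from \<open>\<beta>\<close> to be
  right; that marginal is a Laplace transform of \<open>\<beta>\<close>, hence determines it.\<close>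

lemma gauss_potentials_determine_measure:
  fixes A P Q :: "real^'d^'d" and \<beta> \<gamma> :: "(real^'d) measure"
  assumes \<sigma>: "\<sigma> > 0" and A: "pd A" and Q: "pd Q" and \<beta>: "\<beta> \<in> P2"
    and \<gamma>: "sets \<gamma> = sets borel"
    and m1: "\<And>y. (\<integral>\<^sup>+x. ennreal (gauss_gibbs \<sigma> \<kappa> a b P Q x y) \<partial>(gaussian a A)) = 1"
    and m2: "\<And>x. (\<integral>\<^sup>+y. ennreal (gauss_gibbs \<sigma> \<kappa> a b P Q x y) \<partial>\<gamma>) = 1"
    and le: "OT \<sigma> (gaussian a A) \<beta> \<le>
      ereal ((\<integral>x. quad_potential a b P x + ((norm (a - b))\<^sup>2 + \<kappa>) \<partial>(gaussian a A)) + (\<integral>y. quad_potential b a Q y \<partial>\<beta>))"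
  shows "\<beta> = \<gamma>"
proof -
  let ?\<alpha> = "gaussian a A"
  let ?e = "gauss_gibbs \<sigma> \<kappa> a b P Q"
  note \<alpha> = gaussian_P2[of a A]
  note sb [measurable_cong] = P2_D(2)[OF \<beta>] and sg [measurable_cong] = \<gamma>
  interpret A: prob_space ?\<alpha> by (rule prob_space_gaussian)
  interpret B: prob_space \<beta> using P2_D[OF \<beta>] by auto
  interpret AB: pair_sigma_finite ?\<alpha> \<beta> ..
  define f where "f x = quad_potential a b P x + ((norm (a - b))\<^sup>2 + \<kappa>)" for x
  define g where "g = quad_potential b a Q"
  have [measurable]: "f \<in> borel_measurable borel" "g \<in> borel_measurable borel" unfolding f_def g_def by measurable
  have fi: "integrable ?\<alpha> f" unfolding f_def using quad_potential_integrable[OF \<alpha>] by auto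
  have gi: "integrable \<beta> g" unfolding g_def using quad_potential_integrable[OF \<beta>] .
  have e: "exp ((f x + g y - (norm (x - y))\<^sup>2) / (2 * \<sigma>\<^sup>2)) = ?e x y" for x y
    unfolding f_def g_def by (rule quad_potential_gibbs)
  obtain q where q: "q > 0" "\<And>x. q * (x \<bullet> x) \<le> x \<bullet> (Q *v x)" using pd_lower[OF Q] by blast
  \<comment> \<open>The maximum over y once Q is replaced by its lower bound q Id: uniform in y and
    continuous in x, it gives integrability here and domination in the continuity proof.\<close>
  define bd where "bd x = exp (((norm (x - a))\<^sup>2 / q - (x - a) \<bullet> (P *v (x - a)) + \<kappa>) / (2 * \<sigma>\<^sup>2))" for x
  have e_le: "?e x y \<le> bd x" for x y
  proof -
    let ?u = "x - a" and ?v = "y - b"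
    have id: "q * (norm (v - (1/q) *\<^sub>R u))\<^sup>2 = q * (v \<bullet> v) - 2 * (u \<bullet> v) + (norm u)\<^sup>2 / q" for u v :: "real^'d"
      unfolding power2_norm_eq_inner using q(1)
      by (simp add: inner_diff_left inner_diff_right inner_commute) (simp add: field_simps)
    have "0 \<le> q * (norm (?v - (1/q) *\<^sub>R ?u))\<^sup>2" using q(1) by simp
    also have "\<dots> = q * (?v \<bullet> ?v) - 2 * (?u \<bullet> ?v) + (norm ?u)\<^sup>2 / q" by (rule id)
    also have "\<dots> \<le> ?v \<bullet> (Q *v ?v) - 2 * (?u \<bullet> ?v) + (norm ?u)\<^sup>2 / q" using q(2)[of ?v] by simp
    finally show ?thesis unfolding gauss_gibbs_def bd_def using \<sigma> by (simp add: divide_right_mono)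
  qed
  have ei: "integrable \<beta> (?e x)" for x
    using e_le[of x] gauss_gibbs_pos[of \<sigma> \<kappa> a b P Q x]
    by (intro B.integrable_const_bound[of _ "bd x"]) (auto simp: abs_of_pos)
  define E where "E x = (\<integral>y. ?e x y \<partial>\<beta>)" for x
  have En: "(\<integral>\<^sup>+y. ennreal (?e x y) \<partial>\<beta>) = ennreal (E x)" for x
    unfolding E_def by (intro nn_integral_eq_integral ei AE_I2 less_imp_le gauss_gibbs_pos)
  have Em [measurable]: "E \<in> borel_measurable borel" unfolding E_def by measurable
  \<comment> \<open>|x - y|^2 \<le> 2 |x|^2 + 2 |y|^2 separates the variables. The resulting E x
    \<ge> c0 lo x bounds ln E below by an integrable function.\<close>
  define lo where "lo x = exp ((f x - 2 * (norm x)\<^sup>2) / (2 * \<sigma>\<^sup>2))" for x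
  define v where "v y = exp ((g y - 2 * (norm y)\<^sup>2) / (2 * \<sigma>\<^sup>2))" for y
  have vm [measurable]: "v \<in> borel_measurable borel" unfolding v_def by measurable
  have ev: "lo x * v y \<le> ?e x y" for x y
  proof -
    have "2 * (norm x)\<^sup>2 + 2 * (norm y)\<^sup>2 - (norm (x - y))\<^sup>2 = (norm (x + y))\<^sup>2"
      by (simp add: power2_norm_eq_inner algebra_simps)
    then have "(norm (x - y))\<^sup>2 \<le> 2 * (norm x)\<^sup>2 + 2 * (norm y)\<^sup>2" by (smt (verit) zero_le_power2)
    then have "(f x - 2 * (norm x)\<^sup>2) / (2 * \<sigma>\<^sup>2) + (g y - 2 * (norm y)\<^sup>2) / (2 * \<sigma>\<^sup>2) \<le> (f x + g y - (norm (x - y))\<^sup>2) / (2 * \<sigma>\<^sup>2)"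
      unfolding add_divide_distrib[symmetric] by (intro divide_right_mono) auto
    then show ?thesis unfolding e[symmetric] lo_def v_def exp_add[symmetric] by simp
  qed
  have lopos: "0 < lo x" for x by (simp add: lo_def)
  have vi: "integrable \<beta> v"
  proof (rule Bochner_Integration.integrable_bound[OF integrable_mult_right[OF ei[of 0], of "1 / lo 0"]])
    have "v y \<le> 1 / lo 0 * ?e 0 y" for y using ev[of 0 y] lopos[of 0] by (simp add: field_simps)
    then show "AE y in \<beta>. norm (v y) \<le> norm (1 / lo 0 * ?e 0 y)"
      by (intro AE_I2) (smt (verit) v_def exp_gt_zero real_norm_def)
  qed measurable
  define c0 where "c0 = (\<integral>y. v y \<partial>\<beta>)"
  have "c0 \<noteq> 0"
  proof
    assume "c0 = 0"
    then have "AE y in \<beta>. v y = 0"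
      unfolding c0_def using vi by (subst (asm) integral_nonneg_eq_0_iff_AE) (auto simp: v_def)
    then have "AE y in \<beta>. False" by (simp add: v_def)
    then show False by simp
  qed
  moreover have "c0 \<ge> 0" unfolding c0_def by (intro integral_nonneg_AE) (auto simp: v_def)
  ultimately have c0: "c0 > 0" by simp
  have Elo: "lo x * c0 \<le> E x" for x
    unfolding c0_def E_def integral_mult_right_zero[symmetric]
    using vi ei ev by (intro integral_mono) auto
  have Epos: "0 < E x" for x using Elo[of x] lopos[of x] c0 by (smt (verit) mult_pos_pos)
  have nE: "(\<integral>\<^sup>+x. ennreal (E x) \<partial>?\<alpha>) = 1"
  proof -
    have "(\<integral>\<^sup>+x. ennreal (E x) \<partial>?\<alpha>) = (\<integral>\<^sup>+y. \<integral>\<^sup>+x. ennreal (?e x y) \<partial>?\<alpha> \<partial>\<beta>)"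
      unfolding En[symmetric] by (rule AB.Fubini'[symmetric]) measurable
    then show ?thesis by (simp add: m1 B.emeasure_space_1)
  qed
  have Ei: "integrable ?\<alpha> E" using nE Epos by (intro integrableI_nonneg) (auto intro: less_imp_le)
  have E1: "(\<integral>x. E x \<partial>?\<alpha>) = 1"
    using nE nn_integral_eq_integral[OF Ei] Epos by (simp add: less_imp_le)
  have lnb: "ln c0 + (f x - 2 * (norm x)\<^sup>2) / (2 * \<sigma>\<^sup>2) \<le> ln (E x)" "ln (E x) \<le> E x - 1" for x
  proof -
    have "ln (lo x * c0) \<le> ln (E x)" using Elo[of x] Epos[of x] lopos[of x] c0 by (subst ln_le_cancel_iff) auto
    then show "ln c0 + (f x - 2 * (norm x)\<^sup>2) / (2 * \<sigma>\<^sup>2) \<le> ln (E x)"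
      using lopos[of x] c0 by (simp add: ln_mult lo_def)
    show "ln (E x) \<le> E x - 1" by (rule ln_le_minus_one[OF Epos])
  qed
  have lnE: "integrable ?\<alpha> (\<lambda>x. ln (E x))"
  proof (rule Bochner_Integration.integrable_bound)
    show "integrable ?\<alpha> (\<lambda>x. \<bar>ln c0 + (f x - 2 * (norm x)\<^sup>2) / (2 * \<sigma>\<^sup>2)\<bar> + \<bar>E x - 1\<bar>)"
      using fi Ei P2_D(3)[OF \<alpha>] by (intro Bochner_Integration.integrable_add integrable_abs) auto
    show "AE x in ?\<alpha>. norm (ln (E x)) \<le> norm (\<bar>ln c0 + (f x - 2 * (norm x)\<^sup>2) / (2 * \<sigma>\<^sup>2)\<bar> + \<bar>E x - 1\<bar>)"
    proof (rule AE_I2)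
      fix x
      show "norm (ln (E x)) \<le> norm (\<bar>ln c0 + (f x - 2 * (norm x)\<^sup>2) / (2 * \<sigma>\<^sup>2)\<bar> + \<bar>E x - 1\<bar>)"
        using lnb[of x] unfolding real_norm_def by linarith
    qed
  qed measurable
  \<comment> \<open>Half a Sinkhorn iteration: it corrects the first marginal and changes the dual
    value by -2 \<sigma>^2 times the integral of ln E. By \<open>le\<close> the dual value cannot
    increase, so that integral is nonnegative; together with ln E \<le> E - 1 and total mass 1 this
    forces E = 1 almost everywhere.\<close>
  define f' where "f' x = f x - 2 * \<sigma>\<^sup>2 * ln (E x)" for x
  have f'i: "integrable ?\<alpha> f'" unfolding f'_def using fi lnE by auto
  have e': "exp ((f' x + g y - (norm (x - y))\<^sup>2) / (2 * \<sigma>\<^sup>2)) = 1 / E x * ?e x y" for x y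
  proof -
    have "(f' x + g y - (norm (x - y))\<^sup>2) / (2 * \<sigma>\<^sup>2) = (f x + g y - (norm (x - y))\<^sup>2) / (2 * \<sigma>\<^sup>2) - ln (E x)"
      using \<sigma> by (simp add: f'_def field_simps)
    then show ?thesis using Epos[of x] by (simp add: exp_diff e)
  qed
  have "(\<integral>\<^sup>+x. \<integral>\<^sup>+y. ennreal (exp ((f' x + g y - (norm (x - y))\<^sup>2) / (2 * \<sigma>\<^sup>2))) \<partial>\<beta> \<partial>?\<alpha>) = (\<integral>\<^sup>+x. 1 \<partial>?\<alpha>)"
  proof (intro nn_integral_cong)
    fix x
    have "(\<integral>\<^sup>+y. ennreal (exp ((f' x + g y - (norm (x - y))\<^sup>2) / (2 * \<sigma>\<^sup>2))) \<partial>\<beta>) = ennreal (1 / E x) * (\<integral>\<^sup>+y. ennreal (?e x y) \<partial>\<beta>)"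
      unfolding e' using Epos[of x] by (subst nn_integral_cmult[symmetric]) (auto simp: ennreal_mult'[symmetric] less_imp_le)
    also have "\<dots> = 1" using Epos[of x] by (simp add: En ennreal_mult'[symmetric])
    finally show "(\<integral>\<^sup>+y. ennreal (exp ((f' x + g y - (norm (x - y))\<^sup>2) / (2 * \<sigma>\<^sup>2))) \<partial>\<beta>) = 1" .
  qed
  then have "ereal ((\<integral>x. f' x \<partial>?\<alpha>) + (\<integral>y. g y \<partial>\<beta>)) \<le> OT \<sigma> ?\<alpha> \<beta>"
    using A.emeasure_space_1 by (intro OT_lower \<sigma> \<alpha> \<beta> f'i gi) simp
  also have "\<dots> \<le> ereal ((\<integral>x. f x \<partial>?\<alpha>) + (\<integral>y. g y \<partial>\<beta>))" using le by (simp add: f_def g_def)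
  finally have "(\<integral>x. f' x \<partial>?\<alpha>) \<le> (\<integral>x. f x \<partial>?\<alpha>)" by simp
  then have lnE0: "0 \<le> (\<integral>x. ln (E x) \<partial>?\<alpha>)"
    unfolding f'_def using fi lnE \<sigma> by (simp add: zero_le_mult_iff)
  have "(\<integral>x. E x - 1 - ln (E x) \<partial>?\<alpha>) \<le> 0" using Ei lnE lnE0 E1 by (simp add: A.prob_space)
  moreover have "0 \<le> (\<integral>x. E x - 1 - ln (E x) \<partial>?\<alpha>)" using lnb(2) by (intro integral_nonneg_AE) auto
  ultimately have "(\<integral>x. E x - 1 - ln (E x) \<partial>?\<alpha>) = 0" by simp
  then have "AE x in ?\<alpha>. E x - 1 - ln (E x) = 0"
    using Ei lnE lnb(2) by (subst (asm) integral_nonneg_eq_0_iff_AE) auto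
  then have EAE: "AE x in ?\<alpha>. E x = 1"
  proof eventually_elim
    case (elim x)
    then show ?case using ln_eq_minus_one[OF Epos[of x]] by simp
  qed
  \<comment> \<open>The Laplace transform is read off from E at every point, so the almost
    everywhere statement is upgraded by continuity.\<close>
  have contE: "continuous_on UNIV E"
  proof (rule continuous_at_imp_continuous_on, rule ballI)
    fix x :: "real^'d"
    have bdc: "continuous_on UNIV bd"
      unfolding bd_def using \<sigma> q(1)
      by (intro continuous_intros bounded_linear.continuous_on[OF matrix_vector_mul_bounded_linear]) auto
    have "compact (bd ` cball x 1)"
      by (intro compact_continuous_image continuous_on_subset[OF bdc] compact_cball) auto
    then have "bounded (bd ` cball x 1)" by (rule compact_imp_bounded)
    then obtain K where "\<forall>r\<in>bd ` cball x 1. norm r \<le> K" unfolding bounded_iff by blast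
    then have K: "bd z \<le> K" if "z \<in> cball x 1" for z using that by (auto dest: abs_le_D1)
    show "isCont E x"
      unfolding continuous_at_sequentially
    proof (intro allI impI)
      fix X :: "nat \<Rightarrow> real^'d" assume X: "X \<longlonglongrightarrow> x"
      then have "\<forall>\<^sub>F n in sequentially. X n \<in> cball x 1"
        using tendstoD[OF X zero_less_one] by (auto elim!: eventually_mono simp: dist_commute less_imp_le)
      then obtain N where N: "\<And>n. n \<ge> N \<Longrightarrow> X n \<in> cball x 1" by (auto simp: eventually_sequentially)
      have "(\<lambda>n. E (X (n + N))) \<longlonglongrightarrow> E x"
        unfolding E_def
      proof (rule integral_dominated_convergence[where w = "\<lambda>_. K"])
        show "AE y in \<beta>. (\<lambda>n. ?e (X (n + N)) y) \<longlonglongrightarrow> ?e x y"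
        proof (rule AE_I2)
          fix y
          have X': "(\<lambda>n. X (n + N)) \<longlonglongrightarrow> x" using X by (rule LIMSEQ_ignore_initial_segment)
          show "(\<lambda>n. ?e (X (n + N)) y) \<longlonglongrightarrow> ?e x y"
            unfolding gauss_gibbs_def using \<sigma>
            by (intro tendsto_intros X' bounded_linear.tendsto[OF matrix_vector_mul_bounded_linear]) auto
        qed
        show "AE y in \<beta>. norm (?e (X (n + N)) y) \<le> K" for n
        proof (rule AE_I2)
          fix y
          have "?e (X (n + N)) y \<le> K" using e_le[of "X (n + N)" y] K[OF N[of "n + N"]] by simp
          then show "norm (?e (X (n + N)) y) \<le> K" using gauss_gibbs_pos[of \<sigma> \<kappa> a b P Q "X (n + N)" y] by simp
        qed
      qed auto
      then have "(\<lambda>n. E (X n)) \<longlonglongrightarrow> E x" by (rule LIMSEQ_offset)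
      then show "(E \<circ> X) \<longlonglongrightarrow> E x" by (simp add: comp_def)
    qed
  qed
  have Eeq: "E x = 1" for x
    by (rule AE_gaussian_continuous[OF A contE continuous_on_const EAE])
  define \<omega> where "\<omega> y = exp (- ((y - b) \<bullet> (Q *v (y - b))) / (2 * \<sigma>\<^sup>2))" for y
  have \<omega>m [measurable]: "\<omega> \<in> borel_measurable borel" unfolding \<omega>_def by measurable
  have wpos: "0 < \<omega> y" for y by (simp add: \<omega>_def)
  define T where "T \<mu> = density \<mu> (\<lambda>y. ennreal (\<omega> y))" for \<mu>
  have lap: "(\<integral>\<^sup>+y. ennreal (exp (\<xi> \<bullet> y)) \<partial>(T \<mu>))
      = ennreal (exp (\<xi> \<bullet> b) * exp ((((\<sigma>\<^sup>2 *\<^sub>R \<xi>) \<bullet> (P *v (\<sigma>\<^sup>2 *\<^sub>R \<xi>))) - \<kappa>) / (2 * \<sigma>\<^sup>2)))"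
    if [measurable_cong]: "sets \<mu> = sets borel" and m: "\<And>x. (\<integral>\<^sup>+y. ennreal (?e x y) \<partial>\<mu>) = 1" for \<mu> \<xi>
  proof -
    \<comment> \<open>At x = a + u the cross term of the Gibbs exponent is the inner product of
      \<xi> and y - b, so the partial integral there is, up to an explicit factor, the Laplace
      transform at \<xi> of \<omega> times the measure.\<close>
    define u where "u = \<sigma>\<^sup>2 *\<^sub>R \<xi>"
    define c where "c = exp (\<xi> \<bullet> b) * exp ((u \<bullet> (P *v u) - \<kappa>) / (2 * \<sigma>\<^sup>2))"
    have "\<omega> y * exp (\<xi> \<bullet> y) = c * ?e (a + u) y" for y
    proof -
      have "\<xi> \<bullet> y = \<xi> \<bullet> b + 2 * (u \<bullet> (y - b)) / (2 * \<sigma>\<^sup>2)" using \<sigma>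
        by (simp add: u_def inner_diff_right field_simps)
      then have "- ((y - b) \<bullet> (Q *v (y - b))) / (2 * \<sigma>\<^sup>2) + \<xi> \<bullet> y
        = \<xi> \<bullet> b + (u \<bullet> (P *v u) - \<kappa>) / (2 * \<sigma>\<^sup>2)
         + (2 * (u \<bullet> (y - b)) - u \<bullet> (P *v u) - (y - b) \<bullet> (Q *v (y - b)) + \<kappa>) / (2 * \<sigma>\<^sup>2)"
        by (simp add: add_divide_distrib diff_divide_distrib)
      then show ?thesis unfolding \<omega>_def c_def gauss_gibbs_def exp_add[symmetric] by simp
    qed
    then have "(\<integral>\<^sup>+y. ennreal (exp (\<xi> \<bullet> y)) \<partial>(T \<mu>)) = (\<integral>\<^sup>+y. ennreal c * ennreal (?e (a + u) y) \<partial>\<mu>)"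
      unfolding T_def using wpos by (simp add: nn_integral_density ennreal_mult'[symmetric] c_def less_imp_le)
    also have "\<dots> = ennreal c * (\<integral>\<^sup>+y. ennreal (?e (a + u) y) \<partial>\<mu>)" by (rule nn_integral_cmult) measurable
    finally show ?thesis by (simp add: m c_def u_def)
  qed
  have "T \<beta> = T \<gamma>"
  proof (rule laplace_unique)
    have mb: "(\<integral>\<^sup>+y. ennreal (?e x y) \<partial>\<beta>) = 1" for x by (simp add: En Eeq)
    show "(\<integral>\<^sup>+y. ennreal (exp (\<xi> \<bullet> y)) \<partial>(T \<beta>)) < \<infinity>" for \<xi> by (subst lap[OF sb mb]) simp
    show "(\<integral>\<^sup>+y. ennreal (exp (\<xi> \<bullet> y)) \<partial>(T \<beta>)) = (\<integral>\<^sup>+y. ennreal (exp (\<xi> \<bullet> y)) \<partial>(T \<gamma>))" for \<xi>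
      by (subst lap[OF sb mb], subst lap[OF sg m2]) simp
  qed (simp_all add: T_def sb sg)
  moreover have "density (T \<mu>) (\<lambda>y. ennreal (1 / \<omega> y)) = \<mu>" if [measurable_cong]: "sets \<mu> = sets borel" for \<mu>
  proof -
    have "ennreal (\<omega> y) * ennreal (1 / \<omega> y) = 1" for y
      using wpos[of y] by (simp add: ennreal_mult'[symmetric] less_imp_le)
    then show ?thesis unfolding T_def by (subst density_density_eq) (auto simp: density_1)
  qed
  ultimately show ?thesis using sb sg by metis
qed

section \<open>The barycenter\<close>

text \<open>The linear terms cancel because the common centre is the weighted mean of the
  \<open>a k\<close>; this is what singles out the mean of the barycenter.\<close>

lemma sum_quad_potential:
  fixes a :: "'i \<Rightarrow> real^'d" and Q :: "'i \<Rightarrow> real^'d^'d"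
  assumes "sum w I = 1"
  shows "(\<Sum>k\<in>I. w k * quad_potential (\<Sum>k\<in>I. w k *\<^sub>R a k) (a k) (Q k) y)
    = quad_potential (\<Sum>k\<in>I. w k *\<^sub>R a k) (\<Sum>k\<in>I. w k *\<^sub>R a k) (\<Sum>k\<in>I. w k *\<^sub>R Q k) y"
proof -
  define b where "b = (\<Sum>k\<in>I. w k *\<^sub>R a k)"
  define v where "v = y - b"
  have 1: "(\<Sum>k\<in>I. w k * (norm v)\<^sup>2) = (norm v)\<^sup>2"
    using assms by (simp add: sum_distrib_right[symmetric])
  have 2: "(\<Sum>k\<in>I. w k * (v \<bullet> (Q k *v v))) = v \<bullet> ((\<Sum>k\<in>I. w k *\<^sub>R Q k) *v v)"
    by (simp add: sum_matrix_vector_mult inner_sum_right scaleR_matrix_vector_assoc[symmetric])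
  have "(\<Sum>k\<in>I. w k * ((b - a k) \<bullet> v)) = (\<Sum>k\<in>I. w k) * (b \<bullet> v) - (\<Sum>k\<in>I. w k *\<^sub>R a k) \<bullet> v"
    by (simp add: inner_diff_left right_diff_distrib sum_subtractf sum_distrib_right inner_sum_left)
  then have 3: "(\<Sum>k\<in>I. w k * ((b - a k) \<bullet> v)) = 0" using assms by (simp add: b_def)
  have "(\<Sum>k\<in>I. w k * quad_potential b (a k) (Q k) y)
     = (\<Sum>k\<in>I. w k * (norm v)\<^sup>2) - (\<Sum>k\<in>I. w k * (v \<bullet> (Q k *v v))) + 2 * (\<Sum>k\<in>I. w k * ((b - a k) \<bullet> v))"
    by (simp add: quad_potential_def v_def[symmetric] sum.distrib[symmetric] sum_subtractf[symmetric]
        sum_distrib_left algebra_simps)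
  then show ?thesis by (simp add: 1 2 3 b_def[symmetric] quad_potential_def v_def[symmetric])
qed

theorem theorem2:
  fixes \<sigma> :: real and K :: nat
    and a :: "nat \<Rightarrow> real^'d" and A :: "nat \<Rightarrow> real^'d^'d" and w :: "nat \<Rightarrow> real"
  assumes "\<sigma> > 0"
    and "K \<ge> 1"
    and "\<And>k. k \<in> {1..K} \<Longrightarrow> pd (A k)"
    and "\<And>k. k \<in> {1..K} \<Longrightarrow> w k > 0"
    and "(\<Sum>k=1..K. w k) = 1"
  shows "\<exists>B. psd B \<and>
    (\<Sum>k=1..K. w k *\<^sub>R msqrt (msqrt B ** A k ** msqrt B + (\<sigma>^4 / 4) *\<^sub>R mat 1))
      = msqrt (B ** B + (\<sigma>^4 / 4) *\<^sub>R mat 1) \<and>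
    {\<beta>. is_arg_min (\<lambda>\<beta>. \<Sum>k=1..K. ereal (w k) * sinkhorn_div \<sigma> (gaussian (a k) (A k)) \<beta>)
          (\<lambda>\<beta>. \<beta> \<in> subgaussian) \<beta>}
      = {gaussian (\<Sum>k=1..K. w k *\<^sub>R a k) B}"
proof -
  note \<sigma> = assms(1)
  define I where "I = {1..K}"
  have I: "finite I" "1 \<in> I" using assms(2) by (auto simp: I_def)
  note A = assms(3)[folded I_def] and w = assms(4)[folded I_def] and w1 = assms(5)[folded I_def]
  \<comment> \<open>Then s^2 is the \<sigma>^4 / 4 of the equation, and the 2s of the matrix
    identities is \<sigma>^2.\<close>
  define s where "s = \<sigma>\<^sup>2 / 2"
  have s: "s > 0" "2 * s = \<sigma>\<^sup>2" "s\<^sup>2 = \<sigma>^4 / 4" using \<sigma> by (auto simp: s_def power_divide)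
  obtain B where B: "pd B" and Beq: "(\<Sum>k\<in>I. w k *\<^sub>R msqrt (msqrt B ** A k ** msqrt B + s\<^sup>2 *\<^sub>R mat 1))
      = msqrt (B ** B + s\<^sup>2 *\<^sub>R mat 1)"
    using barycenter_equation_solvable[of I A w s, OF I(1) A less_imp_le[OF w] w1] by blast
  have RR: "msqrt B ** msqrt B = B" using msqrt_pd[OF B] by blast
  obtain Ri where Ri: "msqrt B ** Ri = mat 1" "Ri ** msqrt B = mat 1" "pd Ri"
    by (rule pd_inverse[OF msqrt_pd(1)[OF B]]) (rule that)
  define Qf where "Qf X = Ri ** (msqrt (msqrt B ** X ** msqrt B + s\<^sup>2 *\<^sub>R mat 1) - s *\<^sub>R mat 1) ** Ri" for X
  note sch = gaussian_schroedinger_matrices[OF _ B s(1) Ri(2,1,3), folded Qf_def, unfolded s(2)]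
  have BB: "msqrt B ** B ** msqrt B = B ** B" by (metis RR matrix_mul_assoc)
  define Q0 where "Q0 = Qf B"
  have Q0: "pd Q0" "\<sigma>\<^sup>2 *\<^sub>R Q0 + B ** Q0 ** Q0 = B" using sch(1,3)[OF B] by (auto simp: Q0_def)
  \<comment> \<open>Here the equation for B enters: \<open>Qf\<close> is affine in the square root,
    so averaging over k produces the root of B^2 + s^2 Id, the one that belongs to the pair (B,
    B).\<close>
  have Qsum: "(\<Sum>k\<in>I. w k *\<^sub>R Qf (A k)) = Q0"
  proof -
    have "(\<Sum>k\<in>I. w k *\<^sub>R Qf (A k))
      = Ri ** (\<Sum>k\<in>I. w k *\<^sub>R (msqrt (msqrt B ** A k ** msqrt B + s\<^sup>2 *\<^sub>R mat 1) - s *\<^sub>R mat 1)) ** Ri"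
      by (simp add: Qf_def sum_matrix_mult_left sum_matrix_mult_right matrix_scaleR_left matrix_scaleR_right)
    also have "(\<Sum>k\<in>I. w k *\<^sub>R (msqrt (msqrt B ** A k ** msqrt B + s\<^sup>2 *\<^sub>R mat 1) - s *\<^sub>R mat 1))
      = msqrt (B ** B + s\<^sup>2 *\<^sub>R mat 1) - s *\<^sub>R mat 1"
      using w1 by (simp add: scaleR_diff_right sum_subtractf Beq scaleR_left.sum[symmetric]
          sum_distrib_right[symmetric])
    finally show ?thesis by (simp add: Q0_def Qf_def BB)
  qed
  define b where "b = (\<Sum>k\<in>I. w k *\<^sub>R a k)"
  define \<gamma> where "\<gamma> = gaussian b B"
  define \<alpha> where "\<alpha> k = gaussian (a k) (A k)" for k
  have \<alpha>: "\<alpha> k \<in> P2" for k unfolding \<alpha>_def by (rule gaussian_P2)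
  have \<gamma>: "\<gamma> \<in> subgaussian" "\<gamma> \<in> P2" unfolding \<gamma>_def by (rule gaussian_subgaussian gaussian_P2)+
  have \<gamma>p: "prob_space \<gamma>" "sets \<gamma> = sets borel" using P2_D[OF \<gamma>(2)] by auto
  obtain \<kappa>0 where \<kappa>0: "\<And>x. (\<integral>\<^sup>+y. ennreal (gauss_gibbs \<sigma> \<kappa>0 b b Q0 Q0 x y) \<partial>\<gamma>) = 1"
    by (rule gauss_gibbs_marginals[OF \<sigma> B B pd_imp_psd[OF Q0(1)] pd_imp_psd[OF Q0(1)] Q0(2) Q0(2), of b b])
      (rule that, simp add: \<gamma>_def)
  \<comment> \<open>\<kappa>0 is split evenly, so that the same function serves as both potentials
    of the self-transport of \<gamma>.\<close>
  define h where "h x = quad_potential b b Q0 x + \<kappa>0 / 2" for x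
  have hg: "exp ((h x + h y - (norm (x - y))\<^sup>2) / (2 * \<sigma>\<^sup>2)) = gauss_gibbs \<sigma> \<kappa>0 b b Q0 Q0 x y" for x y
    using quad_potential_gibbs[of b b Q0 x \<kappa>0 Q0 y \<sigma>] by (simp add: h_def algebra_simps)
  have H: "(\<integral>\<^sup>+y. ennreal (exp ((h x + h y - (norm (x - y))\<^sup>2) / (2 * \<sigma>\<^sup>2))) \<partial>\<gamma>) = 1" for x
    unfolding hg by (rule \<kappa>0)
  have hi: "integrable \<beta> h" and hint: "(\<integral>x. h x \<partial>\<beta>) = (\<integral>x. quad_potential b b Q0 x \<partial>\<beta>) + \<kappa>0 / 2"
    if "\<beta> \<in> P2" for \<beta>
  proof -
    interpret prob_space \<beta> using P2_D[OF that] by auto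
    show "integrable \<beta> h" "(\<integral>x. h x \<partial>\<beta>) = (\<integral>x. quad_potential b b Q0 x \<partial>\<beta>) + \<kappa>0 / 2"
      unfolding h_def using quad_potential_integrable[OF that] by (auto simp: prob_space)
  qed
  define marg where "marg k P \<kappa> \<longleftrightarrow>
      (\<forall>y. (\<integral>\<^sup>+x. ennreal (gauss_gibbs \<sigma> \<kappa> (a k) b P (Qf (A k)) x y) \<partial>(\<alpha> k)) = 1) \<and>
      (\<forall>x. (\<integral>\<^sup>+y. ennreal (gauss_gibbs \<sigma> \<kappa> (a k) b P (Qf (A k)) x y) \<partial>\<gamma>) = 1)" for k P \<kappa>
  have "\<exists>P \<kappa>. marg k P \<kappa>" if k: "k \<in> I" for k
  proof -
    obtain P where P: "psd P" "\<sigma>\<^sup>2 *\<^sub>R Qf (A k) + A k ** P ** Qf (A k) = A k" "\<sigma>\<^sup>2 *\<^sub>R P + B ** Qf (A k) ** P = B"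
      using sch(2)[OF A[OF k]] by blast
    show ?thesis
      by (rule gauss_gibbs_marginals[OF \<sigma> A[OF k] B P(1) pd_imp_psd[OF sch(1)[OF A[OF k]]] P(2,3), of "a k" b])
        (unfold marg_def \<alpha>_def \<gamma>_def, blast)
  qed
  then obtain P \<kappa> where marg: "\<And>k. k \<in> I \<Longrightarrow> marg k (P k) (\<kappa> k)" by metis
  define f where "f k x = quad_potential (a k) b (P k) x + ((norm (a k - b))\<^sup>2 + \<kappa> k)" for k x
  define g where "g k = quad_potential b (a k) (Qf (A k))" for k
  have fi: "integrable (\<alpha> k) (f k)" for k
  proof -
    interpret prob_space "\<alpha> k" using P2_D[OF \<alpha>] by auto
    show ?thesis unfolding f_def using quad_potential_integrable[OF \<alpha>] by auto
  qed
  have gi: "integrable \<beta> (g k)" if "\<beta> \<in> P2" for k \<beta> unfolding g_def by (rule quad_potential_integrable[OF that])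
  have fg: "exp ((f k x + g k y - (norm (x - y))\<^sup>2) / (2 * \<sigma>\<^sup>2)) = gauss_gibbs \<sigma> (\<kappa> k) (a k) b (P k) (Qf (A k)) x y" for k x y
    unfolding f_def g_def by (rule quad_potential_gibbs)
  have OTr: "OT \<sigma> \<mu> \<nu> = ereal (real_of_ereal (OT \<sigma> \<mu> \<nu>))" if "\<mu> \<in> P2" "\<nu> \<in> P2" for \<mu> \<nu> :: "(real^'d) measure"
    using OT_finite[OF \<sigma> that] by (metis real_of_ereal.simps(1))
  define ot where "ot \<mu> \<nu> = real_of_ereal (OT \<sigma> \<mu> \<nu>)" for \<mu> \<nu> :: "(real^'d) measure"
  have OTr: "OT \<sigma> \<mu> \<nu> = ereal (ot \<mu> \<nu>)" if "\<mu> \<in> P2" "\<nu> \<in> P2" for \<mu> \<nu>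
    unfolding ot_def by (rule OTr[OF that])
  \<comment> \<open>The integral over \<open>\<alpha> k\<close> equals 1 for every y, so the Gibbs
    measure has total mass 1 against every \<beta>, not just \<gamma>.\<close>
  have lower: "(\<integral>x. f k x \<partial>(\<alpha> k)) + (\<integral>y. g k y \<partial>\<beta>) \<le> ot (\<alpha> k) \<beta>" if k: "k \<in> I" and \<beta>: "\<beta> \<in> P2" for k \<beta>
  proof -
    interpret A: prob_space "\<alpha> k" using P2_D[OF \<alpha>] by auto
    interpret B: prob_space \<beta> using P2_D[OF \<beta>] by auto
    interpret AB: pair_sigma_finite "\<alpha> k" \<beta> ..
    note [measurable_cong] = P2_D(2)[OF \<beta>] P2_D(2)[OF \<alpha>, of k]
    have "(\<integral>\<^sup>+x. \<integral>\<^sup>+y. ennreal (gauss_gibbs \<sigma> (\<kappa> k) (a k) b (P k) (Qf (A k)) x y) \<partial>\<beta> \<partial>(\<alpha> k))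
       = (\<integral>\<^sup>+y. \<integral>\<^sup>+x. ennreal (gauss_gibbs \<sigma> (\<kappa> k) (a k) b (P k) (Qf (A k)) x y) \<partial>(\<alpha> k) \<partial>\<beta>)"
      by (rule AB.Fubini'[symmetric]) measurable
    also have "\<dots> = 1" using marg[OF k] by (simp add: marg_def B.emeasure_space_1)
    finally show ?thesis
      using OT_lower[OF \<sigma> \<alpha> \<beta> fi gi[OF \<beta>], of k k] by (simp add: fg OTr[OF \<alpha> \<beta>])
  qed
  have upper: "ot (\<alpha> k) \<gamma> \<le> (\<integral>x. f k x \<partial>(\<alpha> k)) + (\<integral>y. g k y \<partial>\<gamma>)" if k: "k \<in> I" for k
  proof -
    interpret A: prob_space "\<alpha> k" using P2_D[OF \<alpha>] by auto
    have "OT \<sigma> (\<alpha> k) \<gamma> \<le> ereal ((\<integral>x. f k x \<partial>(\<alpha> k)) + (\<integral>y. g k y \<partial>\<gamma>))"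
      using marg[OF k] by (intro OT_upper[OF \<sigma> \<alpha> \<gamma>(2) fi gi[OF \<gamma>(2)], of "\<lambda>_. 1"])
        (auto simp: fg marg_def A.emeasure_space_1)
    then show ?thesis by (simp add: OTr[OF \<alpha> \<gamma>(2)])
  qed
  have self_le: "ot \<beta> \<beta> \<le> 2 * (\<integral>x. quad_potential b b Q0 x \<partial>\<beta>) + \<kappa>0" if \<beta>: "\<beta> \<in> P2" for \<beta>
    using OT_self_le[OF \<sigma> \<beta> \<gamma>p hi[OF \<beta>] H] by (simp add: OTr[OF \<beta> \<beta>] hint[OF \<beta>])
  have self_ge: "2 * (\<integral>x. quad_potential b b Q0 x \<partial>\<gamma>) + \<kappa>0 \<le> ot \<gamma> \<gamma>"
    using OT_lower[OF \<sigma> \<gamma>(2) \<gamma>(2) hi[OF \<gamma>(2)] hi[OF \<gamma>(2)]] prob_space.emeasure_space_1[OF \<gamma>p(1)]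
    by (simp add: H OTr[OF \<gamma>(2) \<gamma>(2)] hint[OF \<gamma>(2)])
  have gsum: "(\<Sum>k\<in>I. w k * (\<integral>y. g k y \<partial>\<beta>)) = (\<integral>x. quad_potential b b Q0 x \<partial>\<beta>)" if \<beta>: "\<beta> \<in> P2" for \<beta>
  proof -
    have "(\<Sum>k\<in>I. w k * (\<integral>y. g k y \<partial>\<beta>)) = (\<integral>y. (\<Sum>k\<in>I. w k * g k y) \<partial>\<beta>)"
      using gi[OF \<beta>] by (subst Bochner_Integration.integral_sum) auto
    also have "(\<lambda>y. \<Sum>k\<in>I. w k * g k y) = quad_potential b b Q0"
      unfolding g_def b_def using sum_quad_potential[OF w1, of a "\<lambda>k. Qf (A k)"] by (simp add: fun_eq_iff Qsum)
    finally show ?thesis .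
  qed
  define F where "F \<beta> = (\<Sum>k\<in>I. ereal (w k) * sinkhorn_div \<sigma> (\<alpha> k) \<beta>)" for \<beta>
  define C where "C = (\<Sum>k\<in>I. w k * (1/2 * ot (\<alpha> k) (\<alpha> k)))"
  \<comment> \<open>All costs are finite on \<open>P2\<close>, so the extended-real objective is
    this real functional there and no difference of infinities arises.\<close>
  define \<Phi> where "\<Phi> \<beta> = (\<Sum>k\<in>I. w k * ot (\<alpha> k) \<beta>) - C - 1/2 * ot \<beta> \<beta>" for \<beta>
  have F: "F \<beta> = ereal (\<Phi> \<beta>)" if \<beta>: "\<beta> \<in> P2" for \<beta>
  proof -
    have "F \<beta> = ereal (\<Sum>k\<in>I. w k * (ot (\<alpha> k) \<beta> - 1/2 * (ot (\<alpha> k) (\<alpha> k) + ot \<beta> \<beta>)))"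
      unfolding F_def sinkhorn_div_def by (simp add: OTr \<alpha> \<beta>)
    also have "(\<Sum>k\<in>I. w k * (ot (\<alpha> k) \<beta> - 1/2 * (ot (\<alpha> k) (\<alpha> k) + ot \<beta> \<beta>)))
       = (\<Sum>k\<in>I. w k * ot (\<alpha> k) \<beta>) - C - (\<Sum>k\<in>I. w k) * (1/2 * ot \<beta> \<beta>)"
      unfolding C_def sum_distrib_right sum_subtractf[symmetric] by (intro sum.cong) (auto simp: algebra_simps)
    finally show ?thesis using w1 by (simp add: \<Phi>_def)
  qed
  define fs where "fs = (\<Sum>k\<in>I. w k * (\<integral>x. f k x \<partial>(\<alpha> k)))"
  have wsum: "(\<Sum>k\<in>I. w k * ((\<integral>x. f k x \<partial>(\<alpha> k)) + (\<integral>y. g k y \<partial>\<beta>))) = fs + (\<integral>x. quad_potential b b Q0 x \<partial>\<beta>)"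
    if "\<beta> \<in> P2" for \<beta>
    by (simp add: distrib_left sum.distrib fs_def gsum[OF that])
  \<comment> \<open>The averaged potential of the pairs is the quadratic part of h, so its integral
    cancels against half the bound \<open>self_le\<close>, leaving a constant independent of
    \<beta>.\<close>
  have Phi_ge: "fs - C - \<kappa>0 / 2 \<le> \<Phi> \<beta>" if \<beta>: "\<beta> \<in> P2" for \<beta>
  proof -
    have "fs + (\<integral>x. quad_potential b b Q0 x \<partial>\<beta>) \<le> (\<Sum>k\<in>I. w k * ot (\<alpha> k) \<beta>)"
      unfolding wsum[OF \<beta>, symmetric] using w by (intro sum_mono mult_left_mono lower \<beta>) (auto intro: less_imp_le)
    then show ?thesis using self_le[OF \<beta>] unfolding \<Phi>_def by simp
  qed
  have Phi_le: "\<Phi> \<gamma> \<le> fs - C - \<kappa>0 / 2"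
  proof -
    have "(\<Sum>k\<in>I. w k * ot (\<alpha> k) \<gamma>) \<le> fs + (\<integral>x. quad_potential b b Q0 x \<partial>\<gamma>)"
      unfolding wsum[OF \<gamma>(2), symmetric] using w by (intro sum_mono mult_left_mono upper) (auto intro: less_imp_le)
    then show ?thesis using self_ge unfolding \<Phi>_def by simp
  qed
  have P2: "\<beta> \<in> P2" if "\<beta> \<in> subgaussian" for \<beta> :: "(real^'d) measure" using that by (simp add: subgaussian_def)
  have min: "is_arg_min F (\<lambda>\<beta>. \<beta> \<in> subgaussian) \<gamma>"
    unfolding is_arg_min_linorder using \<gamma> F Phi_ge Phi_le P2 by (metis ereal_less_eq(3) order_trans)
  have unique: "\<beta> = \<gamma>" if \<beta>: "is_arg_min F (\<lambda>\<beta>. \<beta> \<in> subgaussian) \<beta>" for \<beta>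
  proof -
    have \<beta>2: "\<beta> \<in> P2" using \<beta> P2 by (auto simp: is_arg_min_def)
    have "F \<beta> \<le> F \<gamma>" using \<beta> \<gamma>(1) by (auto simp: is_arg_min_linorder)
    then have "\<Phi> \<beta> \<le> fs - C - \<kappa>0 / 2" using Phi_le by (simp add: F \<beta>2 \<gamma>(2))
    then have "(\<Sum>k\<in>I. w k * ot (\<alpha> k) \<beta>) \<le> fs + (\<integral>x. quad_potential b b Q0 x \<partial>\<beta>)"
      using self_le[OF \<beta>2] unfolding \<Phi>_def by simp
    \<comment> \<open>Weighted duality gaps: each is nonnegative and their sum is at most 0. A
      single vanishing gap determines \<beta>, and index 1 exists because K \<ge> 1.\<close>
    moreover define t where "t k = w k * (ot (\<alpha> k) \<beta> - ((\<integral>x. f k x \<partial>(\<alpha> k)) + (\<integral>y. g k y \<partial>\<beta>)))" for k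
    ultimately have "sum t I \<le> 0"
      unfolding t_def wsum[OF \<beta>2, symmetric] by (simp add: right_diff_distrib sum_subtractf)
    moreover have "0 \<le> t k" if "k \<in> I" for k
      using w[OF that] lower[OF that \<beta>2] by (simp add: t_def)
    ultimately have "t 1 \<le> 0"
      using member_le_sum[of 1 I t] I by force
    then have "w 1 * (ot (\<alpha> 1) \<beta> - ((\<integral>x. f 1 x \<partial>(\<alpha> 1)) + (\<integral>y. g 1 y \<partial>\<beta>))) \<le> 0" by (simp add: t_def)
    then have "ot (\<alpha> 1) \<beta> \<le> (\<integral>x. f 1 x \<partial>(\<alpha> 1)) + (\<integral>y. g 1 y \<partial>\<beta>)"
      using w[OF I(2)] by (simp add: mult_le_0_iff)
    then have le: "OT \<sigma> (gaussian (a 1) (A 1)) \<beta> \<le>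
        ereal ((\<integral>x. quad_potential (a 1) b (P 1) x + ((norm (a 1 - b))\<^sup>2 + \<kappa> 1) \<partial>(gaussian (a 1) (A 1)))
          + (\<integral>y. quad_potential b (a 1) (Qf (A 1)) y \<partial>\<beta>))"
      using OTr[OF \<alpha> \<beta>2, of 1] by (simp add: f_def g_def \<alpha>_def)
    show ?thesis
      by (rule gauss_potentials_determine_measure[OF \<sigma> A[OF I(2)] sch(1)[OF A[OF I(2)]] \<beta>2 \<gamma>p(2) _ _ le])
        (use marg[OF I(2)] in \<open>auto simp: marg_def \<alpha>_def\<close>)
  qed
  have argmin: "{\<beta>. is_arg_min F (\<lambda>\<beta>. \<beta> \<in> subgaussian) \<beta>} = {\<gamma>}" using min unique by blast
  show ?thesis
  proof (intro exI[of _ B] conjI)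
    show "psd B" using B by (rule pd_imp_psd)
    show "(\<Sum>k=1..K. w k *\<^sub>R msqrt (msqrt B ** A k ** msqrt B + (\<sigma>^4 / 4) *\<^sub>R mat 1))
      = msqrt (B ** B + (\<sigma>^4 / 4) *\<^sub>R mat 1)"
      using Beq unfolding s(3) I_def .
    show "{\<beta>. is_arg_min (\<lambda>\<beta>. \<Sum>k=1..K. ereal (w k) * sinkhorn_div \<sigma> (gaussian (a k) (A k)) \<beta>)
          (\<lambda>\<beta>. \<beta> \<in> subgaussian) \<beta>} = {gaussian (\<Sum>k=1..K. w k *\<^sub>R a k) B}"
      using argmin unfolding F_def[abs_def] \<alpha>_def \<gamma>_def b_def I_def .
  qed
qed

end
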